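(* We have $\mathrm{ex}_{\mathrm{rand}}(n,2,\{K_3,K_{2,3}\}) \ge \left(\frac{1}{2}-o(1)\right)n^{3/2}$, where $o(1)\to 0$ as $n\to\infty$.
   Context: Graphs are finite and simple. $K_3$ is the triangle and $K_{2,3}$ is the complete bipartite graph with parts of sizes $2$ and $3$. For a graph $G$ and $X,Y\subset V(G)$, $e(X,Y)$ is the number of edges of $G$ with one vertex in $X$ and one vertex in $Y$, where edges with both vertices in $X\cap Y$ are counted twice. For real numbers $p\in[0,1]$ and $\alpha\ge 0$, $G$ is $(p,\alpha)$-jumbled if $\left|e(X,Y)-p|X||Y|\right|\le \alpha\sqrt{|X||Y|}$ for all $X,Y\subset V(G)$. A graph is $\mathcal{F}$-free, for a family $\mathcal{F}$ of graphs, if it contains no member of $\mathcal{F}$ as a (not necessarily induced) subgraph. For $C>0$, $\mathrm{ex}_{\mathrm{rand}}(n,C,\mathcal{F})$ is the maximum number of edges in an $n$-vertex $\mathcal{F}$-free graph that is $(p,\alpha)$-jumbled for some $p\in[0,1]$ and some $\alpha\ge 0$ with $\alpha\le C\sqrt{np}$ (there is no restriction on $p$). *)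

theory Defs
  imports Complex_Main "HOL-Library.Landau_Symbols"
begin

record 'a ugraph =
  vertices :: "'a set"
  edges :: "'a set set"

definition simple_graph :: "'a ugraph \<Rightarrow> bool" where
  "simple_graph G \<longleftrightarrow>
     finite (vertices G) \<and> (\<forall>e\<in>edges G. e \<subseteq> vertices G \<and> card e = 2)"

definition complete_graph :: "'a set \<Rightarrow> 'a ugraph" where
  "complete_graph A = \<lparr>vertices = A, edges = {e. e \<subseteq> A \<and> card e = 2}\<rparr>"

text \<open>The parts \<open>A\<close> and \<open>B\<close> are meant to be disjoint.\<close>

definition complete_bipartite_graph :: "'a set \<Rightarrow> 'a set \<Rightarrow> 'a ugraph" where
  "complete_bipartite_graph A B =
     \<lparr>vertices = A \<union> B, edges = {{a, b} | a b. a \<in> A \<and> b \<in> B}\<rparr>"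

definition K3 :: "nat ugraph" where
  "K3 = complete_graph {0, 1, 2}"

definition K23 :: "nat ugraph" where
  "K23 = complete_bipartite_graph {0, 1} {2, 3, 4}"

text \<open>Subgraph containment up to isomorphism, not necessarily induced.\<close>

definition contains_subgraph :: "'a ugraph \<Rightarrow> 'b ugraph \<Rightarrow> bool" where
  "contains_subgraph G H \<longleftrightarrow>
     (\<exists>f. inj_on f (vertices H) \<and> f ` vertices H \<subseteq> vertices G \<and>
          (\<forall>e\<in>edges H. f ` e \<in> edges G))"

definition family_free :: "'b ugraph set \<Rightarrow> 'a ugraph \<Rightarrow> bool" where
  "family_free F G \<longleftrightarrow> (\<forall>H\<in>F. \<not> contains_subgraph G H)"

text \<open>The second summand makes the edges inside \<open>X \<inter> Y\<close> count twice.\<close>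

definition edge_count :: "'a ugraph \<Rightarrow> 'a set \<Rightarrow> 'a set \<Rightarrow> nat" where
  "edge_count G X Y =
     card {e \<in> edges G. \<exists>x\<in>X. \<exists>y\<in>Y. e = {x, y}} + card {e \<in> edges G. e \<subseteq> X \<inter> Y}"

definition jumbled :: "real \<Rightarrow> real \<Rightarrow> 'a ugraph \<Rightarrow> bool" where
  "jumbled p \<alpha> G \<longleftrightarrow>
     (\<forall>X Y. X \<subseteq> vertices G \<longrightarrow> Y \<subseteq> vertices G \<longrightarrow>
        \<bar>real (edge_count G X Y) - p * real (card X) * real (card Y)\<bar>
          \<le> \<alpha> * sqrt (real (card X) * real (card Y)))"

text \<open>Every \<open>n\<close>-vertex graph is isomorphic to one with vertex set \<open>{..<n}\<close>, so it suffices to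
  range over those.\<close>

definition ex_rand_graphs :: "nat \<Rightarrow> real \<Rightarrow> 'b ugraph set \<Rightarrow> nat ugraph set" where
  "ex_rand_graphs n C F =
     {G. simple_graph G \<and> vertices G = {..<n} \<and> family_free F G \<and>
         (\<exists>p \<alpha>. 0 \<le> p \<and> p \<le> 1 \<and> 0 \<le> \<alpha> \<and> \<alpha> \<le> C * sqrt (real n * p) \<and> jumbled p \<alpha> G)}"

definition ex_rand :: "nat \<Rightarrow> real \<Rightarrow> 'b ugraph set \<Rightarrow> nat" where
  "ex_rand n C F = Max ((\<lambda>G. card (edges G)) ` ex_rand_graphs n C F)"

text \<open>The maximum is over a finite set, which is nonempty for the family of interest.\<close>

lemma finite_ex_rand_graphs: "finite ((\<lambda>G. card (edges G)) ` ex_rand_graphs n C F)"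
proof -
  have "edges ` ex_rand_graphs n C F \<subseteq> Pow (Pow {..<n})"
    by (auto simp: ex_rand_graphs_def simple_graph_def)
  then have "finite (edges ` ex_rand_graphs n C F)"
    by (rule finite_subset) simp
  then have "finite (card ` edges ` ex_rand_graphs n C F)"
    by (rule finite_imageI)
  then show ?thesis
    by (simp add: image_image)
qed

lemma ex_rand_graphs_K3_K23_nonempty: "ex_rand_graphs n C {K3, K23} \<noteq> {}"
proof -
  let ?G = "\<lparr>vertices = {..<n}, edges = {}\<rparr> :: nat ugraph"
  have "{0, 1} \<in> edges K3"
    by (simp add: K3_def complete_graph_def)
  moreover have "{0, 2} \<in> edges K23"
    by (auto simp: K23_def complete_bipartite_graph_def)
  ultimately have "family_free {K3, K23} ?G"
    by (auto simp: family_free_def contains_subgraph_def)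
  moreover have "jumbled 0 0 ?G"
    by (simp add: jumbled_def edge_count_def)
  ultimately have "?G \<in> ex_rand_graphs n C {K3, K23}"
    unfolding ex_rand_graphs_def simple_graph_def
    by (auto intro!: exI[of _ "0::real"])
  then show ?thesis by blast
qed

lemma edge_count_eq_card_pairs:
  assumes "simple_graph G" "X \<subseteq> vertices G" "Y \<subseteq> vertices G"
  shows "edge_count G X Y = card {(x, y). x \<in> X \<and> y \<in> Y \<and> {x, y} \<in> edges G}"
proof -
  let ?P = "{(x, y). x \<in> X \<and> y \<in> Y \<and> {x, y} \<in> edges G}"
  let ?h = "\<lambda>(x, y). {x, y}"
  let ?A = "{e \<in> edges G. \<exists>x\<in>X. \<exists>y\<in>Y. e = {x, y}}"
  let ?B = "{e \<in> edges G. e \<subseteq> X \<inter> Y}"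
  have finV: "finite (vertices G)" and sg: "\<And>e. e \<in> edges G \<Longrightarrow> e \<subseteq> vertices G \<and> card e = 2"
    using assms(1) by (auto simp: simple_graph_def)
  have finE: "finite (edges G)"
    by (rule finite_subset[of _ "Pow (vertices G)"]) (use finV sg in auto)
  have finA: "finite ?A" using finE by auto
  have BA: "?B \<subseteq> ?A"
  proof
    fix e assume e: "e \<in> ?B"
    then have "card e = 2" using sg by blast
    then obtain u v where "e = {u, v}" by (auto simp: card_2_iff)
    then show "e \<in> ?A" using e by auto
  qed
  have finXY: "finite X" "finite Y" using assms finV finite_subset by blast+
  have finP: "finite ?P"
    by (rule finite_subset[of _ "X \<times> Y"]) (use finXY in auto)
  have img: "?h ` ?P = ?A" by auto
  have fib: "card {q \<in> ?P. ?h q = e} = 1 + (if e \<in> ?B then 1 else 0)" if eA: "e \<in> ?A" for e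
  proof -
    obtain x y where xy: "x \<in> X" "y \<in> Y" "e = {x, y}" and eE: "e \<in> edges G"
      using eA by blast
    have ne: "x \<noteq> y" using eE sg[of e] xy(3) by fastforce
    have iff: "(a, b) \<in> {q \<in> ?P. ?h q = e} \<longleftrightarrow> a \<in> X \<and> b \<in> Y \<and> (a = x \<and> b = y \<or> a = y \<and> b = x)"
      for a b
    proof -
      have "(a, b) \<in> {q \<in> ?P. ?h q = e} \<longleftrightarrow> a \<in> X \<and> b \<in> Y \<and> {a, b} \<in> edges G \<and> {a, b} = e"
        by simp
      also have "\<dots> \<longleftrightarrow> a \<in> X \<and> b \<in> Y \<and> {a, b} = e" using eE by blast
      also have "\<dots> \<longleftrightarrow> a \<in> X \<and> b \<in> Y \<and> (a = x \<and> b = y \<or> a = y \<and> b = x)"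
        by (simp only: xy(3) doubleton_eq_iff)
      finally show ?thesis .
    qed
    have B: "e \<in> ?B \<longleftrightarrow> y \<in> X \<and> x \<in> Y" using eE xy by blast
    show ?thesis
    proof (cases "e \<in> ?B")
      case True
      have "{q \<in> ?P. ?h q = e} = {(x, y), (y, x)}"
      proof (rule set_eqI)
        fix q show "q \<in> {q \<in> ?P. ?h q = e} \<longleftrightarrow> q \<in> {(x, y), (y, x)}"
          by (cases q, simp only: iff, use True B xy in blast)
      qed
      then have "card {q \<in> ?P. ?h q = e} = 2" using ne by (simp only:) simp
      then show ?thesis using True by simp
    next
      case False
      have "{q \<in> ?P. ?h q = e} = {(x, y)}"
      proof (rule set_eqI)
        fix q show "q \<in> {q \<in> ?P. ?h q = e} \<longleftrightarrow> q \<in> {(x, y)}"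
          by (cases q, simp only: iff, use False B xy in blast)
      qed
      then have "card {q \<in> ?P. ?h q = e} = 1" by (simp only:) simp
      then show ?thesis using False by (simp only: if_False)
    qed
  qed
  have "card ?P = (\<Sum>e\<in>?A. card {q \<in> ?P. ?h q = e})"
    using sum.image_gen[OF finP, of "\<lambda>_. 1::nat" ?h] img by simp
  also have "\<dots> = (\<Sum>e\<in>?A. 1 + (if e \<in> ?B then 1 else 0))"
    by (rule sum.cong[OF refl fib])
  also have "\<dots> = card ?A + (\<Sum>e\<in>?A. if e \<in> ?B then 1 else 0)"
    by (simp only: sum.distrib card_eq_sum)
  also have "(\<Sum>e\<in>?A. if e \<in> ?B then 1 else 0) = card (?A \<inter> ?B)"
    using sum.inter_restrict[OF finA, of "\<lambda>_. 1::nat" ?B] by (simp only: card_eq_sum)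
  also have "?A \<inter> ?B = ?B" using BA by blast
  finally show ?thesis by (simp only: edge_count_def)
qed

end

theory Submission
  imports Defs "HOL-Complex_Analysis.Complex_Analysis" "HOL-Number_Theory.Number_Theory"
    "HOL-Real_Asymp.Real_Asymp"
begin

text \<open>
  Let \<open>q = 2h + 1\<close> be a prime and \<open>X = {1..h}\<close>, a set of representatives of the nonzero residues up to
  sign. On the \<open>q(q - 1)\<close> triples \<open>(s, m, t)\<close> with \<open>s = \<plusminus>1\<close>, \<open>m \<in> X\<close> and \<open>t\<close> modulo \<open>q\<close>, join \<open>(s, m, t)\<close> to
  \<open>(s', m', t')\<close> if \<open>m \<noteq> m'\<close>, \<open>m m' (t' - t) \<equiv> \<plusminus>1\<close> and \<open>s s' = e(m, m')\<close>, for a sign function \<open>e\<close> on the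
  pairs of \<open>X\<close>. Two vertices then have at most two common neighbours. In a triangle some signed sum of
  the three coordinates \<open>m\<close> vanishes modulo \<open>q\<close>, so there is none if \<open>e\<close> has product \<open>-1\<close> on every such
  Schur triple.

  Fourier analysis in \<open>t\<close> turns the adjacency matrix into the matrices \<open>cos(2\<pi>b/(m m'q))\<close>, of norm at
  most \<open>\<surd>q / 2\<close> for \<open>b \<noteq> 0\<close>, and their entrywise products with \<open>e\<close>. For \<open>e\<close> uniform among the admissible
  sign functions, the expected trace of a high power of such a product counts closed walks whose odd
  edge set is the boundary modulo 2 of a set of Schur triples. The empty boundary dominates, which gives
  norm about \<open>\<surd>(2q)\<close> as for independent signs. The two contributions add up to less than \<open>2\<surd>q\<close>, with
  room to pass to induced subgraphs on a \<open>1 - o(1)\<close> proportion of the vertices. Primes \<open>q\<close> with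
  \<open>q(q - 1)\<close> just above a given \<open>n\<close> exist because \<open>\<zeta>\<close> has no zero on the line \<open>Re s = 1\<close>; testing
  \<open>-\<zeta>'/\<zeta> - \<zeta>\<close> against a Fejer kernel yields this without the full prime number theorem.
\<close>

section \<open>Walks with a prescribed odd edge set\<close>

text \<open>With \<open>p = 1/q\<close> and about \<open>q^2\<close> vertices the allowed error is
  about \<open>2 * sqrt q\<close>. Functions on the vertices split into those even and those odd in
  the sign s, with norms about \<open>sqrt q / 2\<close> and \<open>sqrt (2 q)\<close>. Their sum
  fits, as \<open>1/2 + sqrt 2 < 1.915\<close>, but twice the larger norm would not: what saves the
  bound is that the odd part of an indicator carries at most half of the mass.

  The obstacle is that the signs are dependent, so that nonempty sets of Schur triples contribute to
  the expected trace. Two facts control them. Every vertex of such a set lies on its boundary, so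
  the boundary determines the set and the sign conditions are independent. And the vertices of a
  boundary with f edges can be listed so that, apart from one per component, at most
  \<open>f/3\<close> of them are chosen freely, the others being determined up to few choices by
  earlier ones. Naming the set thus costs about \<open>h^(f/3)\<close>, while leaving f edges open
  costs the walk \<open>h^(f/2)\<close>. The remaining \<open>h^(-1/6)\<close> per edge beats all
  powers of the walk length, which is logarithmic.\<close>

definition toggle :: "'b \<Rightarrow> 'b set \<Rightarrow> 'b set" where
  "toggle e Z = (if e \<in> Z then Z - {e} else insert e Z)"

text \<open>The number of \<open>n\<close>-step walks from \<open>v\<close> to \<open>r\<close> that use exactly the edges of \<open>Z\<close> an odd number of
  times.\<close>

fun walks :: "'a set \<Rightarrow> 'a \<Rightarrow> nat \<Rightarrow> 'a set set \<Rightarrow> 'a \<Rightarrow> nat" where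
  "walks X r 0 Z v = (if Z = {} \<and> v = r then 1 else 0)"
| "walks X r (Suc n) Z v = (\<Sum>w\<in>X - {v}. walks X r n (toggle {v, w} Z) w)"

definition edges_on :: "'a set \<Rightarrow> 'a set set" where
  "edges_on X = {e. e \<subseteq> X \<and> card e = 2}"

lemma edges_onI: "x \<in> X \<Longrightarrow> y \<in> X \<Longrightarrow> x \<noteq> y \<Longrightarrow> {x, y} \<in> edges_on X"
  by (simp add: edges_on_def)

lemma finite_edges_on: "finite X \<Longrightarrow> finite (edges_on X)"
  by (rule finite_subset[of _ "Pow X"]) (auto simp: edges_on_def)

lemma finite_toggle [simp]: "finite (toggle e Z) \<longleftrightarrow> finite Z"
  by (simp add: toggle_def)

lemma card_toggle:
  assumes "finite Z"
  shows "card (toggle e Z) = (if e \<in> Z then card Z - 1 else card Z + 1)"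
  using assms by (simp add: toggle_def)

text \<open>A step changes the number of open edges by exactly one, so \<open>card Z\<close> steps
  are necessary to close them all.\<close>

lemma walks_eq_0:
  "finite X \<Longrightarrow> finite Z \<Longrightarrow> n < card Z \<Longrightarrow> walks X r n Z v = 0"
proof (induction n arbitrary: Z v)
  case (Suc n)
  have "walks X r n (toggle {v, w} Z) w = 0" for w
    using Suc.prems by (intro Suc.IH) (auto simp: card_toggle)
  then show ?case by simp
qed auto

text \<open>An edge of \<open>Z\<close> is open. A step to a new vertex recolours it, a step between old vertices merges two
  colours; the factor \<open>\<theta>\<close>, of order \<open>K\<^sup>3 / card X\<close>, is what the walk pays for each colour of open edges
  that it still has to reach.\<close>

lemma walks_bound:
  fixes \<kappa> \<theta> s :: real and f :: "'a \<Rightarrow> 'c"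
  assumes X: "finite X" and K: "real K \<le> \<kappa>" "1 \<le> K" and th: "0 < \<theta>" "\<theta> \<le> 1"
    and s: "0 < s" "real (card X) + 2 * real K * \<kappa> / \<theta> \<le> s\<^sup>2"
  shows "Z \<subseteq> edges_on X \<Longrightarrow> v \<in> X \<Longrightarrow> (\<And>a b. {a, b} \<in> Z \<Longrightarrow> f a = f b) \<Longrightarrow> card Z \<le> n \<Longrightarrow> n \<le> K \<Longrightarrow>
    real (walks X r n Z v) \<le> 2 ^ n * s ^ (n - card Z) * (\<kappa> ^ (card Z + 1) / \<kappa> ^ card (insert v (\<Union>Z)))
       * \<theta> ^ card (f ` \<Union>Z - {f v})"
proof (induction n arbitrary: Z v f)
  case 0
  have "finite Z" using 0 X finite_edges_on finite_subset by blast
  with 0 have "Z = {}" by simp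
  moreover have "\<kappa> \<noteq> 0" using K by auto
  ultimately show ?case by simp
next
  case (Suc n)
  note IH = Suc.IH
  have kpos: "1 \<le> \<kappa>" using K by linarith
  have k0: "\<kappa> > 0" using kpos by simp
  have finZ: "finite Z" by (rule finite_subset[OF Suc.prems(1) finite_edges_on[OF X]])
  have ZX: "\<Union>Z \<subseteq> X"
  proof (rule Union_least)
    show "e \<subseteq> X" if "e \<in> Z" for e using subsetD[OF Suc.prems(1) that] by (simp add: edges_on_def)
  qed
  have finV: "finite (\<Union>Z)" by (rule finite_subset[OF ZX X])
  have finU: "finite (\<Union>(Z - E))" for E
    by (rule finite_subset[OF Union_mono[OF Diff_subset] finV])
  define V where "V = \<Union>Z"
  define q where "q = card (insert v V)"
  define c where "c = card (f ` V - {f v})"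
  \<comment> \<open>Steps of kind A close an open edge, kind B opens an edge to a vertex already in
    use, kind C opens one to a fresh vertex. Opening lowers the exponent of s by 2, so B and C
    together have a factor \<open>s^2\<close> to spend: C needs \<open>card X\<close> choices, and B
    at most \<open>2 K\<close> choices of weight \<kappa>/\<theta> each.\<close>
  define A where "A = {w \<in> X - {v}. {v, w} \<in> Z}"
  define B where "B = {w \<in> X - {v}. {v, w} \<notin> Z \<and> w \<in> V}"
  define C where "C = {w \<in> X - {v}. w \<notin> V}"
  have finV': "finite V" using finV V_def by simp
  have part: "X - {v} = A \<union> B \<union> C" "A \<inter> B = {}" "(A \<union> B) \<inter> C = {}" "finite A" "finite B" "finite C"
    using X by (auto simp: A_def B_def C_def V_def)
  let ?R = "\<lambda>m::nat. 2 ^ n * s ^ m * (\<kappa> ^ (card Z + 1) / \<kappa> ^ q) * \<theta> ^ c"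
  let ?W = "\<lambda>w. real (walks X r n (toggle {v, w} Z) w)"
  have Rnn: "?R m \<ge> 0" for m using s th k0 by simp
  have cardA: "card A \<le> card Z"
  proof -
    have "inj_on (\<lambda>w. {v, w}) A" by (auto simp: inj_on_def doubleton_eq_iff A_def)
    moreover have "(\<lambda>w. {v, w}) ` A \<subseteq> Z" by (auto simp: A_def)
    ultimately show ?thesis using finZ by (metis card_inj_on_le)
  qed
  have cardV: "card V \<le> 2 * card Z"
  proof -
    have "card (\<Union>Z) \<le> (\<Sum>e\<in>Z. card e)" by (rule card_Union_le_sum_card)
    also have "\<dots> = (\<Sum>e\<in>Z. 2)" using Suc.prems(1) by (intro sum.cong) (auto simp: edges_on_def)
    finally show ?thesis by (simp add: V_def)
  qed
  \<comment> \<open>closing an open edge: ambiguous only if \<open>v\<close> carries a second open edge, which lowers the exponent of \<open>\<kappa>\<close>\<close>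
  have sumA: "(\<Sum>w\<in>A. ?W w) \<le> ?R (Suc n - card Z)"
  proof (cases "A = {}")
    case True
    then show ?thesis using Rnn by simp
  next
    case False
    have step: "?W w \<le> 2 ^ n * s ^ (Suc n - card Z) * (\<kappa> ^ card Z / \<kappa> ^ card (insert w (\<Union>(Z - {{v,w}})))) * \<theta> ^ c" 
      if w: "w \<in> A" for w
    proof -
      have e: "{v, w} \<in> Z" and wv: "w \<noteq> v" "w \<in> X" using w by (auto simp: A_def)
      have tg: "toggle {v, w} Z = Z - {{v, w}}" using e by (simp add: toggle_def)
      have cz: "card Z \<ge> 1" using e finZ by (auto simp: Suc_le_eq card_gt_0_iff)
      have cd: "card (Z - {{v, w}}) = card Z - 1" using e finZ by simp
      have fv: "f v = f w" using Suc.prems(3) e by blast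
      \<comment> \<open>The closed edge joins two vertices of the colour of v, so a vertex of any
        other colour keeps all its edges.\<close>
      have col: "f ` \<Union>(Z - {{v, w}}) - {f w} = f ` V - {f v}"
      proof -
        have "x \<in> \<Union>(Z - {{v, w}})" if "x \<in> V" "f x \<noteq> f v" for x
        proof -
          from that obtain e where e: "e \<in> Z" "x \<in> e" by (auto simp: V_def)
          then have "e \<noteq> {v, w}" using that fv by auto
          then show ?thesis using e by blast
        qed
        then show ?thesis using fv by (auto simp: V_def)
      qed
      have "?W w \<le> 2 ^ n * s ^ (n - card (Z - {{v, w}})) * (\<kappa> ^ (card (Z - {{v, w}}) + 1) / \<kappa> ^ card (insert w (\<Union>(Z - {{v,w}})))) * \<theta> ^ card (f ` \<Union>(Z - {{v,w}}) - {f w})"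
        unfolding tg by (rule IH) (use Suc.prems wv cd in auto)
      moreover have "n - card (Z - {{v, w}}) = Suc n - card Z" "card (Z - {{v, w}}) + 1 = card Z" using cd cz by auto
      ultimately show ?thesis by (simp only: col c_def)
    qed
    from False obtain w0 where w0: "w0 \<in> A" by blast
    have vV: "v \<in> V" using w0 by (auto simp: A_def V_def)
    have qV: "q = card V" using vV by (simp add: q_def insert_absorb)
    have cz: "card Z \<ge> 1" using w0 finZ by (auto simp: A_def Suc_le_eq card_gt_0_iff)
    show ?thesis
    proof (cases "card A = 1")
      case True
      then have Aw: "A = {w0}" using w0 by (metis card_1_singletonE singletonD)
      have u: "insert w0 (\<Union>(Z - {{v,w0}})) \<supseteq> V - {v}"
      proof
        fix x assume x: "x \<in> V - {v}"
        then obtain e where e: "e \<in> Z" "x \<in> e" by (auto simp: V_def)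
        show "x \<in> insert w0 (\<Union>(Z - {{v,w0}}))"
          using e x by (cases "e = {v, w0}") auto
      qed
      have "card (V - {v}) \<le> card (insert w0 (\<Union>(Z - {{v,w0}})))"
        by (rule card_mono[OF _ u]) (simp add: finU)
      then have "q - 1 \<le> card (insert w0 (\<Union>(Z - {{v,w0}})))" using vV finV' qV by simp
      then have "\<kappa> ^ (q - 1) \<le> \<kappa> ^ card (insert w0 (\<Union>(Z - {{v,w0}})))"
        using kpos by (rule power_increasing)
      then have "\<kappa> ^ card Z / \<kappa> ^ card (insert w0 (\<Union>(Z - {{v,w0}}))) \<le> \<kappa> ^ card Z / \<kappa> ^ (q - 1)"
        using k0 by (intro divide_left_mono) auto
      also have "\<dots> = \<kappa> ^ (card Z + 1) / \<kappa> ^ q"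
      proof -
        have "q \<ge> 1" using qV vV finV' by (auto simp: Suc_le_eq card_gt_0_iff)
        then show ?thesis using k0 by (simp add: power_diff field_simps)
      qed
      finally have "2 ^ n * s ^ (Suc n - card Z) * (\<kappa> ^ card Z / \<kappa> ^ card (insert w0 (\<Union>(Z - {{v,w0}})))) * \<theta> ^ c \<le> ?R (Suc n - card Z)"
        using s th by (intro mult_right_mono mult_left_mono) auto
      then show ?thesis using step[OF w0] by (simp add: Aw)
    next
      case False
      have st2: "?W w \<le> ?R (Suc n - card Z) / \<kappa>" if w: "w \<in> A" for w
      proof -
        have u: "insert w (\<Union>(Z - {{v,w}})) \<supseteq> V"
        proof
          fix x assume x: "x \<in> V"
          then obtain e where e: "e \<in> Z" "x \<in> e" by (auto simp: V_def)
          have "A - {w} \<noteq> {}" using False w by (metis card.empty card_Suc_Diff1 One_nat_def part(4))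
          then obtain w' where w': "w' \<in> A" "w' \<noteq> w" by blast
          then have "v \<in> \<Union>(Z - {{v,w}})" by (auto simp: A_def doubleton_eq_iff)
          then show "x \<in> insert w (\<Union>(Z - {{v,w}}))"
            using e by (cases "e = {v, w}") auto
        qed
        have "card V \<le> card (insert w (\<Union>(Z - {{v,w}})))"
          by (rule card_mono[OF _ u]) (simp add: finU)
        then have "\<kappa> ^ q \<le> \<kappa> ^ card (insert w (\<Union>(Z - {{v,w}})))"
          using kpos qV by (intro power_increasing) auto
        then have "\<kappa> ^ card Z / \<kappa> ^ card (insert w (\<Union>(Z - {{v,w}}))) \<le> \<kappa> ^ card Z / \<kappa> ^ q"
          using k0 by (intro divide_left_mono) auto
        then have "2 ^ n * s ^ (Suc n - card Z) * (\<kappa> ^ card Z / \<kappa> ^ card (insert w (\<Union>(Z - {{v,w}})))) * \<theta> ^ c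
           \<le> 2 ^ n * s ^ (Suc n - card Z) * (\<kappa> ^ card Z / \<kappa> ^ q) * \<theta> ^ c"
          using s th by (intro mult_right_mono mult_left_mono) auto
        also have "\<dots> = ?R (Suc n - card Z) / \<kappa>" using k0 by simp
        finally show ?thesis using step[OF w] by linarith
      qed
      have "(\<Sum>w\<in>A. ?W w) \<le> (\<Sum>w\<in>A. ?R (Suc n - card Z) / \<kappa>)" by (rule sum_mono[OF st2])
      also have "\<dots> = real (card A) / \<kappa> * ?R (Suc n - card Z)" by simp
      also have "\<dots> \<le> 1 * ?R (Suc n - card Z)"
      proof (rule mult_right_mono[OF _ Rnn])
        have "real (card A) \<le> \<kappa>" using cardA Suc.prems(4,5) K by linarith
        then show "real (card A) / \<kappa> \<le> 1" using k0 by simp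
      qed
      finally show ?thesis by simp
    qed
  qed
  show ?case
  proof (cases "card Z \<le> n")
    case False
    then have cZ: "card Z = Suc n" using Suc.prems(4) by simp
    \<comment> \<open>Opening a further edge would leave more open edges than steps, so only steps
      of kind A survive.\<close>
    have "?W w = 0" if "w \<in> B \<union> C" for w
    proof -
      have "{v, w} \<notin> Z" using that by (auto simp: B_def C_def V_def)
      then show ?thesis using X finZ cZ by (subst walks_eq_0) (auto simp: card_toggle)
    qed
    then have "(\<Sum>w\<in>X - {v}. ?W w) = (\<Sum>w\<in>A. ?W w)"
      using part by (simp add: sum.union_disjoint Int_Un_distrib2)
    also have "\<dots> \<le> ?R (Suc n - card Z)" by (rule sumA)
    also have "\<dots> \<le> 2 * ?R (Suc n - card Z)" using Rnn[of "Suc n - card Z"] by linarith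
    finally show ?thesis by (simp add: q_def c_def V_def)
  next
    case True
    then consider "card Z = n" | "card Z < n" by linarith
    then show ?thesis
    proof cases
      case 1
      have "?W w = 0" if "w \<in> B \<union> C" for w
      proof -
        have "{v, w} \<notin> Z" using that by (auto simp: B_def C_def V_def)
        then show ?thesis using X finZ 1 by (subst walks_eq_0) (auto simp: card_toggle)
      qed
      then have "(\<Sum>w\<in>X - {v}. ?W w) = (\<Sum>w\<in>A. ?W w)"
        using part by (simp add: sum.union_disjoint Int_Un_distrib2)
      also have "\<dots> \<le> ?R (Suc n - card Z)" by (rule sumA)
      also have "\<dots> \<le> 2 * ?R (Suc n - card Z)" using Rnn[of "Suc n - card Z"] by linarith
      finally show ?thesis by (simp add: q_def c_def V_def)
    next
      case 2
      let ?m = "n - Suc (card Z)"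
      have stC: "?W w \<le> ?R ?m" if w: "w \<in> C" for w
      proof -
        have e: "{v, w} \<notin> Z" and wv: "w \<noteq> v" "w \<in> X" "w \<notin> V" using w by (auto simp: C_def V_def)
        have tg: "toggle {v, w} Z = insert {v, w} Z" using e by (simp add: toggle_def)
        have cd: "card (insert {v, w} Z) = Suc (card Z)" using e finZ by simp
        \<comment> \<open>The fresh vertex takes the colour of v. One edge and one vertex are
          gained, so the powers of \<kappa> and \<theta> do not change.\<close>
        define g where "g = f(w := f v)"
        have gcol: "g a = g b" if "{a, b} \<in> insert {v, w} Z" for a b
        proof (cases "{a, b} = {v, w}")
          case True then show ?thesis by (auto simp: doubleton_eq_iff g_def)
        next
          case False
          then have "{a, b} \<in> Z" using that by blast
          moreover from this have "a \<noteq> w" "b \<noteq> w" using wv(3) by (auto simp: V_def)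
          ultimately show ?thesis using Suc.prems(3) by (auto simp: g_def)
        qed
        have U: "\<Union>(insert {v, w} Z) = insert v (insert w V)" by (auto simp: V_def)
        have "?W w \<le> 2 ^ n * s ^ (n - card (insert {v, w} Z)) * (\<kappa> ^ (card (insert {v, w} Z) + 1) / \<kappa> ^ card (insert w (\<Union>(insert {v,w} Z)))) * \<theta> ^ card (g ` \<Union>(insert {v,w} Z) - {g w})"
          unfolding tg 
        proof (rule IH)
          show "insert {v, w} Z \<subseteq> edges_on X" using Suc.prems wv by (auto intro!: edges_onI)
        qed (use Suc.prems wv gcol cd 2 in auto)
        moreover have "insert w (\<Union>(insert {v,w} Z)) = insert w (insert v V)" unfolding U by auto
        moreover have "card (insert w (insert v V)) = Suc q" using wv finV' by (simp add: q_def)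
        moreover have "g ` \<Union>(insert {v,w} Z) - {g w} = f ` V - {f v}"
          unfolding U using wv by (auto simp: g_def)
        ultimately have "?W w \<le> 2 ^ n * s ^ ?m * (\<kappa> ^ (Suc (card Z) + 1) / \<kappa> ^ Suc q) * \<theta> ^ c"
          by (simp only: cd c_def)
        then show ?thesis using k0 by simp
      qed
      have stB: "?W w \<le> ?R ?m * (\<kappa> / \<theta>)" if w: "w \<in> B" for w
      proof -
        have e: "{v, w} \<notin> Z" and wv: "w \<noteq> v" "w \<in> X" "w \<in> V" using w by (auto simp: B_def)
        have tg: "toggle {v, w} Z = insert {v, w} Z" using e by (simp add: toggle_def)
        have cd: "card (insert {v, w} Z) = Suc (card Z)" using e finZ by simp
        \<comment> \<open>The colour of w is merged into that of v. This removes at most one colour,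
          whence 1/\<theta>; an edge gained without a vertex gives the factor \<kappa>.\<close>
        define g where "g = (\<lambda>x. if f x = f w then f v else f x)"
        have gcol: "g a = g b" if "{a, b} \<in> insert {v, w} Z" for a b
        proof (cases "{a, b} = {v, w}")
          case True then show ?thesis by (auto simp: doubleton_eq_iff g_def)
        next
          case False
          then have "{a, b} \<in> Z" using that by blast
          then have "f a = f b" by (rule Suc.prems(3))
          then show ?thesis by (simp add: g_def)
        qed
        have U: "\<Union>(insert {v, w} Z) = insert v (insert w V)" by (auto simp: V_def)
        let ?c' = "card (g ` \<Union>(insert {v,w} Z) - {g w})"
        have "?W w \<le> 2 ^ n * s ^ (n - card (insert {v, w} Z)) * (\<kappa> ^ (card (insert {v, w} Z) + 1) / \<kappa> ^ card (insert w (\<Union>(insert {v,w} Z)))) * \<theta> ^ ?c'"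
          unfolding tg 
        proof (rule IH)
          show "insert {v, w} Z \<subseteq> edges_on X" using Suc.prems wv by (auto intro!: edges_onI)
        qed (use Suc.prems wv gcol cd 2 in auto)
        moreover have "insert w (\<Union>(insert {v,w} Z)) = insert v V" unfolding U using wv by auto
        ultimately have "?W w \<le> 2 ^ n * s ^ ?m * (\<kappa> ^ (Suc (card Z) + 1) / \<kappa> ^ q) * \<theta> ^ ?c'"
          by (simp only: cd q_def)
        also have "\<dots> \<le> 2 ^ n * s ^ ?m * (\<kappa> ^ (Suc (card Z) + 1) / \<kappa> ^ q) * (\<theta> ^ c / \<theta>)"
        proof (rule mult_left_mono)
          have "f ` V - {f v} \<subseteq> insert (f w) (g ` \<Union>(insert {v,w} Z) - {g w})"
            unfolding U by (auto simp: g_def image_iff)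
          then have "c \<le> card (insert (f w) (g ` \<Union>(insert {v,w} Z) - {g w}))"
            unfolding c_def U by (rule card_mono[rotated]) (use finV' in auto)
          also have "\<dots> \<le> Suc ?c'" unfolding U using finV' by (simp add: card_insert_if)
          finally have "\<theta> ^ Suc ?c' \<le> \<theta> ^ c" using th by (intro power_decreasing) auto
          then show "\<theta> ^ ?c' \<le> \<theta> ^ c / \<theta>" using th by (simp add: field_simps)
        qed (use s k0 in auto)
        also have "\<dots> = ?R ?m * (\<kappa> / \<theta>)" using k0 by simp
        finally show ?thesis .
      qed
      have sumC: "(\<Sum>w\<in>C. ?W w) \<le> real (card X) * ?R ?m"
      proof -
        have "(\<Sum>w\<in>C. ?W w) \<le> (\<Sum>w\<in>C. ?R ?m)" by (rule sum_mono[OF stC])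
        also have "\<dots> = real (card C) * ?R ?m" by simp
        also have "\<dots> \<le> real (card X) * ?R ?m"
          by (intro mult_right_mono Rnn) (use X in \<open>auto simp: C_def intro!: card_mono\<close>)
        finally show ?thesis .
      qed
      have sumB: "(\<Sum>w\<in>B. ?W w) \<le> 2 * real K * \<kappa> / \<theta> * ?R ?m"
      proof -
        have "(\<Sum>w\<in>B. ?W w) \<le> (\<Sum>w\<in>B. ?R ?m * (\<kappa> / \<theta>))" by (rule sum_mono[OF stB])
        also have "\<dots> = real (card B) * (\<kappa> / \<theta> * ?R ?m)" by (simp add: mult_ac)
        also have "\<dots> \<le> (2 * real K) * (\<kappa> / \<theta> * ?R ?m)"
        proof (rule mult_right_mono)
          have "card B \<le> card V" using finV' by (auto simp: B_def intro!: card_mono)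
          then show "real (card B) \<le> 2 * real K" using cardV Suc.prems(4,5) by linarith
          show "0 \<le> \<kappa> / \<theta> * ?R ?m" by (intro mult_nonneg_nonneg[OF divide_nonneg_nonneg Rnn]) (use k0 th in auto)
        qed
        finally show ?thesis by (simp add: mult_ac)
      qed
      have "(\<Sum>w\<in>X - {v}. ?W w) = (\<Sum>w\<in>A. ?W w) + (\<Sum>w\<in>B. ?W w) + (\<Sum>w\<in>C. ?W w)"
        using part by (simp add: sum.union_disjoint)
      also have "\<dots> \<le> ?R (Suc n - card Z) + (real (card X) + 2 * real K * \<kappa> / \<theta>) * ?R ?m"
        unfolding distrib_right using sumA sumB sumC by linarith
      also have "(real (card X) + 2 * real K * \<kappa> / \<theta>) * ?R ?m \<le> s\<^sup>2 * ?R ?m"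
        by (intro mult_right_mono Rnn s)
      also have "s\<^sup>2 * ?R ?m = ?R (Suc n - card Z)"
      proof -
        have "Suc n - card Z = ?m + 2" using 2 by simp
        then show ?thesis by (simp add: power_add power2_eq_square)
      qed
      finally have "(\<Sum>w\<in>X - {v}. ?W w) \<le> 2 * ?R (Suc n - card Z)" by linarith
      then show ?thesis by (simp add: q_def c_def V_def mult_ac)
    qed
  qed
qed

section \<open>Sign functions with prescribed products on triples\<close>

text \<open>The boundary modulo 2 of a set of triples.\<close>

definition bd :: "'a set set \<Rightarrow> 'a set set" where
  "bd T = {e. card e = 2 \<and> odd (card {t \<in> T. e \<subseteq> t})}"

lemma bd_empty [simp]: "bd {} = {}"
  by (simp add: bd_def)

lemma bdE:
  assumes "e \<in> bd T"
  obtains t where "t \<in> T" "e \<subseteq> t" "card e = 2"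
proof -
  have "card {t \<in> T. e \<subseteq> t} \<noteq> 0" using assms by (auto simp: bd_def intro: Nat.gr0I elim: oddE)
  then have "{t \<in> T. e \<subseteq> t} \<noteq> {}" by (metis card.empty)
  then show thesis using that assms by (auto simp: bd_def)
qed

lemma Union_bd_subset: "\<Union>(bd T) \<subseteq> \<Union>T"
  by (meson Sup_least Union_upper bdE order_trans)

lemma bd_Un:
  assumes "finite T1" "finite T2"
    and sep: "\<And>e t1 t2. card e = 2 \<Longrightarrow> t1 \<in> T1 \<Longrightarrow> t2 \<in> T2 \<Longrightarrow> e \<subseteq> t1 \<Longrightarrow> e \<subseteq> t2 \<Longrightarrow> False"
  shows "bd (T1 \<union> T2) = bd T1 \<union> bd T2" "bd T1 \<inter> bd T2 = {}"
proof -
  show "bd T1 \<inter> bd T2 = {}" using sep by (auto elim!: bdE)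
  have "e \<in> bd (T1 \<union> T2) \<longleftrightarrow> e \<in> bd T1 \<union> bd T2" for e
  proof (cases "card e = 2")
    case True
    have dec: "{t. (t \<in> T1 \<or> t \<in> T2) \<and> e \<subseteq> t} = {t \<in> T1. e \<subseteq> t} \<union> {t \<in> T2. e \<subseteq> t}" by auto
    show ?thesis
    proof (cases "\<exists>t1\<in>T1. e \<subseteq> t1")
      case True
      then have none: "{t \<in> T2. e \<subseteq> t} = {}" using sep \<open>card e = 2\<close> by blast
      show ?thesis unfolding bd_def Un_iff mem_Collect_eq dec none by simp
    next
      case False
      then have none: "{t \<in> T1. e \<subseteq> t} = {}" by blast
      show ?thesis unfolding bd_def Un_iff mem_Collect_eq dec none by simp
    qed
  qed (simp add: bd_def)
  then show "bd (T1 \<union> T2) = bd T1 \<union> bd T2" by blast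
qed

text \<open>The random signs depend on Schur triples only through these properties:
  \<open>two\<close> leaves few choices for the third vertex of a triple, and
  \<open>anchored\<close> prevents a set of triples from hiding a vertex off its boundary.\<close>

locale triangle_system =
  fixes X :: "'a set" and TT :: "'a set set"
  assumes finX: "finite X"
    and tri: "t \<in> TT \<Longrightarrow> t \<subseteq> X \<and> card t = 3"
    and two: "x \<noteq> y \<Longrightarrow> card {z. {x, y, z} \<in> TT} \<le> 2"
    and anchored: "T \<subseteq> TT \<Longrightarrow> t \<in> T \<Longrightarrow> u \<in> t \<Longrightarrow> u \<in> \<Union>(bd T)"
begin

lemma finTT: "finite TT"
  by (rule finite_subset[of _ "Pow X"]) (use tri finX in auto)

lemma finite_sub: "T \<subseteq> TT \<Longrightarrow> finite T"
  using finTT finite_subset by blast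

lemma bd_edges: "T \<subseteq> TT \<Longrightarrow> bd T \<subseteq> edges_on X"
proof
  fix e assume T: "T \<subseteq> TT" and "e \<in> bd T"
  from this(2) obtain t where "t \<in> T" "e \<subseteq> t" "card e = 2" by (rule bdE)
  then show "e \<in> edges_on X" using T tri[of t] by (auto simp: edges_on_def)
qed

lemma Union_eq: "T \<subseteq> TT \<Longrightarrow> \<Union>(bd T) = \<Union>T"
  using Union_bd_subset[of T] anchored[of T] by (intro equalityI subsetI) auto

text \<open>The boundary of a boundary vanishes modulo 2: a triple through u has exactly two pairs
  at u, and counting incidences both ways transfers this parity to \<open>bd T\<close>.\<close>

lemma even_degree:
  assumes T: "T \<subseteq> TT"
  shows "even (card {e \<in> bd T. u \<in> e})"
proof -
  let ?E = "{e \<in> edges_on X. u \<in> e}"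
  let ?f = "\<lambda>e. card {t \<in> T. e \<subseteq> t}"
  have finE: "finite ?E" using finite_edges_on[OF finX] by simp
  have finT: "finite T" using finite_sub T .
  have "even (sum ?f ?E)"
  proof -
    have "sum ?f ?E = (\<Sum>e\<in>?E. \<Sum>t\<in>T. if e \<subseteq> t then 1 else 0)"
      by (simp only: card_eq_sum sum.inter_filter[OF finT])
    also have "\<dots> = (\<Sum>t\<in>T. \<Sum>e\<in>?E. if e \<subseteq> t then 1 else 0)" by (rule sum.swap)
    also have "\<dots> = (\<Sum>t\<in>T. card {e \<in> ?E. e \<subseteq> t})"
      by (simp only: card_eq_sum sum.inter_filter[OF finE])
    finally have "sum ?f ?E = (\<Sum>t\<in>T. card {e \<in> ?E. e \<subseteq> t})" .
    moreover have "even (card {e \<in> ?E. e \<subseteq> t})" if t: "t \<in> T" for t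
    proof (cases "u \<in> t")
      case True
      have t3: "t \<subseteq> X" "card t = 3" using tri T t by auto
      have "card (t - {u}) = 2" using True t3 finX by (simp add: finite_subset)
      then obtain a b where ab: "t - {u} = {a, b}" "a \<noteq> b" by (auto simp: card_2_iff)
      then have t: "t = {u, a, b}" "a \<noteq> u" "b \<noteq> u" using True by auto
      have "{e \<in> ?E. e \<subseteq> t} = {{u, a}, {u, b}}"
      proof (intro equalityI subsetI)
        fix e assume "e \<in> {e \<in> ?E. e \<subseteq> t}"
        then have e: "card e = 2" "u \<in> e" "e \<subseteq> {u, a, b}" by (auto simp: edges_on_def t)
        then have "card (e - {u}) = 1" by simp
        then obtain c where "e - {u} = {c}" by (auto simp: card_1_singleton_iff)
        then show "e \<in> {{u, a}, {u, b}}" using e by auto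
      qed (use t t3 ab in \<open>auto simp: edges_on_def\<close>)
      moreover have "{u, a} \<noteq> {u, b}" using ab t by (auto simp: doubleton_eq_iff)
      ultimately show ?thesis by simp
    next
      case False
      then have none: "{e \<in> ?E. e \<subseteq> t} = {}" by auto
      show ?thesis unfolding none by simp
    qed
    ultimately show ?thesis by (simp only:) (rule dvd_sum, assumption)
  qed
  then have "even (card {e \<in> ?E. odd (?f e)})"
    using even_sum_iff[OF finE, of ?f] by blast
  moreover have "{e \<in> ?E. odd (?f e)} = {e \<in> bd T. u \<in> e}"
    using bd_edges[OF T] by (auto simp: bd_def edges_on_def)
  ultimately show ?thesis by simp
qed

text \<open>The boundary is nonempty by \<open>anchored\<close> and has even degrees, so one of its
  edges can be continued by a second edge at each of its two ends.\<close>

lemma card_bd_ge_3: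
  assumes T: "T \<subseteq> TT" "T \<noteq> {}"
  shows "3 \<le> card (bd T)"
proof -
  have fin: "finite (bd T)" using bd_edges[OF T(1)] finite_edges_on[OF finX] finite_subset by blast
  have deg: "\<exists>e'\<in>bd T. u \<in> e' \<and> e' \<noteq> e" if "e \<in> bd T" "u \<in> e" for u e
  proof (rule ccontr)
    assume "\<not> ?thesis"
    then have "{e \<in> bd T. u \<in> e} = {e}" using that by blast
    then show False using even_degree[OF T(1), of u] by simp
  qed
  from T obtain t where t: "t \<in> T" by blast
  then have "card t = 3" using tri T by blast
  then obtain x where "x \<in> t" by fastforce
  then obtain e1 where e1: "e1 \<in> bd T" "x \<in> e1" using anchored[OF T(1) t] by blast
  then obtain e2 where e2: "e2 \<in> bd T" "x \<in> e2" "e2 \<noteq> e1" using deg by blast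
  have pair: "\<exists>a. e = {x, a} \<and> a \<noteq> x" if "e \<in> bd T" "x \<in> e" for e
    using that by (auto simp: bd_def card_2_iff)
  obtain a b where a: "e1 = {x, a}" "a \<noteq> x" and b: "e2 = {x, b}" "b \<noteq> x"
    using pair e1 e2 by metis
  obtain e3 where e3: "e3 \<in> bd T" "a \<in> e3" "e3 \<noteq> e1" using deg[OF e1(1), of a] a by blast
  have "e3 \<noteq> e2" using e3 a b e2(3) by auto
  then have "card {e1, e2, e3} = 3" using e2 e3 by auto
  moreover have "{e1, e2, e3} \<subseteq> bd T" using e1 e2 e3 by auto
  ultimately show ?thesis using card_mono[OF fin, of "{e1, e2, e3}"] by linarith
qed

text \<open>Boundaries add modulo 2, so the symmetric difference of T and T' has empty boundary and
  must itself be empty.\<close>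

lemma bd_inj:
  assumes "T \<subseteq> TT" "T' \<subseteq> TT" "bd T = bd T'"
  shows "T = T'"
proof -
  let ?D = "(T - T') \<union> (T' - T)"
  have fin: "finite T" "finite T'" using assms finite_sub by auto
  have "bd ?D = {}"
  proof -
    have "even (card {t \<in> ?D. e \<subseteq> t})" if "card e = 2" for e
    proof -
      let ?c = "\<lambda>S. card {t \<in> S. e \<subseteq> t}"
      have 1: "?c ?D = ?c (T - T') + ?c (T' - T)"
        using fin by (subst card_Un_disjoint[symmetric]) (auto intro: arg_cong[of _ _ card])
      have 2: "?c T = ?c (T - T') + ?c (T \<inter> T')" 
        using fin by (subst card_Un_disjoint[symmetric]) (auto intro: arg_cong[of _ _ card])
      have 3: "?c T' = ?c (T' - T) + ?c (T \<inter> T')"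
        using fin by (subst card_Un_disjoint[symmetric]) (auto intro: arg_cong[of _ _ card])
      have "odd (?c T) = odd (?c T')" using assms(3) that by (auto simp: bd_def)
      then show ?thesis using 1 2 3 by presburger
    qed
    then show ?thesis by (auto simp: bd_def)
  qed
  then have "?D = {}" using card_bd_ge_3[of ?D] assms by force
  then show ?thesis by blast
qed

section \<open>Encoding sets of triples by lists of vertices\<close>

definition det :: "'a set \<Rightarrow> 'a \<Rightarrow> bool" where
  "det K x \<longleftrightarrow> (\<exists>a\<in>K. \<exists>b\<in>K. a \<noteq> b \<and> {a, b, x} \<in> TT)"

text \<open>Only the entries counted here range over all of X; each other entry completes a triple
  with two vertices that precede it and has few candidates.\<close>

primrec free :: "'a set \<Rightarrow> 'a list \<Rightarrow> nat" where
  "free K [] = 0"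
| "free K (x # xs) = (if det K x then 0 else 1) + free (insert x K) xs"

lemma free_append: "free K (xs @ ys) = free K xs + free (K \<union> set xs) ys"
  by (induction xs arbitrary: K) simp_all

lemma card_det:
  assumes "finite K"
  shows "card {x. det K x} \<le> 2 * (card K)\<^sup>2" "finite {x. det K x}"
proof -
  let ?P = "{p \<in> K \<times> K. fst p \<noteq> snd p}"
  have finP: "finite ?P" using assms by auto
  have eq: "{x. det K x} = (\<Union>p\<in>?P. {x. {fst p, snd p, x} \<in> TT})"
    by (simp add: det_def Bex_def set_eq_iff)
  have "{x. {a, b, x} \<in> TT} \<subseteq> X" for a b using tri[of "{a, b, x}" for x] by auto
  then have fin: "finite {x. {a, b, x} \<in> TT}" for a b by (rule finite_subset[OF _ finX])
  show "finite {x. det K x}" unfolding eq by (rule finite_UN_I[OF finP fin])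
  have "card {x. det K x} \<le> (\<Sum>p\<in>?P. card {x. {fst p, snd p, x} \<in> TT})"
    unfolding eq by (rule card_UN_le[OF finP])
  also have "\<dots> \<le> (\<Sum>p\<in>?P. 2)" by (intro sum_mono two) auto
  also have "\<dots> = 2 * card ?P" by simp
  also have "card ?P \<le> card (K \<times> K)" using assms by (intro card_mono) auto
  finally show "card {x. det K x} \<le> 2 * (card K)\<^sup>2" by (simp add: power2_eq_square card_cartesian_product)
qed

text \<open>In the sum over one entry the free vertices contribute at most
  \<open>h * (1/h) = 1\<close> and the determined ones at most \<open>2 * (card K)^2\<close>. The
  weight \<open>1/h\<close> thus pays for each free choice, and the bound does not involve
  h.\<close>

lemma sum_free_lists:
  assumes h: "real (card X) \<le> h" "0 < h"
  shows "finite K \<Longrightarrow> (\<Sum>xs | set xs \<subseteq> X \<and> length xs = s. (1 / h) ^ free K xs)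
     \<le> (1 + 2 * (real (card K) + real s)\<^sup>2) ^ s"
proof (induction s arbitrary: K)
  case 0
  have "{xs. set xs \<subseteq> X \<and> length xs = 0} = {[]}" by auto
  then show ?case by simp
next
  case (Suc s)
  let ?L = "\<lambda>s. {xs. set xs \<subseteq> X \<and> length xs = s}"
  let ?B = "1 + 2 * (real (card K) + real (Suc s))\<^sup>2"
  have bij: "?L (Suc s) = (\<lambda>(x, xs). x # xs) ` (X \<times> ?L s)"
    by (auto simp: length_Suc_conv image_iff)
  have inj: "inj_on (\<lambda>(x, xs). x # xs) (X \<times> ?L s)" by (auto simp: inj_on_def)
  have "(\<Sum>xs\<in>?L (Suc s). (1 / h) ^ free K xs) = (\<Sum>(x, xs)\<in>X \<times> ?L s. (1 / h) ^ free K (x # xs))"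
    unfolding bij by (subst sum.reindex[OF inj]) (simp add: case_prod_unfold)
  also have "\<dots> = (\<Sum>x\<in>X. \<Sum>xs\<in>?L s. (1 / h) ^ free K (x # xs))"
    by (rule sum.cartesian_product[symmetric])
  also have "\<dots> = (\<Sum>x\<in>X. (if det K x then 1 else 1 / h) * (\<Sum>xs\<in>?L s. (1 / h) ^ free (insert x K) xs))"
    by (intro sum.cong refl) (simp add: sum_distrib_left)
  also have "\<dots> \<le> (\<Sum>x\<in>X. (if det K x then 1 else 1 / h) * ?B ^ s)"
  proof (intro sum_mono mult_left_mono)
    fix x
    have "(\<Sum>xs\<in>?L s. (1 / h) ^ free (insert x K) xs) \<le> (1 + 2 * (real (card (insert x K)) + real s)\<^sup>2) ^ s"
      using Suc by simp
    also have "\<dots> \<le> ?B ^ s"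
    proof (intro power_mono add_left_mono mult_left_mono)
      show "real (card (insert x K)) + real s \<le> real (card K) + real (Suc s)"
        using Suc.prems by (simp add: card_insert_if)
    qed auto
    finally show "(\<Sum>xs\<in>?L s. (1 / h) ^ free (insert x K) xs) \<le> ?B ^ s" .
  qed (use h in auto)
  also have "\<dots> = (\<Sum>x\<in>X. if det K x then 1 else 1 / h) * ?B ^ s"
    by (simp add: sum_distrib_right)
  also have "(\<Sum>x\<in>X. if det K x then 1 else 1 / h) \<le> ?B"
  proof -
    have "(\<Sum>x\<in>X. if det K x then 1 else 1 / h) \<le> (\<Sum>x\<in>X. 1 / h + (if det K x then 1 else 0))"
      using h by (intro sum_mono) auto
    also have "\<dots> = real (card X) / h + real (card {x \<in> X. det K x})"
      using finX by (simp add: sum.distrib sum.If_cases Int_def)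
    also have "\<dots> \<le> 1 + 2 * (real (card K))\<^sup>2"
    proof (rule add_mono)
      show "real (card X) / h \<le> 1" using h by simp
      have "card {x \<in> X. det K x} \<le> card {x. det K x}"
        using card_det[OF Suc.prems] by (intro card_mono) auto
      then have "card {x \<in> X. det K x} \<le> 2 * (card K)\<^sup>2" using card_det[OF Suc.prems] by linarith
      then have "real (card {x \<in> X. det K x}) \<le> real (2 * (card K)\<^sup>2)" using of_nat_mono by blast
      then show "real (card {x \<in> X. det K x}) \<le> 2 * (real (card K))\<^sup>2" by simp
    qed
    also have "\<dots> \<le> ?B" by (intro add_left_mono mult_left_mono power_mono) auto
    finally show ?thesis .
  qed
  finally show ?case by (simp add: mult_right_mono)
qed

definition closed_in :: "'a set set \<Rightarrow> 'a set \<Rightarrow> bool" where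
  "closed_in T K \<longleftrightarrow> (\<forall>t\<in>T. \<forall>a\<in>t \<inter> K. \<forall>b\<in>t \<inter> K. a \<noteq> b \<longrightarrow> t \<subseteq> K)"

text \<open>A vertex that has to be added completes a triple with two vertices already present, so
  it is determined: closing up costs no free vertex.\<close>

lemma exists_closure:
  assumes T: "T \<subseteq> TT"
  shows "\<exists>ys. free K ys = 0 \<and> distinct ys \<and> set ys \<subseteq> \<Union>T - K \<and> closed_in T (K \<union> set ys)"
proof (induction "card (\<Union>T - K)" arbitrary: K rule: less_induct)
  case less
  have finU: "finite (\<Union>T)" using T tri finX by (meson Sup_least finite_subset subsetD)
  show ?case
  proof (cases "closed_in T K")
    case True
    then show ?thesis by (intro exI[of _ "[]"]) simp
  next
    case False
    then obtain t a b where t: "t \<in> T" "a \<in> t" "a \<in> K" "b \<in> t" "b \<in> K" "a \<noteq> b" "\<not> t \<subseteq> K"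
      by (auto simp: closed_in_def)
    then obtain x where x: "x \<in> t" "x \<notin> K" by blast
    have "card t = 3" "finite t" using t tri T finX finite_subset by blast+
    moreover have "a \<noteq> x" "b \<noteq> x" using t x by auto
    then have "{a, b, x} \<subseteq> t" "card {a, b, x} = 3" using t x by auto
    ultimately have "t = {a, b, x}" by (metis card_subset_eq)
    then have d: "det K x" using t T by (auto simp: det_def)
    have "card (\<Union>T - insert x K) < card (\<Union>T - K)"
      using finU x t by (intro psubset_card_mono) auto
    from less[OF this] obtain ys where ys: "free (insert x K) ys = 0" "distinct ys"
      "set ys \<subseteq> \<Union>T - insert x K" "closed_in T (insert x K \<union> set ys)" by blast
    show ?thesis using ys d x t by (intro exI[of _ "x # ys"]) auto
  qed
qed

text \<open>Each round adds one vertex y and closes up, so it has at most one free vertex. If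
  possible y is joined by an edge of F to K. That edge lies in a triple of T, which the closure
  absorbs; since K was closed, the absorbed triples share no pair with the earlier ones, and their
  boundary contributes at least three further edges. If no edge of F leaves K, then y lies in a
  component of F not met before. So every free vertex is paid for by three edges or by a
  component.\<close>

lemma enumerate_vertices:
  assumes T: "T \<subseteq> TT" and r: "r \<in> K"
  defines "F \<equiv> bd T"
  defines "V \<equiv> \<Union>F"
  defines "cmp \<equiv> (\<lambda>v. {w. (v, w) \<in> {(a, b). {a, b} \<in> F}\<^sup>*})"
  shows "closed_in T K \<Longrightarrow> \<exists>ys. distinct ys \<and> set ys = V - K \<and>
     3 * free K ys + 3 * card (cmp ` (K \<inter> V) - {cmp r}) + card (bd {t \<in> T. t \<subseteq> K})
        \<le> 3 * card (cmp ` V - {cmp r}) + card F"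
  using r
proof (induction "card (V - K)" arbitrary: K rule: less_induct)
  case less
  note K = less.prems(1) and r = less.prems(2)
  have VT: "V = \<Union>T" using Union_eq[OF T] by (simp add: V_def F_def)
  have VX: "V \<subseteq> X" using VT T tri by blast
  have finV: "finite V" using VX finX finite_subset by blast
  have finT: "finite T" using finite_sub T .
  show ?case
  proof (cases "V \<subseteq> K")
    case True
    then have "{t \<in> T. t \<subseteq> K} = T" using VT by auto
    moreover have "K \<inter> V = V" using True by blast
    ultimately show ?thesis using True by (intro exI[of _ "[]"]) (simp add: F_def)
  next
    case False
    define crossing where "crossing = (\<lambda>y. \<exists>x\<in>K. {x, y} \<in> F)"
    obtain y where y: "y \<in> V - K" and cr: "crossing y \<or> (\<forall>y\<in>V - K. \<not> crossing y)"
      using False by (cases "\<exists>y\<in>V - K. crossing y") auto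
    obtain zs where zs: "free (insert y K) zs = 0" "distinct zs" "set zs \<subseteq> \<Union>T - insert y K"
      "closed_in T (insert y K \<union> set zs)" using exists_closure[OF T] by blast
    define K2 where "K2 = insert y K \<union> set zs"
    have "card (V - K2) < card (V - K)"
      using finV y by (intro psubset_card_mono) (auto simp: K2_def)
    from less.hyps[OF this] zs(4) r obtain ys where ys: "distinct ys" "set ys = V - K2"
      "3 * free K2 ys + 3 * card (cmp ` (K2 \<inter> V) - {cmp r}) + card (bd {t \<in> T. t \<subseteq> K2})
        \<le> 3 * card (cmp ` V - {cmp r}) + card F" by (auto simp: K2_def)
    let ?l = "y # zs @ ys"
    have set: "set ?l = V - K" "distinct ?l"
      using ys zs y by (auto simp: K2_def VT)
    have fr: "free K ?l \<le> 1 + free K2 ys"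
      using zs by (simp add: free_append K2_def)
    let ?T1 = "{t \<in> T. t \<subseteq> K}" and ?T2 = "{t \<in> T. t \<subseteq> K2 \<and> \<not> t \<subseteq> K}"
    have split: "{t \<in> T. t \<subseteq> K2} = ?T1 \<union> ?T2" by (auto simp: K2_def)
    \<comment> \<open>A pair common to an old and a new triple would put two vertices of the new one
      into K, and closedness of K would then absorb the whole triple.\<close>
    have sep: False if e: "card e = 2" and "t1 \<in> ?T1" "t2 \<in> ?T2" "e \<subseteq> t1" "e \<subseteq> t2" for e t1 t2
    proof -
      obtain a b where ab: "e = {a, b}" "a \<noteq> b" using e by (auto simp: card_2_iff)
      have "t1 \<subseteq> K" "t2 \<in> T" "\<not> t2 \<subseteq> K" using that(2,3) by auto
      moreover from this have "a \<in> t2 \<inter> K" "b \<in> t2 \<inter> K" using ab that(4,5) by auto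
      ultimately show False using K ab(2) unfolding closed_in_def by metis
    qed
    have bdU: "bd {t \<in> T. t \<subseteq> K2} = bd ?T1 \<union> bd ?T2" "bd ?T1 \<inter> bd ?T2 = {}"
      unfolding split by (rule bd_Un[OF _ _ sep]; use finT in simp)+
    have finbd: "finite (bd S)" if "S \<subseteq> TT" for S
      using bd_edges[OF that] finite_edges_on[OF finX] finite_subset by blast
    have cardbd: "card (bd {t \<in> T. t \<subseteq> K2}) = card (bd ?T1) + card (bd ?T2)"
      unfolding bdU(1) by (rule card_Un_disjoint[OF finbd finbd bdU(2)]) (use T in auto)
    have mono: "cmp ` (K \<inter> V) - {cmp r} \<subseteq> cmp ` (K2 \<inter> V) - {cmp r}" by (auto simp: K2_def)
    have fincomp: "finite (cmp ` (K2 \<inter> V) - {cmp r})" using finV by simp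
    have "3 + 3 * card (cmp ` (K \<inter> V) - {cmp r}) + card (bd ?T1)
        \<le> 3 * card (cmp ` (K2 \<inter> V) - {cmp r}) + card (bd {t \<in> T. t \<subseteq> K2})"
    proof (cases "crossing y")
      case True
      then obtain x where x: "x \<in> K" "{x, y} \<in> F" by (auto simp: crossing_def)
      then obtain t where t: "t \<in> T" "{x, y} \<subseteq> t" by (auto simp: F_def elim: bdE)
      have "x \<noteq> y" using x y by auto
      then have "t \<subseteq> K2" using zs(4) t x unfolding closed_in_def K2_def by blast
      then have "t \<in> ?T2" using t y by auto
      then have "3 \<le> card (bd ?T2)" using T by (intro card_bd_ge_3) auto
      then show ?thesis using card_mono[OF fincomp mono] cardbd by linarith
    next
      case False
      then have nocr: "\<And>y. y \<in> V - K \<Longrightarrow> \<not> crossing y" using cr by blast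
      have stay: "w \<in> K" if "(v, w) \<in> {(a, b). {a, b} \<in> F}\<^sup>*" "v \<in> K" for v w
        using that
      proof (induction rule: rtrancl_induct)
        case (step a b)
        then have "a \<in> K" "{a, b} \<in> F" by auto
        moreover from this have "b \<in> V" by (auto simp: V_def)
        ultimately show ?case using nocr[of b] by (auto simp: crossing_def)
      qed
      have new: "cmp y \<noteq> cmp v" if "v \<in> K" for v
      proof
        assume "cmp y = cmp v"
        moreover have "y \<in> cmp y" by (simp add: cmp_def)
        ultimately have "(v, y) \<in> {(a, b). {a, b} \<in> F}\<^sup>*" by (simp add: cmp_def)
        from stay[OF this that] show False using y by blast
      qed
      have "insert (cmp y) (cmp ` (K \<inter> V) - {cmp r}) \<subseteq> cmp ` (K2 \<inter> V) - {cmp r}"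
        using mono new[OF r] y by (auto simp: K2_def)
      then have "card (insert (cmp y) (cmp ` (K \<inter> V) - {cmp r})) \<le> card (cmp ` (K2 \<inter> V) - {cmp r})"
        by (rule card_mono[OF fincomp])
      moreover have "cmp y \<notin> cmp ` (K \<inter> V) - {cmp r}" using new by auto
      ultimately have "Suc (card (cmp ` (K \<inter> V) - {cmp r})) \<le> card (cmp ` (K2 \<inter> V) - {cmp r})"
        using finV by simp
      then show ?thesis using cardbd by linarith
    qed
    note grow = this
    have arith: "3 * f + c1 + b1 \<le> R" if "f \<le> 1 + g" "3 * g + c2 + b2 \<le> R" "3 + c1 + b1 \<le> c2 + b2"
      for f g c1 b1 c2 b2 R :: nat using that by linarith
    have fin: "3 * free K ?l + 3 * card (cmp ` (K \<inter> V) - {cmp r}) + card (bd {t \<in> T. t \<subseteq> K})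
        \<le> 3 * card (cmp ` V - {cmp r}) + card F" 
      by (rule arith[OF fr ys(3) grow])
    have "distinct ?l \<and> set ?l = V - K \<and> 3 * free K ?l + 3 * card (cmp ` (K \<inter> V) - {cmp r}) + card (bd {t \<in> T. t \<subseteq> K})
        \<le> 3 * card (cmp ` V - {cmp r}) + card F" 
      by (intro conjI set fin)
    show ?thesis
      by (rule exI[of _ ?l]) fact
  qed
qed

text \<open>Couples the two sides of the later estimate: c is the exponent of \<theta> in
  \<open>walks_bound\<close>, and \<open>3 * free {r} ys\<close> is at most
  \<open>3 * c + card F\<close>, which limits the cost of naming F.\<close>

definition enumerates :: "'a \<Rightarrow> 'a set set \<Rightarrow> 'a list \<Rightarrow> nat \<Rightarrow> ('a \<Rightarrow> 'a set) \<Rightarrow> bool" where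
  "enumerates r F ys c f \<longleftrightarrow> set ys \<subseteq> X \<and> insert r (set ys) = insert r (\<Union>F) \<and>
     length ys \<le> card (\<Union>F) \<and> 3 * free {r} ys \<le> 3 * c + card F \<and> c \<le> card (\<Union>F) \<and>
     c = card (f ` \<Union>F - {f r}) \<and> (\<forall>a b. {a, b} \<in> F \<longrightarrow> f a = f b)"

lemma exists_enumeration:
  assumes "T \<subseteq> TT" "r \<in> X"
  shows "\<exists>ys c f. enumerates r (bd T) ys c f"
proof -
  let ?F = "bd T" let ?V = "\<Union>?F"
  define f where "f = (\<lambda>v. {w. (v, w) \<in> {(a, b). {a, b} \<in> ?F}\<^sup>*})"
  have finV: "finite ?V" and VX: "?V \<subseteq> X"
  proof -
    show "?V \<subseteq> X" using bd_edges[OF assms(1)] by (auto simp: edges_on_def)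
    then show "finite ?V" using finX finite_subset by metis
  qed
  have cl: "closed_in T {r}" by (simp add: closed_in_def)
  obtain ys where ys: "distinct ys" "set ys = ?V - {r}"
     "3 * free {r} ys + 3 * card (f ` ({r} \<inter> ?V) - {f r}) + card (bd {t \<in> T. t \<subseteq> {r}})
        \<le> 3 * card (f ` ?V - {f r}) + card ?F"
    using enumerate_vertices[OF assms(1) _ cl, of r] unfolding f_def by auto
  have col: "f a = f b" if "{a, b} \<in> ?F" for a b
  proof -
    have ab: "(a, b) \<in> {(a, b). {a, b} \<in> ?F}\<^sup>*" "(b, a) \<in> {(a, b). {a, b} \<in> ?F}\<^sup>*"
      using that by (auto simp: insert_commute)
    have "(a, w) \<in> {(a, b). {a, b} \<in> ?F}\<^sup>* \<longleftrightarrow> (b, w) \<in> {(a, b). {a, b} \<in> ?F}\<^sup>*" for w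
      using rtrancl_trans[OF ab(1)] rtrancl_trans[OF ab(2)] by (rule iffI[rotated])
    then show ?thesis by (simp only: f_def)
  qed
  have 1: "set ys \<subseteq> X" using ys(2) VX by blast
  have 2: "insert r (set ys) = insert r ?V" using ys(2) by auto
  have "length ys = card (set ys)" using ys(1) by (simp add: distinct_card)
  also have "\<dots> \<le> card ?V" unfolding ys(2) using finV by (intro card_mono) auto
  finally have 3: "length ys \<le> card ?V" .
  have 4: "3 * free {r} ys \<le> 3 * card (f ` ?V - {f r}) + card ?F" using ys(3) by linarith
  have "card (f ` ?V - {f r}) \<le> card (f ` ?V)" using finV by (intro card_mono) auto
  also have "\<dots> \<le> card ?V" using finV by (rule card_image_le)
  finally have 5: "card (f ` ?V - {f r}) \<le> card ?V" .
  have "enumerates r ?F ys (card (f ` ?V - {f r})) f"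
    unfolding enumerates_def using 1 2 3 4 5 col by simp
  then show ?thesis by blast
qed

lemma card_Union_bd: "T \<subseteq> TT \<Longrightarrow> card (\<Union>(bd T)) \<le> 2 * card (bd T)"
proof -
  assume "T \<subseteq> TT"
  have "card (\<Union>(bd T)) \<le> (\<Sum>e\<in>bd T. card e)" by (rule card_Union_le_sum_card)
  also have "\<dots> = (\<Sum>e\<in>bd T. 2)" by (intro sum.cong) (auto simp: bd_def)
  finally show ?thesis by simp
qed

text \<open>T is recovered from its boundary, which consists of f pairs on r and the listed
  vertices. So T is encoded by a list of length at most \<open>2 f\<close>, carrying the weight,
  together with one of at most \<open>M^(2 f)\<close> edge sets.\<close>

lemma sum_free_boundaries:
  fixes h M :: real
  assumes r: "r \<in> X" and h: "real (card X) \<le> h" "0 < h" and M: "2 * real f + 1 \<le> M"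
    and ys: "\<And>T. T \<in> S \<Longrightarrow> T \<subseteq> TT \<and> card (bd T) = f \<and> set (ys T) \<subseteq> X \<and> length (ys T) \<le> 2 * f \<and>
       insert r (set (ys T)) = insert r (\<Union>(bd T))"
  shows "(\<Sum>T\<in>S. (1 / h) ^ free {r} (ys T)) \<le> M * (3 * M\<^sup>2) ^ (2 * f) * M ^ (2 * f)"
proof -
  let ?L = "{xs. set xs \<subseteq> X \<and> length xs \<le> 2 * f}"
  let ?G = "\<lambda>xs. {F. F \<subseteq> {e. e \<subseteq> insert r (set xs) \<and> card e = 2} \<and> card F = f}"
  have M1: "M \<ge> 1" using M by simp
  have finL: "finite ?L" using finX by (rule finite_lists_length_le)
  have fin2: "finite {e. e \<subseteq> insert r (set xs) \<and> card e = 2}" for xs :: "'a list"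
    by (rule finite_subset[of _ "Pow (insert r (set xs))"]) auto
  have finG: "finite (?G xs)" for xs
    by (rule finite_subset[of _ "Pow {e. e \<subseteq> insert r (set xs) \<and> card e = 2}"]) (use fin2 in auto)
  have cardG: "real (card (?G xs)) \<le> M ^ (2 * f)" if "xs \<in> ?L" for xs
  proof -
    let ?A = "{e. e \<subseteq> insert r (set xs) \<and> card e = 2}"
    have ci: "card (insert r (set xs)) \<le> 2 * f + 1"
    proof -
      have "card (insert r (set xs)) \<le> Suc (card (set xs))" by (simp add: card_insert_if)
      also have "card (set xs) \<le> length xs" by (rule card_length)
      finally show ?thesis using that by simp
    qed
    have "card ?A = card (insert r (set xs)) choose 2" by (rule n_subsets) simp
    also have "\<dots> \<le> (card (insert r (set xs)))\<^sup>2" unfolding choose_two power2_eq_square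
      by (rule order_trans[OF div_le_dividend mult_le_mono2]) simp
    finally have "card ?A \<le> (2 * f + 1)\<^sup>2" using ci by (meson order_trans power_mono zero_le)
    have "card (?G xs) = card ?A choose f" by (rule n_subsets[OF fin2])
    also have "\<dots> \<le> card ?A ^ f" by (cases "f \<le> card ?A") (auto intro: binomial_le_pow simp: binomial_eq_0)
    also have "\<dots> \<le> ((2 * f + 1)\<^sup>2) ^ f" by (rule power_mono) (fact, simp)
    finally have "real (card (?G xs)) \<le> real (((2 * f + 1)\<^sup>2) ^ f)" using of_nat_mono by blast
    also have "\<dots> = (2 * real f + 1) ^ (2 * f)" by (simp add: power_mult add.commute)
    also have "\<dots> \<le> M ^ (2 * f)" using M by (intro power_mono) auto
    finally show ?thesis .
  qed
  have inj: "inj_on (\<lambda>T. (ys T, bd T)) S" using bd_inj ys by (intro inj_onI) auto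
  have sub: "(\<lambda>T. (ys T, bd T)) ` S \<subseteq> Sigma ?L ?G"
    using ys by (auto simp: bd_def)
  have "(\<Sum>T\<in>S. (1 / h) ^ free {r} (ys T)) = (\<Sum>p\<in>(\<lambda>T. (ys T, bd T)) ` S. (1 / h) ^ free {r} (fst p))"
    by (subst sum.reindex[OF inj]) simp
  also have "\<dots> \<le> (\<Sum>p\<in>Sigma ?L ?G. (1 / h) ^ free {r} (fst p))"
    by (rule sum_mono2) (use sub h finL finG in auto)
  also have "\<dots> = (\<Sum>xs\<in>?L. \<Sum>F\<in>?G xs. (1 / h) ^ free {r} xs)"
    by (subst sum.Sigma) (use finL finG in \<open>auto simp: case_prod_unfold\<close>)
  also have "\<dots> = (\<Sum>xs\<in>?L. real (card (?G xs)) * (1 / h) ^ free {r} xs)" by simp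
  also have "\<dots> \<le> (\<Sum>xs\<in>?L. M ^ (2 * f) * (1 / h) ^ free {r} xs)"
    using h by (intro sum_mono mult_right_mono cardG) auto
  also have "\<dots> = M ^ (2 * f) * (\<Sum>xs\<in>?L. (1 / h) ^ free {r} xs)" by (simp add: sum_distrib_left)
  also have "(\<Sum>xs\<in>?L. (1 / h) ^ free {r} xs) = (\<Sum>s\<in>{..2 * f}. \<Sum>xs | set xs \<subseteq> X \<and> length xs = s. (1 / h) ^ free {r} xs)"
  proof -
    have "?L = (\<Union>s\<in>{..2 * f}. {xs. set xs \<subseteq> X \<and> length xs = s})" by auto
    then show ?thesis
      using finite_lists_length_eq[OF finX] by (simp only:) (subst sum.UNION_disjoint, auto)
  qed
  also have "\<dots> \<le> (\<Sum>s\<in>{..2 * f}. (3 * M\<^sup>2) ^ (2 * f))"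
  proof (intro sum_mono)
    fix s assume s: "s \<in> {..2 * f}"
    have "(\<Sum>xs | set xs \<subseteq> X \<and> length xs = s. (1 / h) ^ free {r} xs) \<le> (1 + 2 * (real (card {r}) + real s)\<^sup>2) ^ s"
      by (rule sum_free_lists[OF h]) simp
    also have "\<dots> \<le> (3 * M\<^sup>2) ^ s"
    proof (rule power_mono)
      have "(real (card {r}) + real s)\<^sup>2 \<le> M\<^sup>2" using s M by (intro power_mono) auto
      moreover have "1 \<le> M\<^sup>2" using M1 by simp
      ultimately show "1 + 2 * (real (card {r}) + real s)\<^sup>2 \<le> 3 * M\<^sup>2" by linarith
    qed simp
    also have "\<dots> \<le> (3 * M\<^sup>2) ^ (2 * f)"
    proof (rule power_increasing)
      have "1 \<le> M\<^sup>2" using M1 by simp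
      then show "1 \<le> 3 * M\<^sup>2" by linarith
    qed (use s in auto)
    finally show "(\<Sum>xs | set xs \<subseteq> X \<and> length xs = s. (1 / h) ^ free {r} xs) \<le> (3 * M\<^sup>2) ^ (2 * f)" .
  qed
  also have "\<dots> = (2 * real f + 1) * (3 * M\<^sup>2) ^ (2 * f)" by simp
  also have "\<dots> \<le> M * (3 * M\<^sup>2) ^ (2 * f)" using M by (intro mult_right_mono) auto
  finally show ?thesis using M1 by (simp add: mult.commute mult_left_mono)
qed

text \<open>The empty set of triples gives the main term \<open>2^n * s^n\<close>, of order
  \<open>(4 h)^k\<close>. For a boundary with m edges the walk pays
  \<open>s^(-m) * \<theta>^c\<close>, where s is at least \<open>g^3\<close>, and naming the set
  costs at most \<open>h^c * g^(2 m)\<close>. Up to powers of n this leaves \<open>1/g\<close> per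
  edge, so the other boundaries form a geometric series.\<close>

lemma sum_walks_boundary:
  fixes g :: real and k :: nat
  assumes g: "0 < g" "g ^ 6 = real (card X)" and k: "1 \<le> k" and n: "n = 2 * k"
    and big: "157464 * real n ^ 14 \<le> g"
  shows "(\<Sum>r\<in>X. \<Sum>T\<in>Pow TT. real (walks X r n (bd T) r)) \<le> 4 * real (card X) * (4 * real (card X)) ^ k"
proof -
  define h where "h = real (card X)"
  define K where "K = real n"
  \<comment> \<open>This choice makes \<open>2 * n * K / \<theta>\<close> equal to
    \<open>h / K\<close>, hence \<open>s^2 = h * (1 + 1/K)\<close>. In the k-th power, with
    \<open>k = K/2\<close>, the extra factor is at most \<open>exp (1/2)\<close>.\<close>
  define \<theta> where "\<theta> = 2 * K ^ 3 / h"
  define s where "s = sqrt (h * (1 + 1 / K))"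
  have K2: "K \<ge> 2" using n k by (simp add: K_def)
  have K1: "K ^ j \<ge> 1" for j using K2 by simp
  have gK: "2 * K ^ 3 \<le> g"
  proof -
    have "2 * K ^ 3 \<le> 157464 * K ^ 14"
    proof (rule mult_mono)
      show "K ^ 3 \<le> K ^ 14" using K2 by (intro power_increasing) auto
    qed (use K2 in auto)
    then show ?thesis using big by (simp add: K_def)
  qed
  have g1: "g \<ge> 1" using gK K1[of 3] by linarith
  have gh: "g \<le> h" using g power_increasing[of 1 6 g] g1 by (simp add: h_def)
  have hpos: "h > 0" using gh g by linarith
  have th: "0 < \<theta>" "\<theta> \<le> 1" using K2 gK gh hpos by (auto simp: \<theta>_def)
  have s2: "s\<^sup>2 = h * (1 + 1 / K)" using hpos K2 by (simp add: s_def)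
  have "1 + 1 / K > 0" using K2 by (simp add: add_pos_nonneg)
  then have spos: "s > 0" using hpos by (simp add: s_def)
  have bnd: "real (card X) + 2 * real n * K / \<theta> \<le> s\<^sup>2"
    unfolding s2 \<theta>_def h_def[symmetric] K_def[symmetric] using hpos K2
    by (simp add: field_simps power2_eq_square power3_eq_cube)
  have sg: "g ^ 3 \<le> s"
  proof (rule power2_le_imp_le)
    have "(g ^ 3)\<^sup>2 = h" using g by (simp add: h_def power_mult[symmetric])
    also have "\<dots> \<le> s\<^sup>2" unfolding s2 using hpos K2 by simp
    finally show "(g ^ 3)\<^sup>2 \<le> s\<^sup>2" .
  qed (use spos in simp)
  have sn: "2 ^ n * s ^ n \<le> (4 * h) ^ k * 2"
  proof -
    have "2 ^ n * s ^ n = (4 * s\<^sup>2) ^ k" unfolding n by (simp add: power_mult power_mult_distrib)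
    also have "\<dots> = (4 * h) ^ k * (1 + 1 / K) ^ k" unfolding s2 by (simp add: power_mult_distrib)
    also have "(1 + 1 / K) ^ k \<le> 2"
    proof -
      have "(1 + 1 / K) ^ k \<le> exp (1 / K) ^ k" using K2 by (intro power_mono exp_ge_add_one_self) auto
      also have "\<dots> = exp (1 / 2)" using n k by (simp add: exp_of_nat_mult[symmetric] K_def)
      also have "\<dots> \<le> 2" using exp_half_le2 .
      finally show ?thesis .
    qed
    finally show ?thesis using hpos by simp
  qed
  have main: "(\<Sum>T\<in>Pow TT. real (walks X r n (bd T) r)) \<le> 2 * (2 ^ n * s ^ n)" if r: "r \<in> X" for r
  proof -
    define W where "W = (\<lambda>T. real (walks X r n (bd T) r))"
    have "\<forall>T. T \<subseteq> TT \<longrightarrow> (\<exists>ys c f. enumerates r (bd T) ys c f)"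
      using exists_enumeration[OF _ r] by simp
    then obtain ys c f where enum: "\<And>T. T \<subseteq> TT \<Longrightarrow> enumerates r (bd T) (ys T) (c T) (f T)"
      by metis
    let ?q = "K * (2 * K ^ 3)\<^sup>2 * g\<^sup>2 / s"
    have W: "W T \<le> 2 ^ n * s ^ n * ?q ^ card (bd T) * (1 / h) ^ free {r} (ys T)" if T: "T \<subseteq> TT" for T
    proof (cases "card (bd T) \<le> n")
      case False
      have "finite (bd T)" using bd_edges[OF T] finite_edges_on[OF finX] finite_subset by metis
      then have "W T = 0" unfolding W_def using False finX by (simp add: walks_eq_0)
      then show ?thesis using spos hpos K2 g by simp
    next
      case True
      let ?f = "card (bd T)"
      have y: "set (ys T) \<subseteq> X" "insert r (set (ys T)) = insert r (\<Union>(bd T))"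
        "3 * free {r} (ys T) \<le> 3 * c T + card (bd T)" "c T \<le> card (\<Union>(bd T))"
        "c T = card (f T ` \<Union>(bd T) - {f T r})" "\<And>a b. {a, b} \<in> bd T \<Longrightarrow> f T a = f T b"
        using enum[OF T] by (simp_all add: enumerates_def)
      have "W T \<le> 2 ^ n * s ^ (n - ?f) * (K ^ (?f + 1) / K ^ card (insert r (\<Union>(bd T)))) * \<theta> ^ c T"
        unfolding W_def y(5)
        by (rule walks_bound[where K = n]) (use finX th spos bnd bd_edges[OF T] r y(6) True k n K2 in \<open>auto simp: K_def\<close>)
      also have "\<dots> \<le> 2 ^ n * (s ^ n / s ^ ?f) * K ^ ?f * ((2 * K ^ 3) ^ (2 * ?f) * (g\<^sup>2) ^ ?f * (1 / h) ^ free {r} (ys T))"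
      proof (intro mult_mono order_refl)
        show "s ^ (n - ?f) \<le> s ^ n / s ^ ?f" using True spos by (simp add: power_diff)
        have "insert r (\<Union>(bd T)) \<subseteq> X" using y(1,2) r by auto
        then have "finite (insert r (\<Union>(bd T)))" using finX by (rule finite_subset)
        then have "1 \<le> card (insert r (\<Union>(bd T)))" by (simp only: card_gt_0_iff Suc_le_eq One_nat_def) simp
        then have "K ^ 1 \<le> K ^ card (insert r (\<Union>(bd T)))" using K2 by (intro power_increasing) auto
        then show "K ^ (?f + 1) / K ^ card (insert r (\<Union>(bd T))) \<le> K ^ ?f"
          using K2 by (simp add: divide_le_eq mult.commute mult_left_mono)
        have c2: "c T \<le> 2 * ?f" using y(4) card_Union_bd[OF T] by linarith
        have "\<theta> ^ c T = (2 * K ^ 3) ^ c T * (1 / h) ^ c T" by (simp add: \<theta>_def power_divide)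
        also have "\<dots> \<le> (2 * K ^ 3) ^ (2 * ?f) * ((g\<^sup>2) ^ ?f * (1 / h) ^ free {r} (ys T))"
        proof (intro mult_mono)
          show "(2 * K ^ 3) ^ c T \<le> (2 * K ^ 3) ^ (2 * ?f)"
            using c2 K1[of 3] by (intro power_increasing) auto
          \<comment> \<open>Here \<open>3 * free <= 3 * c + f\<close> is used; the sixth root g
            keeps the exponents integral after doubling.\<close>
          have "h ^ free {r} (ys T) = g ^ (6 * free {r} (ys T))" using g by (simp add: h_def power_mult)
          also have "\<dots> \<le> g ^ (6 * c T + 2 * ?f)" using g1 y(3) by (intro power_increasing) auto
          also have "\<dots> = h ^ c T * (g\<^sup>2) ^ ?f" using g by (simp add: h_def power_mult power_add)
          finally have "h ^ free {r} (ys T) \<le> h ^ c T * (g\<^sup>2) ^ ?f" .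
          then show "(1 / h) ^ c T \<le> (g\<^sup>2) ^ ?f * (1 / h) ^ free {r} (ys T)"
            using hpos by (simp add: power_divide field_simps)
        qed (use K2 hpos g in auto)
        finally show "\<theta> ^ c T \<le> (2 * K ^ 3) ^ (2 * ?f) * (g\<^sup>2) ^ ?f * (1 / h) ^ free {r} (ys T)"
          by (simp add: mult.assoc)
      qed (use spos K2 th g hpos in auto)
      also have "\<dots> = 2 ^ n * s ^ n * ?q ^ ?f * (1 / h) ^ free {r} (ys T)"
        by (simp add: power_mult power_divide power_mult_distrib)
      finally show ?thesis .
    qed
    have empty: "W {} \<le> 2 ^ n * s ^ n"
    proof -
      have "W {} \<le> 2 ^ n * s ^ (n - card ({} :: 'a set set)) * (K ^ (card ({} :: 'a set set) + 1) / K ^ card (insert r (\<Union>({} :: 'a set set)))) * \<theta> ^ card ((\<lambda>_. ()) ` \<Union>({} :: 'a set set) - {()})"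
        unfolding W_def bd_empty
        by (rule walks_bound[where K = n]) (use finX th spos bnd r k n K2 in \<open>auto simp: K_def\<close>)
      then show ?thesis using K2 by simp
    qed
    have level: "(\<Sum>T | T \<subseteq> TT \<and> card (bd T) = m. W T) \<le> 2 ^ n * s ^ n * (1 / 2) ^ m" if m: "3 \<le> m" "m \<le> n" for m
    proof -
      let ?S = "{T. T \<subseteq> TT \<and> card (bd T) = m}"
      let ?M = "3 * K"
      have "(\<Sum>T\<in>?S. W T) \<le> (\<Sum>T\<in>?S. 2 ^ n * s ^ n * ?q ^ m * (1 / h) ^ free {r} (ys T))"
        by (intro sum_mono) (use W in auto)
      also have "\<dots> = 2 ^ n * s ^ n * ?q ^ m * (\<Sum>T\<in>?S. (1 / h) ^ free {r} (ys T))"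
        by (simp add: sum_distrib_left)
      also have "\<dots> \<le> 2 ^ n * s ^ n * ?q ^ m * (?M * (3 * ?M\<^sup>2) ^ (2 * m) * ?M ^ (2 * m))"
      proof (intro mult_left_mono sum_free_boundaries[OF r])
        show "2 * real m + 1 \<le> 3 * K" using m by (simp add: K_def)
        fix T assume T: "T \<in> ?S"
        then show "T \<subseteq> TT \<and> card (bd T) = m \<and> set (ys T) \<subseteq> X \<and> length (ys T) \<le> 2 * m \<and>
          insert r (set (ys T)) = insert r (\<Union>(bd T))"
          using enum[of T] card_Union_bd[of T] by (auto simp: enumerates_def)
      qed (use spos K2 g hpos in \<open>auto simp: h_def\<close>)
      also have "\<dots> \<le> 2 ^ n * s ^ n * ?q ^ m * (?M ^ m * (3 * ?M\<^sup>2) ^ (2 * m) * ?M ^ (2 * m))"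
      proof (intro mult_left_mono mult_right_mono)
        show "3 * K \<le> (3 * K) ^ m" using power_increasing[of 1 m "3 * K"] m K2 by simp
      qed (use spos K2 g hpos in auto)
      also have "\<dots> = 2 ^ n * s ^ n * (?q * (?M * (3 * ?M\<^sup>2)\<^sup>2 * ?M\<^sup>2)) ^ m"
      proof -
        have "A * Q ^ m * (a ^ m * b ^ (2 * m) * a ^ (2 * m)) = A * (Q * (a * b\<^sup>2 * a\<^sup>2)) ^ m" for A Q a b :: real
          by (simp add: power_mult power_mult_distrib)
        then show ?thesis .
      qed
      also have "\<dots> \<le> 2 ^ n * s ^ n * (1 / 2) ^ m"
      proof (intro mult_left_mono power_mono)
        \<comment> \<open>\<open>78732 = 4 * 3 * 27^2 * 9\<close> comes from
          \<open>(2 K^3)^2\<close>, M, \<open>(3 M^2)^2\<close> and \<open>M^2\<close> at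
          \<open>M = 3 K\<close>. The hypothesis carries twice this constant, which leaves 1/2 per
          edge.\<close>
        have "?q * (?M * (3 * ?M\<^sup>2)\<^sup>2 * ?M\<^sup>2) = 78732 * K ^ 14 * g\<^sup>2 / s"
          by (simp add: power_mult_distrib power_mult[symmetric]) (simp add: numeral_eq_Suc)
        also have "\<dots> \<le> (g / 2) * g\<^sup>2 / s"
          using big spos by (intro divide_right_mono mult_right_mono) (auto simp: K_def)
        also have "\<dots> = (g ^ 3 / s) / 2" by (simp add: power3_eq_cube power2_eq_square)
        also have "\<dots> \<le> 1 / 2" using sg spos by simp
        finally show "?q * (?M * (3 * ?M\<^sup>2)\<^sup>2 * ?M\<^sup>2) \<le> 1 / 2" .
      qed (use spos K2 g hpos in auto)
      finally show ?thesis .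
    qed
    have "(\<Sum>T\<in>Pow TT. W T) = W {} + (\<Sum>T\<in>Pow TT - {{}}. W T)"
      using finTT by (subst sum.remove[of _ "{}"]) auto
    also have "(\<Sum>T\<in>Pow TT - {{}}. W T) = (\<Sum>T | T \<subseteq> TT \<and> card (bd T) \<in> {3..n}. W T)"
    proof (rule sum.mono_neutral_right)
      show "\<forall>T\<in>Pow TT - {{}} - {T. T \<subseteq> TT \<and> card (bd T) \<in> {3..n}}. W T = 0"
      proof
        fix T assume T: "T \<in> Pow TT - {{}} - {T. T \<subseteq> TT \<and> card (bd T) \<in> {3..n}}"
        then have "3 \<le> card (bd T)" by (intro card_bd_ge_3) auto
        then have "n < card (bd T)" using T by auto
        moreover have "finite (bd T)" using T bd_edges[of T] finite_edges_on[OF finX] finite_subset by blast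
        ultimately show "W T = 0" using finX by (simp add: W_def walks_eq_0)
      qed
    qed (use finTT in auto)
    also have "\<dots> = (\<Sum>m\<in>{3..n}. \<Sum>T | T \<subseteq> TT \<and> card (bd T) = m. W T)"
    proof -
      have "{T. T \<subseteq> TT \<and> card (bd T) \<in> {3..n}} = (\<Union>m\<in>{3..n}. {T. T \<subseteq> TT \<and> card (bd T) = m})" by auto
      moreover have "finite {T. T \<subseteq> TT \<and> card (bd T) = m}" for m
        by (rule finite_subset[of _ "Pow TT"]) (use finTT in auto)
      ultimately show ?thesis by (simp only:) (subst sum.UNION_disjoint, auto)
    qed
    also have "\<dots> \<le> (\<Sum>m\<in>{3..n}. 2 ^ n * s ^ n * (1 / 2) ^ m)"
      by (intro sum_mono level) auto
    also have "\<dots> = 2 ^ n * s ^ n * (\<Sum>m\<in>{3..n}. (1 / 2) ^ m)" by (simp add: sum_distrib_left)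
    also have "\<dots> \<le> 2 ^ n * s ^ n * 1"
    proof (rule mult_left_mono)
      have "(\<Sum>m\<in>{3..n}. (1 / 2 :: real) ^ m) \<le> (\<Sum>m. (1 / 2) ^ Suc m)"
      proof -
        have "(\<Sum>m\<in>{3..n}. (1 / 2 :: real) ^ m) \<le> (\<Sum>m\<in>{Suc 0..<Suc n}. (1 / 2) ^ m)" by (rule sum_mono2) auto
        also have "\<dots> = (\<Sum>m\<in>{0..<n}. (1 / 2) ^ Suc m)" by (rule sum.shift_bounds_Suc_ivl)
        also have "\<dots> \<le> (\<Sum>m. (1 / 2) ^ Suc m)"
          by (rule sum_le_suminf) (auto intro: sums_summable power_half_series)
        finally show ?thesis .
      qed
      also have "\<dots> = 1" using power_half_series by (simp add: sums_iff)
      finally show "(\<Sum>m\<in>{3..n}. (1 / 2 :: real) ^ m) \<le> 1" .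
    qed (use spos in simp)
    finally have "(\<Sum>T\<in>Pow TT. W T) \<le> W {} + 2 ^ n * s ^ n" by simp
    then show ?thesis using empty by (simp add: W_def)
  qed
  have "(\<Sum>r\<in>X. \<Sum>T\<in>Pow TT. real (walks X r n (bd T) r)) \<le> (\<Sum>r\<in>X. 2 * (2 ^ n * s ^ n))"
    by (rule sum_mono[OF main])
  also have "\<dots> = h * (2 * (2 ^ n * s ^ n))" by (simp add: h_def)
  also have "\<dots> \<le> h * (2 * ((4 * h) ^ k * 2))" using sn hpos by (intro mult_left_mono) auto
  finally show ?thesis by (simp add: h_def)
qed

end

text \<open>The set \<open>S\<close> consists of the edges of sign \<open>-1\<close>.\<close>

definition sgn_of :: "'a set set \<Rightarrow> 'a set \<Rightarrow> real" where
  "sgn_of S e = (if e \<in> S then -1 else 1)"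

lemma sgn_of_square [simp]: "sgn_of S e * sgn_of S e = 1"
  by (simp add: sgn_of_def)

lemma abs_sgn_of [simp]: "\<bar>sgn_of S e\<bar> = 1"
  by (simp add: sgn_of_def)

lemma prod_sgn_toggle:
  assumes "finite Z"
  shows "(\<Prod>e\<in>toggle a Z. sgn_of S e) = sgn_of S a * (\<Prod>e\<in>Z. sgn_of S e)"
proof (cases "a \<in> Z")
  case True
  have "sgn_of S a * (\<Prod>e\<in>Z. sgn_of S e) = sgn_of S a * sgn_of S a * (\<Prod>e\<in>Z - {a}. sgn_of S e)"
    using prod.remove[OF assms True, of "sgn_of S"] by simp
  then show ?thesis using True by (simp add: toggle_def)
qed (use assms in \<open>simp add: toggle_def\<close>)

text \<open>Orthogonality of characters on sign functions: the sum factors over the edges, and an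
  edge of Z contributes \<open>-1 + 1 = 0\<close>.\<close>

lemma sum_Pow_prod_sgn:
  assumes "finite E" "Z \<subseteq> E"
  shows "(\<Sum>S\<in>Pow E. \<Prod>e\<in>Z. sgn_of S e) = (if Z = {} then 2 ^ card E else 0)"
proof -
  have "(\<Prod>e\<in>Z. sgn_of S e) = (\<Prod>e\<in>S. if e \<in> Z then -1 else 1) * (\<Prod>e\<in>E - S. 1)" if "S \<in> Pow E" for S
  proof -
    have fin: "finite Z" "finite S" using assms that finite_subset by auto
    have "(\<Prod>e\<in>Z. sgn_of S e) = (\<Prod>e\<in>Z \<inter> S. -1)"
      unfolding sgn_of_def by (rule prod.inter_restrict[OF fin(1), symmetric])
    also have "\<dots> = (\<Prod>e\<in>S \<inter> Z. -1)" by (simp add: Int_commute)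
    also have "\<dots> = (\<Prod>e\<in>S. if e \<in> Z then -1 else 1)"
      by (rule prod.inter_restrict[OF fin(2)])
    finally show ?thesis by simp
  qed
  then have "(\<Sum>S\<in>Pow E. \<Prod>e\<in>Z. sgn_of S e) = (\<Sum>S\<in>Pow E. (\<Prod>e\<in>S. if e \<in> Z then -1 else 1) * (\<Prod>e\<in>E - S. 1))"
    by (intro sum.cong) auto
  also have "\<dots> = (\<Prod>e\<in>E. (if e \<in> Z then -1 else 1) + (1 :: real))"
    by (rule prod_add[symmetric, OF assms(1)])
  also have "\<dots> = (if Z = {} then 2 ^ card E else 0)"
  proof (cases "Z = {}")
    case False
    then obtain e where "e \<in> Z" by blast
    then have "\<exists>e\<in>E. (if e \<in> Z then -1 else 1) + (1 :: real) = 0" using assms by (intro bexI[of _ e]) auto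
    then have "(\<Prod>e\<in>E. (if e \<in> Z then -1 else 1) + (1 :: real)) = 0"
      by (rule prod_zero[OF assms(1)])
    then show ?thesis using False by simp
  qed simp
  finally show ?thesis .
qed

primrec mpow :: "'a set \<Rightarrow> ('a \<Rightarrow> 'a \<Rightarrow> real) \<Rightarrow> nat \<Rightarrow> 'a \<Rightarrow> 'a \<Rightarrow> real" where
  "mpow X M 0 x y = (if x = y then 1 else 0)"
| "mpow X M (Suc n) x y = (\<Sum>w\<in>X. M x w * mpow X M n w y)"

definition signed :: "'a set set \<Rightarrow> ('a \<Rightarrow> 'a \<Rightarrow> real) \<Rightarrow> 'a \<Rightarrow> 'a \<Rightarrow> real" where
  "signed S c x y = (if x = y then 0 else sgn_of S {x, y} * c x y)"

section \<open>Averages over the admissible sign functions\<close>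

context triangle_system
begin

definition valid :: "'a set set set" where
  "valid = {S. S \<subseteq> edges_on X \<and> (\<forall>t\<in>TT. (\<Prod>e\<in>edges_on t. sgn_of S e) = -1)}"

lemma finite_valid: "finite valid"
  by (rule finite_subset[of _ "Pow (edges_on X)"]) (auto simp: valid_def finite_edges_on finX)

lemma edges_on_tri: "t \<in> TT \<Longrightarrow> edges_on t \<subseteq> edges_on X"
  using tri[of t] by (auto simp: edges_on_def)

lemma prod_sgn_bd:
  assumes T: "T \<subseteq> TT"
  shows "(\<Prod>t\<in>T. \<Prod>e\<in>edges_on t. sgn_of S e) = (\<Prod>e\<in>bd T. sgn_of S e)"
proof -
  have finE: "finite (edges_on X)" using finite_edges_on[OF finX] .
  have finT: "finite T" using finite_sub[OF T] .
  have "(\<Prod>t\<in>T. \<Prod>e\<in>edges_on t. sgn_of S e) = (\<Prod>t\<in>T. \<Prod>e\<in>edges_on X. if e \<subseteq> t then sgn_of S e else 1)"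
  proof (rule prod.cong[OF refl])
    fix t assume "t \<in> T"
    then have "edges_on t = {e \<in> edges_on X. e \<subseteq> t}" using edges_on_tri[of t] T by (auto simp: edges_on_def)
    then show "(\<Prod>e\<in>edges_on t. sgn_of S e) = (\<Prod>e\<in>edges_on X. if e \<subseteq> t then sgn_of S e else 1)"
      using prod.inter_filter[OF finE, of "sgn_of S" "\<lambda>e. e \<subseteq> t"] by simp
  qed
  also have "\<dots> = (\<Prod>e\<in>edges_on X. \<Prod>t\<in>T. if e \<subseteq> t then sgn_of S e else 1)" by (rule prod.swap)
  also have "\<dots> = (\<Prod>e\<in>edges_on X. if e \<in> bd T then sgn_of S e else 1)"
  proof (rule prod.cong[OF refl])
    fix e assume e: "e \<in> edges_on X"
    have "(\<Prod>t\<in>T. if e \<subseteq> t then sgn_of S e else 1) = (\<Prod>t\<in>{t \<in> T. e \<subseteq> t}. sgn_of S e)"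
      using prod.inter_filter[OF finT, of "\<lambda>_. sgn_of S e" "\<lambda>t. e \<subseteq> t"] by simp
    also have "\<dots> = sgn_of S e ^ card {t \<in> T. e \<subseteq> t}" by simp
    also have "\<dots> = (if odd (card {t \<in> T. e \<subseteq> t}) then sgn_of S e else 1)"
      by (simp add: sgn_of_def)
    finally show "(\<Prod>t\<in>T. if e \<subseteq> t then sgn_of S e else 1) = (if e \<in> bd T then sgn_of S e else 1)"
      using e by (simp add: bd_def edges_on_def)
  qed
  also have "\<dots> = (\<Prod>e\<in>{e \<in> edges_on X. e \<in> bd T}. sgn_of S e)"
    using prod.inter_filter[OF finE, of "sgn_of S" "\<lambda>e. e \<in> bd T"] by simp
  also have "{e \<in> edges_on X. e \<in> bd T} = bd T" using bd_edges[OF T] by blast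
  finally show ?thesis .
qed

lemma prod_sgn_symdiff:
  assumes "finite A" "finite B"
  shows "(\<Prod>e\<in>A. sgn_of S e) * (\<Prod>e\<in>B. sgn_of S e) = (\<Prod>e\<in>(A - B) \<union> (B - A). sgn_of S e)"
proof -
  have "(\<Prod>e\<in>A. sgn_of S e) = (\<Prod>e\<in>A \<inter> B. sgn_of S e) * (\<Prod>e\<in>A - B. sgn_of S e)"
       "(\<Prod>e\<in>B. sgn_of S e) = (\<Prod>e\<in>A \<inter> B. sgn_of S e) * (\<Prod>e\<in>B - A. sgn_of S e)"
    using prod.Int_Diff[OF assms(1), of "sgn_of S" B] prod.Int_Diff[OF assms(2), of "sgn_of S" A]
    by (simp_all only: Int_commute)
  moreover have "(\<Prod>e\<in>A \<inter> B. sgn_of S e) * (\<Prod>e\<in>A \<inter> B. sgn_of S e) = 1"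
    by (simp add: prod.distrib[symmetric])
  moreover have "(\<Prod>e\<in>(A - B) \<union> (B - A). sgn_of S e) = (\<Prod>e\<in>A - B. sgn_of S e) * (\<Prod>e\<in>B - A. sgn_of S e)"
    using assms by (intro prod.union_disjoint) auto
  ultimately show ?thesis by (metis (no_types, lifting) mult.assoc mult.commute mult.right_neutral)
qed

text \<open>The indicator of \<open>valid\<close> is the product of \<open>(1 - p) / 2\<close> over
  the triples, p being the product of the signs on a triple. Expanding it gives a sum over sets T of
  triples with the sign product on \<open>bd T\<close>, and orthogonality keeps those with
  \<open>bd T = Z\<close>.\<close>

lemma sum_valid_sgn:
  assumes Z: "Z \<subseteq> edges_on X"
  shows "(\<Sum>S\<in>valid. \<Prod>e\<in>Z. sgn_of S e) =
    2 ^ card (edges_on X) / 2 ^ card TT * (\<Sum>T\<in>Pow TT. if Z = bd T then (-1) ^ card T else 0)"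
proof -
  let ?E = "edges_on X"
  let ?p = "\<lambda>S Z. \<Prod>e\<in>Z. sgn_of S e"
  have finE: "finite ?E" using finite_edges_on[OF finX] .
  have finZ: "finite Z" using Z finE finite_subset by blast
  have ind: "(\<Prod>t\<in>TT. 1 + - ?p S (edges_on t)) = (if S \<in> valid then 2 ^ card TT else 0)" if "S \<subseteq> ?E" for S
  proof (cases "S \<in> valid")
    case True
    then have "(\<Prod>t\<in>TT. 1 + - ?p S (edges_on t)) = (\<Prod>t\<in>TT. 2)" by (intro prod.cong) (auto simp: valid_def)
    then show ?thesis using True by simp
  next
    case False
    then obtain t where t: "t \<in> TT" "?p S (edges_on t) \<noteq> -1" using \<open>S \<subseteq> ?E\<close> by (auto simp: valid_def)
    have "\<bar>?p S (edges_on t)\<bar> = 1" by (simp add: abs_prod)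
    then have "?p S (edges_on t) = 1" using t(2) by linarith
    then have "(\<Prod>t\<in>TT. 1 + - ?p S (edges_on t)) = 0" using t(1) finTT by (intro prod_zero) auto
    then show ?thesis using False by simp
  qed
  have expand: "(\<Prod>t\<in>TT. 1 + - ?p S (edges_on t)) = (\<Sum>T\<in>Pow TT. (-1) ^ card T * ?p S (bd T))" for S
  proof -
    have "(\<Prod>t\<in>TT. 1 + - ?p S (edges_on t)) = (\<Prod>t\<in>TT. - ?p S (edges_on t) + 1)" by (simp add: add.commute)
    also have "\<dots> = (\<Sum>T\<in>Pow TT. (\<Prod>t\<in>T. - ?p S (edges_on t)) * (\<Prod>t\<in>TT - T. 1))"
      by (rule prod_add[OF finTT])
    also have "\<dots> = (\<Sum>T\<in>Pow TT. (-1) ^ card T * ?p S (bd T))"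
      by (intro sum.cong refl) (simp add: prod_uminus prod_sgn_bd)
    finally show ?thesis .
  qed
  have "2 ^ card TT * (\<Sum>S\<in>valid. ?p S Z) = (\<Sum>S\<in>valid. 2 ^ card TT * ?p S Z)" by (simp add: sum_distrib_left)
  also have "\<dots> = (\<Sum>S\<in>Pow ?E. (\<Prod>t\<in>TT. 1 + - ?p S (edges_on t)) * ?p S Z)"
  proof (rule sum.mono_neutral_cong_left)
    show "\<forall>S\<in>Pow ?E - valid. (\<Prod>t\<in>TT. 1 + - ?p S (edges_on t)) * ?p S Z = 0" using ind by simp
    show "2 ^ card TT * ?p S Z = (\<Prod>t\<in>TT. 1 + - ?p S (edges_on t)) * ?p S Z" if "S \<in> valid" for S
      using ind[of S] that by (simp add: valid_def)
  qed (use finE in \<open>auto simp: valid_def\<close>)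
  also have "\<dots> = (\<Sum>S\<in>Pow ?E. \<Sum>T\<in>Pow TT. (-1) ^ card T * (?p S (bd T) * ?p S Z))"
    by (simp only: expand sum_distrib_right mult.assoc)
  also have "\<dots> = (\<Sum>T\<in>Pow TT. \<Sum>S\<in>Pow ?E. (-1) ^ card T * (?p S (bd T) * ?p S Z))" by (rule sum.swap)
  also have "\<dots> = (\<Sum>T\<in>Pow TT. 2 ^ card ?E * (if Z = bd T then (-1) ^ card T else 0))"
  proof (rule sum.cong[OF refl])
    fix T assume T: "T \<in> Pow TT"
    have b: "bd T \<subseteq> ?E" "finite (bd T)" using T bd_edges[of T] finE finite_subset by auto
    have "(\<Sum>S\<in>Pow ?E. (-1) ^ card T * (?p S (bd T) * ?p S Z)) = (-1) ^ card T * (\<Sum>S\<in>Pow ?E. ?p S ((bd T - Z) \<union> (Z - bd T)))"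
      by (simp only: sum_distrib_left prod_sgn_symdiff[OF b(2) finZ])
    also have "(\<Sum>S\<in>Pow ?E. ?p S ((bd T - Z) \<union> (Z - bd T))) = (if (bd T - Z) \<union> (Z - bd T) = {} then 2 ^ card ?E else 0)"
      by (rule sum_Pow_prod_sgn[OF finE]) (use b Z in auto)
    also have "((bd T - Z) \<union> (Z - bd T) = {}) = (Z = bd T)" by auto
    finally show "(\<Sum>S\<in>Pow ?E. (-1) ^ card T * (?p S (bd T) * ?p S Z)) = 2 ^ card ?E * (if Z = bd T then (-1) ^ card T else 0)"
      by simp
  qed
  finally have "2 ^ card TT * (\<Sum>S\<in>valid. ?p S Z) = 2 ^ card ?E * (\<Sum>T\<in>Pow TT. if Z = bd T then (-1) ^ card T else 0)"
    by (simp only: sum_distrib_left)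
  then show ?thesis by (simp add: field_simps)
qed

text \<open>Only the empty set of triples has empty boundary, so the sign conditions are independent
  and can be met.\<close>

lemma card_valid: "real (card valid) = 2 ^ card (edges_on X) / 2 ^ card TT"
proof -
  have "(\<Sum>T\<in>Pow TT. if {} = bd T then (-1) ^ card T else (0::real)) = (\<Sum>T\<in>{{} :: 'a set set}. 1)"
  proof (rule sum.mono_neutral_cong_right)
    show "\<forall>T\<in>Pow TT - {{}}. (if {} = bd T then (-1) ^ card T else (0::real)) = 0"
    proof
      fix T assume "T \<in> Pow TT - {{}}"
      then have "3 \<le> card (bd T)" by (intro card_bd_ge_3) auto
      then show "(if {} = bd T then (-1) ^ card T else (0::real)) = 0" by auto
    qed
  qed (use finTT in auto)
  then show ?thesis using sum_valid_sgn[of "{}"] by simp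
qed

lemma abs_sum_valid_sgn:
  assumes "Z \<subseteq> edges_on X"
  shows "\<bar>\<Sum>S\<in>valid. \<Prod>e\<in>Z. sgn_of S e\<bar> \<le> real (card valid) * (\<Sum>T\<in>Pow TT. if Z = bd T then 1 else 0)"
proof -
  have "\<bar>\<Sum>T\<in>Pow TT. if Z = bd T then (-1) ^ card T else (0::real)\<bar> \<le> (\<Sum>T\<in>Pow TT. \<bar>if Z = bd T then (-1) ^ card T else (0::real)\<bar>)"
    by (rule sum_abs)
  also have "\<dots> = (\<Sum>T\<in>Pow TT. if Z = bd T then 1 else 0)"
    by (intro sum.cong refl) simp
  finally show ?thesis
    unfolding sum_valid_sgn[OF assms] card_valid abs_mult
    by (intro mult_mono) auto
qed

text \<open>Each step of the walk multiplies by a sign, which toggles its edge in Z; the product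
  left at the end has a nonzero average only if its edge set is some \<open>bd T\<close>. Carrying
  \<open>bd T\<close> along from the start leaves a count of walks with odd edge set the symmetric
  difference of Z and \<open>bd T\<close>. The entries c matter only through their bound C.\<close>

lemma sum_valid_mpow:
  fixes c :: "'a \<Rightarrow> 'a \<Rightarrow> real"
  assumes c: "\<And>x y. \<bar>c x y\<bar> \<le> C" and C: "0 \<le> C" and r: "r \<in> X"
  shows "Z \<subseteq> edges_on X \<Longrightarrow> v \<in> X \<Longrightarrow>
    \<bar>\<Sum>S\<in>valid. (\<Prod>e\<in>Z. sgn_of S e) * mpow X (signed S c) n v r\<bar>
      \<le> real (card valid) * C ^ n * (\<Sum>T\<in>Pow TT. real (walks X r n ((Z - bd T) \<union> (bd T - Z)) v))"
proof (induction n arbitrary: Z v)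
  case 0
  show ?case
  proof (cases "v = r")
    case True
    have "((Z - bd T) \<union> (bd T - Z) = {}) = (Z = bd T)" for T by auto
    then show ?thesis using abs_sum_valid_sgn[OF 0(1)] True by (simp add: if_distrib[of real] cong: if_cong)
  qed simp
next
  case (Suc n)
  let ?p = "\<lambda>S Z. \<Prod>e\<in>Z. sgn_of S e"
  let ?sd = "\<lambda>Z T. (Z - bd T) \<union> (bd T - Z)"
  have finZ: "finite Z" using Suc.prems finite_edges_on[OF finX] finite_subset by blast
  have "(\<Sum>S\<in>valid. ?p S Z * mpow X (signed S c) (Suc n) v r)
     = (\<Sum>S\<in>valid. \<Sum>w\<in>X. ?p S Z * (signed S c v w * mpow X (signed S c) n w r))"
    by (simp add: sum_distrib_left)
  also have "\<dots> = (\<Sum>S\<in>valid. \<Sum>w\<in>X - {v}. c v w * (?p S (toggle {v, w} Z) * mpow X (signed S c) n w r))"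
  proof (rule sum.cong[OF refl])
    fix S
    show "(\<Sum>w\<in>X. ?p S Z * (signed S c v w * mpow X (signed S c) n w r))
      = (\<Sum>w\<in>X - {v}. c v w * (?p S (toggle {v, w} Z) * mpow X (signed S c) n w r))"
      by (rule sum.mono_neutral_cong_right) (use finX finZ in \<open>auto simp: signed_def prod_sgn_toggle\<close>)
  qed
  also have "\<dots> = (\<Sum>w\<in>X - {v}. \<Sum>S\<in>valid. c v w * (?p S (toggle {v, w} Z) * mpow X (signed S c) n w r))"
    by (rule sum.swap)
  also have "\<dots> = (\<Sum>w\<in>X - {v}. c v w * (\<Sum>S\<in>valid. ?p S (toggle {v, w} Z) * mpow X (signed S c) n w r))"
    by (simp only: sum_distrib_left)
  finally have "\<bar>\<Sum>S\<in>valid. ?p S Z * mpow X (signed S c) (Suc n) v r\<bar>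
     \<le> (\<Sum>w\<in>X - {v}. \<bar>c v w * (\<Sum>S\<in>valid. ?p S (toggle {v, w} Z) * mpow X (signed S c) n w r)\<bar>)"
    by (simp only: sum_abs)
  also have "\<dots> \<le> (\<Sum>w\<in>X - {v}. C * (real (card valid) * C ^ n * (\<Sum>T\<in>Pow TT. real (walks X r n (?sd (toggle {v, w} Z) T) w))))"
    unfolding abs_mult
  proof (intro sum_mono mult_mono c C Suc.IH)
    fix w assume w: "w \<in> X - {v}"
    show "toggle {v, w} Z \<subseteq> edges_on X" 
      using Suc.prems w by (auto simp: toggle_def intro!: edges_onI)
  qed auto
  also have "\<dots> = (\<Sum>w\<in>X - {v}. \<Sum>T\<in>Pow TT. real (card valid) * C ^ Suc n * real (walks X r n (toggle {v, w} (?sd Z T)) w))"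
  proof (rule sum.cong[OF refl])
    fix w
    have "?sd (toggle {v, w} Z) T = toggle {v, w} (?sd Z T)" for T by (auto simp: toggle_def)
    then show "C * (real (card valid) * C ^ n * (\<Sum>T\<in>Pow TT. real (walks X r n (?sd (toggle {v, w} Z) T) w)))
       = (\<Sum>T\<in>Pow TT. real (card valid) * C ^ Suc n * real (walks X r n (toggle {v, w} (?sd Z T)) w))"
      by (simp add: sum_distrib_left mult_ac)
  qed
  also have "\<dots> = (\<Sum>T\<in>Pow TT. \<Sum>w\<in>X - {v}. real (card valid) * C ^ Suc n * real (walks X r n (toggle {v, w} (?sd Z T)) w))"
    by (rule sum.swap)
  also have "\<dots> = real (card valid) * C ^ Suc n * (\<Sum>T\<in>Pow TT. real (walks X r (Suc n) (?sd Z T) v))"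
    by (simp add: sum_distrib_left)
  finally show ?case .
qed

end

section \<open>Operator norms from traces of powers\<close>

lemma mpow_add:
  assumes "finite X" "x \<in> X"
  shows "mpow X M (m + n) x y = (\<Sum>w\<in>X. mpow X M m x w * mpow X M n w y)"
  using assms(2)
proof (induction m arbitrary: x)
  case 0
  then show ?case using assms(1) by (simp add: if_distrib[of "\<lambda>a. a * _"] sum.delta cong: if_cong)
next
  case (Suc m)
  have "mpow X M (Suc m + n) x y = (\<Sum>w\<in>X. M x w * (\<Sum>z\<in>X. mpow X M m w z * mpow X M n z y))"
    using Suc.IH by simp
  also have "\<dots> = (\<Sum>w\<in>X. \<Sum>z\<in>X. M x w * mpow X M m w z * mpow X M n z y)"
    by (simp add: sum_distrib_left mult.assoc)
  also have "\<dots> = (\<Sum>z\<in>X. \<Sum>w\<in>X. M x w * mpow X M m w z * mpow X M n z y)" by (rule sum.swap)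
  finally show ?case by (simp add: sum_distrib_right)
qed

lemma mpow_1: "finite X \<Longrightarrow> y \<in> X \<Longrightarrow> mpow X M (Suc 0) x y = M x y"
  by (simp add: if_distrib[of "\<lambda>a. _ * a"] sum.delta' cong: if_cong)

lemma mpow_symmetric:
  assumes "finite X" "\<And>x y. M x y = M y x"
  shows "x \<in> X \<Longrightarrow> y \<in> X \<Longrightarrow> mpow X M n x y = mpow X M n y x"
proof (induction n arbitrary: x y)
  case (Suc n)
  have "mpow X M (Suc n) y x = (\<Sum>w\<in>X. mpow X M n y w * mpow X M (Suc 0) w x)"
    using mpow_add[OF assms(1) Suc.prems(2), of M n "Suc 0" x] by simp
  also have "\<dots> = (\<Sum>w\<in>X. M x w * mpow X M n w y)"
    using Suc assms by (intro sum.cong refl) (simp add: mpow_1 del: mpow.simps)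
  finally show ?case by simp
qed auto

definition mapply :: "'a set \<Rightarrow> ('a \<Rightarrow> 'a \<Rightarrow> real) \<Rightarrow> ('a \<Rightarrow> real) \<Rightarrow> 'a \<Rightarrow> real" where
  "mapply X M u x = (\<Sum>y\<in>X. M x y * u y)"

definition trace_pow :: "'a set \<Rightarrow> ('a \<Rightarrow> 'a \<Rightarrow> real) \<Rightarrow> nat \<Rightarrow> real" where
  "trace_pow X M n = (\<Sum>x\<in>X. mpow X M n x x)"

lemma trace_pow_double:
  assumes "finite X" "\<And>x y. M x y = M y x"
  shows "trace_pow X M (2 * k) = (\<Sum>x\<in>X. \<Sum>y\<in>X. (mpow X M k x y)\<^sup>2)"
proof -
  have "mpow X M (2 * k) x x = (\<Sum>y\<in>X. (mpow X M k x y)\<^sup>2)" if "x \<in> X" for x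
    using mpow_add[OF assms(1) that, of M k k x] that mpow_symmetric[OF assms]
    by (simp add: mult_2 power2_eq_square)
  then show ?thesis by (simp add: trace_pow_def)
qed

text \<open>By symmetry the squared norm of \<open>M^n u\<close> is the inner product of u with
  \<open>M^(2 n) u\<close>; then Cauchy-Schwarz.\<close>

lemma norm_mapply_mpow:
  assumes "finite X" "\<And>x y. M x y = M y x"
  shows "L2_set (mapply X (mpow X M n) u) X ^ 2 \<le> L2_set u X * L2_set (mapply X (mpow X M (2 * n)) u) X"
proof -
  have "L2_set (mapply X (mpow X M n) u) X ^ 2 = (\<Sum>x\<in>X. (mapply X (mpow X M n) u x)\<^sup>2)"
    by (simp add: L2_set_def sum_nonneg)
  also have "\<dots> = (\<Sum>x\<in>X. \<Sum>y\<in>X. \<Sum>z\<in>X. mpow X M n x y * u y * (mpow X M n x z * u z))"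
    by (simp add: mapply_def power2_eq_square sum_product)
  also have "\<dots> = (\<Sum>y\<in>X. \<Sum>x\<in>X. \<Sum>z\<in>X. mpow X M n x y * u y * (mpow X M n x z * u z))"
    by (rule sum.swap)
  also have "\<dots> = (\<Sum>y\<in>X. \<Sum>z\<in>X. \<Sum>x\<in>X. mpow X M n x y * u y * (mpow X M n x z * u z))"
    by (intro sum.cong refl sum.swap)
  also have "\<dots> = (\<Sum>y\<in>X. u y * (\<Sum>z\<in>X. (\<Sum>x\<in>X. mpow X M n y x * mpow X M n x z) * u z))"
  proof (intro sum.cong refl)
    fix y assume y: "y \<in> X"
    have "(\<Sum>x\<in>X. mpow X M n x y * u y * (mpow X M n x z * u z)) = u y * ((\<Sum>x\<in>X. mpow X M n y x * mpow X M n x z) * u z)" for z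
      using mpow_symmetric[where n = n and y = y, OF assms] y by (simp add: sum_distrib_left sum_distrib_right mult_ac cong: sum.cong)
    then show "(\<Sum>z\<in>X. \<Sum>x\<in>X. mpow X M n x y * u y * (mpow X M n x z * u z)) = u y * (\<Sum>z\<in>X. (\<Sum>x\<in>X. mpow X M n y x * mpow X M n x z) * u z)"
      by (simp add: sum_distrib_left)
  qed
  also have "\<dots> = (\<Sum>y\<in>X. u y * mapply X (mpow X M (2 * n)) u y)"
    using mpow_add[OF assms(1), of _ M n n] by (simp add: mapply_def mult_2)
  also have "\<dots> \<le> L2_set u X * L2_set (mapply X (mpow X M (2 * n)) u) X"
    by (rule order_trans[OF sum_mono[OF abs_ge_self]]) (simp add: abs_mult L2_set_mult_ineq)
  finally show ?thesis .
qed

text \<open>Instead of diagonalising M, the preceding inequality is iterated with the exponent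
  doubling each time, whence the powers of 2; the last matrix power is bounded by its
  Hilbert-Schmidt norm, whose square is a trace.\<close>

lemma norm_le_trace:
  assumes "finite X" "\<And>x y. M x y = M y x"
  shows "L2_set (mapply X M u) X ^ (2 ^ Suc j) \<le> L2_set u X ^ (2 ^ Suc j) * trace_pow X M (2 ^ Suc j)"
proof -
  let ?N = "\<lambda>n. L2_set (mapply X (mpow X M n) u) X"
  let ?U = "L2_set u X"
  have U: "?U \<ge> 0" by (rule L2_set_nonneg)
  have step: "L2_set (mapply X M u) X ^ (2 ^ i) \<le> ?U ^ (2 ^ i - 1) * ?N (2 ^ i)" for i
  proof (induction i)
    case 0
    have "mapply X (mpow X M (Suc 0)) u = mapply X M u"
      using assms(1) by (intro ext) (simp add: mapply_def mpow_1 del: mpow.simps)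
    then show ?case by (simp del: mpow.simps)
  next
    case (Suc i)
    have "L2_set (mapply X M u) X ^ (2 ^ Suc i) = (L2_set (mapply X M u) X ^ (2 ^ i))\<^sup>2"
      by (simp add: power_mult[symmetric] mult.commute)
    also have "\<dots> \<le> (?U ^ (2 ^ i - 1) * ?N (2 ^ i))\<^sup>2"
      by (rule power_mono[OF Suc]) (simp add: L2_set_nonneg)
    also have "\<dots> = ?U ^ (2 * (2 ^ i - 1)) * (?N (2 ^ i))\<^sup>2"
      by (simp add: power_mult_distrib power_mult[symmetric] mult.commute)
    also have "\<dots> \<le> ?U ^ (2 * (2 ^ i - 1)) * (?U * ?N (2 * 2 ^ i))"
      by (intro mult_left_mono norm_mapply_mpow assms) (simp add: U)
    also have "\<dots> = ?U ^ Suc (2 * (2 ^ i - 1)) * ?N (2 ^ Suc i)" by simp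
    also have "Suc (2 * (2 ^ i - 1)) = 2 ^ Suc i - (1 :: nat)"
    proof -
      have "1 \<le> (2 :: nat) ^ i" by simp
      then show ?thesis unfolding power_Suc by linarith
    qed
    finally show ?case .
  qed
  have hs: "(?N k)\<^sup>2 \<le> ?U\<^sup>2 * trace_pow X M (2 * k)" for k
  proof -
    have "(?N k)\<^sup>2 = (\<Sum>x\<in>X. (mapply X (mpow X M k) u x)\<^sup>2)" by (simp add: L2_set_def sum_nonneg)
    also have "\<dots> \<le> (\<Sum>x\<in>X. (\<Sum>y\<in>X. (mpow X M k x y)\<^sup>2) * (\<Sum>y\<in>X. (u y)\<^sup>2))"
      unfolding mapply_def by (intro sum_mono Cauchy_Schwarz_ineq_sum)
    also have "\<dots> = (\<Sum>y\<in>X. (u y)\<^sup>2) * trace_pow X M (2 * k)"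
      unfolding trace_pow_double[OF assms] by (simp add: sum_distrib_left mult.commute)
    also have "(\<Sum>y\<in>X. (u y)\<^sup>2) = ?U\<^sup>2" by (simp add: L2_set_def sum_nonneg)
    finally show ?thesis .
  qed
  have "L2_set (mapply X M u) X ^ (2 ^ Suc j) = (L2_set (mapply X M u) X ^ (2 ^ j))\<^sup>2"
    by (simp add: power_mult[symmetric] mult.commute)
  also have "\<dots> \<le> (?U ^ (2 ^ j - 1) * ?N (2 ^ j))\<^sup>2"
    by (rule power_mono[OF step]) (simp add: L2_set_nonneg)
  also have "\<dots> \<le> (?U ^ (2 ^ j - 1))\<^sup>2 * (?U\<^sup>2 * trace_pow X M (2 * 2 ^ j))"
    unfolding power_mult_distrib by (intro mult_left_mono hs) simp
  also have "\<dots> = (?U ^ (2 ^ j - 1) * ?U)\<^sup>2 * trace_pow X M (2 ^ Suc j)" by (simp add: power_mult_distrib)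
  also have "?U ^ (2 ^ j - 1) * ?U = ?U ^ (2 ^ j)"
    by (metis One_nat_def Suc_pred' mult.commute power_Suc zero_less_numeral zero_less_power)
  also have "(?U ^ (2 ^ j))\<^sup>2 = ?U ^ (2 ^ Suc j)" by (simp add: power_mult[symmetric] mult.commute)
  finally show ?thesis .
qed

context triangle_system
begin

text \<open>The traces are summed over all i before averaging, so that a single S serves every i.
  The loss \<open>4 * card X * card I\<close> is absorbed by a high power of \<gamma>. The bound
  \<open>2 * sqrt (card X)\<close> is the asymptotic norm of a symmetric matrix of independent
  signs.\<close>

lemma exists_valid_small_norm:
  fixes c :: "'i \<Rightarrow> 'a \<Rightarrow> 'a \<Rightarrow> real" and g \<gamma> :: real
  assumes I: "finite I" and c: "\<And>i x y. \<bar>c i x y\<bar> \<le> 1" "\<And>i x y. c i x y = c i y x"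
    and g: "0 < g" "g ^ 6 = real (card X)" and big: "157464 * 2 ^ (14 * Suc j) \<le> g"
    and \<gamma>: "0 \<le> \<gamma>" "4 * real (card X) * real (card I) \<le> \<gamma> ^ (2 ^ Suc j)"
  shows "\<exists>S\<in>valid. \<forall>i\<in>I. \<forall>u. L2_set (mapply X (signed S (c i)) u) X \<le> \<gamma> * (2 * sqrt (real (card X))) * L2_set u X"
proof -
  let ?n = "2 ^ Suc j :: nat" and ?k = "2 ^ j :: nat" and ?h = "real (card X)"
  have sym: "signed S (c i) x y = signed S (c i) y x" for S i x y
    using c(2) by (simp add: signed_def insert_commute)
  have tr_nonneg: "0 \<le> trace_pow X (signed S (c i)) ?n" for S i
    using trace_pow_double[where M = "signed S (c i)" and k = ?k, OF finX sym] by (simp add: sum_nonneg)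
  have tr_i: "(\<Sum>S\<in>valid. trace_pow X (signed S (c i)) ?n) \<le> real (card valid) * (4 * ?h * (4 * ?h) ^ ?k)" for i
  proof -
    have "(\<Sum>S\<in>valid. trace_pow X (signed S (c i)) ?n) = (\<Sum>r\<in>X. \<Sum>S\<in>valid. mpow X (signed S (c i)) ?n r r)"
      unfolding trace_pow_def by (rule sum.swap)
    also have "\<dots> \<le> (\<Sum>r\<in>X. real (card valid) * (\<Sum>T\<in>Pow TT. real (walks X r ?n (bd T) r)))"
    proof (rule sum_mono)
      fix r assume r: "r \<in> X"
      have "\<bar>\<Sum>S\<in>valid. (\<Prod>e\<in>{}. sgn_of S e) * mpow X (signed S (c i)) ?n r r\<bar>
        \<le> real (card valid) * 1 ^ ?n * (\<Sum>T\<in>Pow TT. real (walks X r ?n (({} - bd T) \<union> (bd T - {})) r))"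
        by (rule sum_valid_mpow[OF c(1) _ r _ r]) auto
      then show "(\<Sum>S\<in>valid. mpow X (signed S (c i)) ?n r r) \<le> real (card valid) * (\<Sum>T\<in>Pow TT. real (walks X r ?n (bd T) r))"
        by (simp del: mpow.simps walks.simps)
    qed
    also have "\<dots> = real (card valid) * (\<Sum>r\<in>X. \<Sum>T\<in>Pow TT. real (walks X r ?n (bd T) r))"
      by (simp only: sum_distrib_left)
    also have "\<dots> \<le> real (card valid) * (4 * ?h * (4 * ?h) ^ ?k)"
    proof (intro mult_left_mono sum_walks_boundary[OF g])
      have "real ?n ^ 14 = 2 ^ (14 * Suc j)" by (simp only: of_nat_power of_nat_numeral power_mult[symmetric] mult.commute)
      then show "157464 * real ?n ^ 14 \<le> g" using big by (simp only:)
    qed auto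
    finally show ?thesis .
  qed
  let ?B = "real (card I) * (4 * ?h * (4 * ?h) ^ ?k)"
  have "\<exists>S\<in>valid. (\<Sum>i\<in>I. trace_pow X (signed S (c i)) ?n) \<le> ?B"
  proof (rule ccontr)
    assume "\<not> ?thesis"
    then have "\<And>S. S \<in> valid \<Longrightarrow> ?B < (\<Sum>i\<in>I. trace_pow X (signed S (c i)) ?n)" by force
    moreover have "valid \<noteq> {}" using card_valid by force
    ultimately have "(\<Sum>S\<in>valid. ?B) < (\<Sum>S\<in>valid. \<Sum>i\<in>I. trace_pow X (signed S (c i)) ?n)"
      by (intro sum_strict_mono finite_valid)
    also have "\<dots> = (\<Sum>i\<in>I. \<Sum>S\<in>valid. trace_pow X (signed S (c i)) ?n)" by (rule sum.swap)
    also have "\<dots> \<le> (\<Sum>i\<in>I. real (card valid) * (4 * ?h * (4 * ?h) ^ ?k))" by (intro sum_mono tr_i)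
    finally show False by (simp add: mult_ac)
  qed
  then obtain S where S: "S \<in> valid" "(\<Sum>i\<in>I. trace_pow X (signed S (c i)) ?n) \<le> ?B" by blast
  have "L2_set (mapply X (signed S (c i)) u) X \<le> \<gamma> * (2 * sqrt ?h) * L2_set u X" if i: "i \<in> I" for i u
  proof (rule power_le_imp_le_base)
    have "trace_pow X (signed S (c i)) ?n \<le> (\<Sum>i\<in>I. trace_pow X (signed S (c i)) ?n)"
      by (rule member_le_sum[OF i tr_nonneg I])
    also have "\<dots> \<le> (4 * ?h * real (card I)) * (4 * ?h) ^ ?k" using S(2) by (simp add: mult_ac)
    also have "\<dots> \<le> \<gamma> ^ ?n * (4 * ?h) ^ ?k" by (intro mult_right_mono \<gamma>) auto
    also have "(4 * ?h) ^ ?k = (2 * sqrt ?h) ^ ?n"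
      by (simp add: power_mult power_mult_distrib)
    finally have tr: "trace_pow X (signed S (c i)) ?n \<le> \<gamma> ^ ?n * (2 * sqrt ?h) ^ ?n" .
    have "L2_set (mapply X (signed S (c i)) u) X ^ ?n \<le> L2_set u X ^ ?n * trace_pow X (signed S (c i)) ?n"
      by (rule norm_le_trace[OF finX sym])
    also have "\<dots> \<le> L2_set u X ^ ?n * (\<gamma> ^ ?n * (2 * sqrt ?h) ^ ?n)"
      by (intro mult_left_mono tr) (simp add: L2_set_nonneg)
    also have "\<dots> = (\<gamma> * (2 * sqrt ?h) * L2_set u X) ^ ?n" by (simp only: power_mult_distrib mult_ac)
    finally show "L2_set (mapply X (signed S (c i)) u) X ^ Suc (?n - 1) \<le> (\<gamma> * (2 * sqrt ?h) * L2_set u X) ^ Suc (?n - 1)"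
      by simp
    show "0 \<le> \<gamma> * (2 * sqrt ?h) * L2_set u X" using \<gamma> by (simp add: L2_set_nonneg)
  qed
  then show ?thesis using S(1) by blast
qed

end

section \<open>Primes in short intervals\<close>

text \<open>The junk value \<open>0 powr z = 0\<close> makes the terms at \<open>n = 0\<close> vanish.\<close>

definition zet :: "complex \<Rightarrow> complex" where
  "zet s = (\<Sum>n. of_nat n powr (-s))"

definition zet_ln :: "complex \<Rightarrow> complex" where
  "zet_ln s = (\<Sum>n. of_real (ln (real n)) * of_nat n powr (-s))"

definition mangoldt_series :: "complex \<Rightarrow> complex" where
  "mangoldt_series s = (\<Sum>n. mangoldt n * of_nat n powr (-s))"

lemma norm_nat_powr: "norm ((of_nat n :: complex) powr s) = real n powr Re s"
  by (cases "n = 0") (auto simp: powr_def Ln_of_nat)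

lemma summable_ln_powr:
  fixes \<sigma> :: real
  assumes "\<sigma> > 1"
  shows "summable (\<lambda>n. ln (real n) * real n powr (-\<sigma>))"
proof (rule summable_comparison_test_bigo)
  show "summable (\<lambda>n. norm (real n powr (-(1 + \<sigma>) / 2)))"
    using assms by (simp add: summable_real_powr_iff)
  show "(\<lambda>n. ln (real n) * real n powr (-\<sigma>)) \<in> O(\<lambda>n. real n powr (-(1 + \<sigma>) / 2))"
    using assms by real_asymp
qed

lemma mangoldt_le_ln: "mangoldt n \<le> ln (real n)" if "n > 0"
proof -
  have "(mangoldt n :: real) \<le> (\<Sum>d | d dvd n. mangoldt d)"
    by (rule member_le_sum) (use that in \<open>auto simp: mangoldt_nonneg\<close>)
  then show ?thesis using mangoldt_sum[of n, where 'a = real] that by simp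
qed

lemma summable_mangoldt_powr:
  fixes \<sigma> :: real
  assumes "\<sigma> > 1"
  shows "summable (\<lambda>n. mangoldt n * real n powr (-\<sigma>))"
proof (rule summable_comparison_test'[OF summable_ln_powr[OF assms], of 0])
  fix n :: nat
  show "norm (mangoldt n * real n powr - \<sigma>) \<le> ln (real n) * real n powr - \<sigma>"
    using mangoldt_le_ln[of n] by (cases "n = 0") (auto simp: abs_mult mult_right_mono)
qed

lemma sums_zet: "Re s > 1 \<Longrightarrow> (\<lambda>n. of_nat n powr (-s)) sums zet s"
  unfolding zet_def
  by (rule summable_sums, rule summable_norm_cancel) (simp add: norm_nat_powr summable_real_powr_iff)

lemma sums_mangoldt_series: "Re s > 1 \<Longrightarrow> (\<lambda>n. mangoldt n * of_nat n powr (-s)) sums mangoldt_series s"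
  unfolding mangoldt_series_def
  by (rule summable_sums, rule summable_norm_cancel)
     (simp add: norm_mult norm_nat_powr summable_mangoldt_powr)

lemma has_field_derivative_nat_powr:
  "((\<lambda>s::complex. of_nat n powr (-s)) has_field_derivative (- of_real (ln (real n)) * of_nat n powr (-s))) (at s)"
proof (cases "n = 0")
  case False
  then show ?thesis by (auto intro!: derivative_eq_intros simp: powr_def Ln_of_nat)
qed simp

lemma has_field_derivative_zet:
  assumes "Re s > 1"
  shows "(zet has_field_derivative (- zet_ln s)) (at s)"
proof -
  let ?S = "{s. Re s > 1}"
  have "\<exists>g g'. \<forall>x\<in>?S. ((\<lambda>n. of_nat n powr (-x)) sums g x) \<and>
    ((\<lambda>n. - of_real (ln (real n)) * of_nat n powr (-x)) sums g' x) \<and> (g has_field_derivative g' x) (at x)"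
  proof (rule series_and_derivative_comparison_local)
    show "open ?S" by (rule open_halfspace_Re_gt)
    fix x assume x: "x \<in> ?S"
    let ?d = "(Re x - 1) / 2"
    show "\<exists>d h. 0 < d \<and> summable h \<and> (\<forall>\<^sub>F n in sequentially. \<forall>y\<in>ball x d \<inter> ?S. norm (of_nat n powr - y :: complex) \<le> h n)"
    proof (intro exI[of _ ?d] exI[of _ "\<lambda>n. real n powr (-(1 + ?d))"] conjI always_eventually allI ballI)
      show "0 < ?d" "summable (\<lambda>n. real n powr (-(1 + ?d)))"
        using x by (auto simp: summable_real_powr_iff)
      fix n y assume y: "y \<in> ball x ?d \<inter> ?S"
      then have "\<bar>Re x - Re y\<bar> < ?d" using abs_Re_le_cmod[of "x - y"] by (auto simp: dist_norm)
      then have "1 + ?d \<le> Re y" by (simp add: abs_if field_simps split: if_splits)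
      then show "norm (of_nat n powr - y :: complex) \<le> real n powr (-(1 + ?d))"
        by (cases "n = 0") (auto simp: norm_nat_powr intro!: powr_mono)
    qed
  qed (rule has_field_derivative_nat_powr)
  then obtain g g' where g: "\<forall>x\<in>?S. ((\<lambda>n. of_nat n powr (-x)) sums g x) \<and>
    ((\<lambda>n. - of_real (ln (real n)) * of_nat n powr (-x)) sums g' x) \<and> (g has_field_derivative g' x) (at x)"
    by blast
  have "(zet has_field_derivative g' s) (at s)"
  proof (rule has_field_derivative_transform_within_open)
    show "(g has_field_derivative g' s) (at s)" using g assms by auto
    show "open ?S" by (rule open_halfspace_Re_gt)
    show "g x = zet x" if "x \<in> ?S" for x using g that by (auto simp: zet_def sums_iff)
  qed (use assms in auto)
  moreover have "g' s = - zet_ln s"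
  proof -
    have "(\<lambda>n. - of_real (ln (real n)) * of_nat n powr (-s)) sums g' s" using g assms by auto
    then have "(\<lambda>n. of_real (ln (real n)) * of_nat n powr (-s)) sums (- g' s)" using sums_minus by fastforce
    then show ?thesis by (simp add: zet_ln_def sums_iff)
  qed
  ultimately show ?thesis by simp
qed

text \<open>The convolution identity that \<Lambda> summed over the divisors of n is
  \<open>ln n\<close>; absolute convergence permits regrouping the pairs \<open>(a, b)\<close> by
  their product.\<close>

lemma mangoldt_series_mult_zet:
  assumes "Re s > 1"
  shows "mangoldt_series s * zet s = zet_ln s"
proof -
  let ?p = "\<lambda>n. (of_nat n :: complex) powr (-s)"
  \<comment> \<open>The index 0 has infinitely many divisors and is removed; its terms
    vanish.\<close>
  let ?P = "{0<..} :: nat set"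
  have a1: "((\<lambda>n. mangoldt n * ?p n) has_sum mangoldt_series s) UNIV"
    by (rule norm_summable_imp_has_sum[OF _ sums_mangoldt_series[OF assms]])
       (use assms in \<open>simp add: norm_mult norm_nat_powr summable_mangoldt_powr\<close>)
  have a2: "(?p has_sum zet s) UNIV"
    by (rule norm_summable_imp_has_sum[OF _ sums_zet[OF assms]])
       (use assms in \<open>simp add: norm_nat_powr summable_real_powr_iff\<close>)
  let ?l = "\<lambda>n. mangoldt n * ?p n"
  have b1: "(?l has_sum mangoldt_series s) ?P"
    by (rule iffD1[OF has_sum_cong_neutral a1]) auto
  have b2: "(?p has_sum zet s) ?P"
    by (rule iffD1[OF has_sum_cong_neutral a2]) auto
  have abs1: "(\<lambda>n. norm (?l n)) summable_on ?P" and abs2: "(\<lambda>n. norm (?p n)) summable_on ?P"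
    using b1[THEN has_sum_imp_summable] b2[THEN has_sum_imp_summable]
    by (simp_all only: summable_on_iff_abs_summable_on_complex)
  let ?f = "\<lambda>(a, b). ?l a * ?p b"
  have "(\<lambda>x. norm (?f x)) summable_on ?P \<times> ?P"
    unfolding Infinite_Sum.abs_summable_on_Sigma_iff
    using abs1 abs2 by (auto simp: norm_mult infsum_cmult_right' abs_mult intro!: summable_on_cmult_right summable_on_cmult_left)
  then have "?f summable_on ?P \<times> ?P" by (rule abs_summable_summable)
  then have "(?f has_sum mangoldt_series s * zet s) (?P \<times> ?P)"
    by (intro has_sum_SigmaI[where g = "\<lambda>a. ?l a * zet s"])
       (auto intro!: has_sum_cmult_right has_sum_cmult_left b1 b2)
  moreover have "(?f has_sum mangoldt_series s * zet s) (?P \<times> ?P) \<longleftrightarrow>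
    ((\<lambda>(n, d). mangoldt d * ?p n) has_sum mangoldt_series s * zet s) (SIGMA n:?P. {d. d dvd n})"
    by (rule has_sum_reindex_bij_witness[where i = "\<lambda>(n, d). (d, n div d)" and j = "\<lambda>(a, b). (a * b, a)"])
       (auto simp: powr_times_real intro!: Nat.gr0I)
  ultimately have "((\<lambda>n. \<Sum>d | d dvd n. mangoldt d * ?p n) has_sum mangoldt_series s * zet s) ?P"
    by (rule_tac has_sum_SigmaD) (auto intro!: has_sum_finite)
  then have "((\<lambda>n. of_real (ln (real n)) * ?p n) has_sum mangoldt_series s * zet s) ?P"
    by (rule iffD1[OF has_sum_cong, rotated]) (auto simp: sum_distrib_right[symmetric] mangoldt_sum)
  then have "((\<lambda>n. of_real (ln (real n)) * ?p n) has_sum mangoldt_series s * zet s) UNIV"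
    by (rule iffD1[OF has_sum_cong_neutral, rotated -1]) auto
  then show ?thesis unfolding zet_ln_def by (metis has_sum_imp_sums sums_unique)
qed

text \<open>The continuation of \<open>(s - 1) \<zeta>(s)\<close> to \<open>Re s > 0\<close>: each \<open>n powr (-s)\<close> is compared with the integral of
  \<open>x powr (-s)\<close> over \<open>[n, n + 1]\<close>. The term at \<open>n = 0\<close> is 1.\<close>

definition Zet_term :: "nat \<Rightarrow> complex \<Rightarrow> complex" where
  "Zet_term n s = (s - 1) * of_nat n powr (-s) + (of_nat (Suc n) powr (1 - s) - of_nat n powr (1 - s))"

definition Zet :: "complex \<Rightarrow> complex" where
  "Zet s = (\<Sum>n. Zet_term n s)"

text \<open>The term is the first-order Taylor remainder of \<open>x powr (1 - s)\<close> between n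
  and n + 1. Two mean value bounds reduce it to the second derivative, and the power of n gained
  gives convergence for \<open>Re s > 0\<close>.\<close>

lemma norm_Zet_term_le:
  assumes n: "n > 0" and s: "Re s \<ge> \<sigma>" "\<sigma> > 0"
  shows "norm (Zet_term n s) \<le> norm s * norm (s - 1) * real n powr (-\<sigma> - 1)"
proof -
  define S where "S = closed_segment (of_nat n :: complex) (of_nat (Suc n))"
  have S_eq: "\<exists>u. x = of_real (real n + u) \<and> 0 \<le> u \<and> u \<le> 1" if "x \<in> S" for x
  proof -
    from that obtain u where "x = (1 - u) *\<^sub>R of_nat n + u *\<^sub>R of_nat (Suc n)" "0 \<le> u" "u \<le> 1"
      unfolding S_def closed_segment_def by blast
    then show ?thesis by (intro exI[of _ u]) (simp add: scaleR_conv_of_real algebra_simps)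
  qed
  have conv: "convex S" by (simp add: S_def)
  have inS: "of_nat n \<in> S" "of_nat (Suc n) \<in> S" by (simp_all add: S_def)
  let ?B = "norm s * norm (s - 1) * real n powr (-\<sigma> - 1)"
  have dist1: "norm (x - of_nat n) \<le> 1" if "x \<in> S" for x
    using S_eq[OF that] by auto
  have nonpos: "x \<notin> \<real>\<^sub>\<le>\<^sub>0" if "x \<in> S" for x
    using S_eq[OF that] n by (auto simp: complex_nonpos_Reals_iff)
  have pw: "norm (x powr (-s - 1)) \<le> real n powr (-\<sigma> - 1)" if "x \<in> S" for x
  proof -
    from S_eq[OF that] obtain u where u: "x = of_real (real n + u)" "0 \<le> u" by blast
    have "norm (x powr (-s - 1)) = (real n + u) powr Re (-s - 1)"
      using u(2) n unfolding u(1) by (subst norm_powr_real_powr) auto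
    also have "\<dots> \<le> (real n + u) powr (-\<sigma> - 1)" by (rule powr_mono) (use u n s in auto)
    also have "\<dots> \<le> real n powr (-\<sigma> - 1)" by (rule powr_mono2') (use u n s in auto)
    finally show ?thesis .
  qed
  have d1: "norm ((1 - s) * x powr (-s) - (1 - s) * of_nat n powr (-s)) \<le> ?B" if x: "x \<in> S" for x
  proof -
    have "norm ((1 - s) * x powr (-s) - (1 - s) * of_nat n powr (-s)) \<le> ?B * norm (x - of_nat n)"
    proof (rule field_differentiable_bound[OF conv _ _ x inS(1)])
      fix z assume z: "z \<in> S"
      show "((\<lambda>z. (1 - s) * z powr (-s)) has_field_derivative ((1 - s) * (-s * z powr (-s - 1)))) (at z within S)"
        using nonpos[OF z] by (auto intro!: derivative_eq_intros)
      have "norm ((1 - s) * (-s * z powr (-s - 1))) = norm s * norm (s - 1) * norm (z powr (-s - 1))"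
        by (simp add: norm_mult norm_minus_commute)
      also have "\<dots> \<le> ?B" using pw[OF z] by (intro mult_left_mono) auto
      finally show "norm ((1 - s) * (-s * z powr (-s - 1))) \<le> ?B" .
    qed
    also have "\<dots> \<le> ?B * 1" using dist1[OF x] by (intro mult_left_mono) auto
    finally show ?thesis by simp
  qed
  let ?g = "\<lambda>x. x powr (1 - s) - x * ((1 - s) * of_nat n powr (-s))"
  have "norm (?g (of_nat (Suc n)) - ?g (of_nat n)) \<le> ?B * norm (of_nat (Suc n) - of_nat n :: complex)"
  proof (rule field_differentiable_bound[OF conv _ _ inS(2) inS(1)])
    fix z assume z: "z \<in> S"
    show "(?g has_field_derivative ((1 - s) * z powr (-s) - (1 - s) * of_nat n powr (-s))) (at z within S)"
      using nonpos[OF z] by (auto intro!: derivative_eq_intros)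
  qed (rule d1)
  also have "?g (of_nat (Suc n)) - ?g (of_nat n) = Zet_term n s"
    by (simp add: Zet_term_def algebra_simps)
  finally show ?thesis by simp
qed

lemma summable_nat_powr_iff: "summable (\<lambda>n. C * real n powr r)" if "r < -1" for C r :: real
  using that by (intro summable_mult) (simp add: summable_real_powr_iff)

lemma Zet_term_holomorphic:
  "Zet_term n field_differentiable at s"
proof -
  have *: "(\<lambda>s::complex. (of_nat m :: complex) powr f s) field_differentiable at s" if "f field_differentiable at s" for m f
  proof (cases "m = 0")
    case False
    from that obtain f' where "(f has_field_derivative f') (at s)" by (auto simp: field_differentiable_def)
    then have "((\<lambda>s. of_nat m powr f s) has_field_derivative (of_nat m powr f s * (f' * Ln (of_nat m)))) (at s)"
      using False unfolding powr_def by (auto intro!: derivative_eq_intros)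
    then show ?thesis by (auto simp: field_differentiable_def)
  qed simp
  show ?thesis unfolding Zet_term_def
    by (intro field_differentiable_add field_differentiable_diff field_differentiable_mult *
      field_differentiable_minus field_differentiable_ident field_differentiable_const)
qed

lemma Zet_sums_and_differentiable:
  assumes "Re s > 0"
  shows "(\<lambda>n. Zet_term n s) sums Zet s \<and> Zet field_differentiable (at s)"
proof -
  let ?S = "{s. Re s > 0}"
  have "\<exists>g g'. \<forall>x\<in>?S. ((\<lambda>n. Zet_term n x) sums g x) \<and>
    ((\<lambda>n. deriv (Zet_term n) x) sums g' x) \<and> (g has_field_derivative g' x) (at x)"
  proof (rule series_and_derivative_comparison_local)
    show "open ?S" by (rule open_halfspace_Re_gt)
    fix x assume x: "x \<in> ?S"
    let ?d = "Re x / 2" and ?M = "norm x + Re x / 2"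
    show "\<exists>d h. 0 < d \<and> summable h \<and> (\<forall>\<^sub>F n in sequentially. \<forall>y\<in>ball x d \<inter> ?S. norm (Zet_term n y) \<le> h n)"
    proof (intro exI[of _ ?d] exI[of _ "\<lambda>n. (?M * (?M + 1)) * real n powr (-?d - 1)"] conjI)
      show "\<forall>\<^sub>F n in sequentially. \<forall>y\<in>ball x ?d \<inter> ?S. norm (Zet_term n y) \<le> (?M * (?M + 1)) * real n powr (-?d - 1)"
        using eventually_gt_at_top[of 0]
      proof eventually_elim
        case (elim n)
        show ?case
        proof
          fix y assume "y \<in> ball x ?d \<inter> ?S"
          then have y: "norm (x - y) < ?d" by (auto simp: dist_norm)
          have "Re x - Re y < ?d" using y abs_Re_le_cmod[of "x - y"] by simp
          then have "?d \<le> Re y" by (simp add: field_simps)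
          then have "norm (Zet_term n y) \<le> norm y * norm (y - 1) * real n powr (-?d - 1)"
            using x elim by (intro norm_Zet_term_le) auto
          also have "\<dots> \<le> (?M * (?M + 1)) * real n powr (-?d - 1)"
          proof (intro mult_mono)
            have "norm y \<le> norm x + norm (x - y)" using norm_triangle_ineq4[of x "x - y"] by simp
            then show 1: "norm y \<le> ?M" using y by linarith
            have "norm (y - 1) \<le> norm y + 1" using norm_triangle_ineq4[of y 1] by simp
            then show "norm (y - 1) \<le> ?M + 1" using 1 by linarith
          qed (use x in auto)
          finally show "norm (Zet_term n y) \<le> (?M * (?M + 1)) * real n powr (-?d - 1)" .
        qed
      qed
    qed (use x in \<open>simp_all add: summable_nat_powr_iff del: summable_cmult_iff\<close>)
  next
    fix n x show "(Zet_term n has_field_derivative deriv (Zet_term n) x) (at x)"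
      using Zet_term_holomorphic field_differentiable_derivI by blast
  qed
  then obtain g g' where g: "\<forall>x\<in>?S. ((\<lambda>n. Zet_term n x) sums g x) \<and>
    ((\<lambda>n. deriv (Zet_term n) x) sums g' x) \<and> (g has_field_derivative g' x) (at x)"
    by blast
  have "(Zet has_field_derivative g' s) (at s)"
  proof (rule has_field_derivative_transform_within_open)
    show "(g has_field_derivative g' s) (at s)" using g assms by auto
    show "open ?S" by (rule open_halfspace_Re_gt)
    show "g x = Zet x" if "x \<in> ?S" for x using g that by (auto simp: Zet_def sums_iff)
  qed (use assms in auto)
  moreover have "(\<lambda>n. Zet_term n s) sums Zet s" using g assms by (auto simp: Zet_def sums_iff)
  ultimately show ?thesis by (auto simp: field_differentiable_def)
qed

lemma Zet_1: "Zet 1 = 1"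
proof -
  have "Zet_term n 1 = (if n = 0 then 1 else 0)" for n by (simp add: Zet_term_def del: of_nat_Suc)
  then show ?thesis using sums_single[of 0 "\<lambda>_. 1 :: complex"] by (simp add: Zet_def sums_iff)
qed

text \<open>For \<open>Re s > 1\<close> the differences telescope to 0: the powers tend to 0, and
  the one at index 0 is 0 by convention.\<close>

lemma Zet_eq:
  assumes "Re s > 1"
  shows "Zet s = (s - 1) * zet s"
proof -
  have "(\<lambda>n. (of_nat n :: complex) powr (1 - s)) \<longlonglongrightarrow> 0"
  proof (rule tendsto_norm_zero_cancel)
    have "(\<lambda>n. real n powr (1 - Re s)) \<longlonglongrightarrow> 0" using assms by real_asymp
    then show "(\<lambda>n. norm ((of_nat n :: complex) powr (1 - s))) \<longlonglongrightarrow> 0" by (simp add: norm_nat_powr)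
  qed
  from telescope_sums[OF this] have "(\<lambda>n. (of_nat (Suc n) :: complex) powr (1 - s) - of_nat n powr (1 - s)) sums 0"
    by simp
  with sums_mult[OF sums_zet[OF assms], of "s - 1"]
  have "(\<lambda>n. Zet_term n s) sums ((s - 1) * zet s + 0)"
    unfolding Zet_term_def by (rule sums_add)
  then show ?thesis using Zet_sums_and_differentiable[of s] assms sums_unique2 by fastforce
qed

lemma has_field_derivative_zet':
  assumes "Re s > 1"
  shows "(zet has_field_derivative (- mangoldt_series s * zet s)) (at s)"
  using has_field_derivative_zet[OF assms] mangoldt_series_mult_zet[OF assms] by simp

section \<open>Non-vanishing of zeta up to the line Re s = 1\<close>

definition zet_341 :: "real \<Rightarrow> complex \<Rightarrow> complex" where
  "zet_341 t s = zet s ^ 3 * zet (s + \<i> * t) ^ 4 * zet (s + \<i> * (2 * t))"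

definition mangoldt_341 :: "real \<Rightarrow> complex \<Rightarrow> complex" where
  "mangoldt_341 t s = 3 * mangoldt_series s + 4 * mangoldt_series (s + \<i> * t) + mangoldt_series (s + \<i> * (2 * t))"

lemma has_field_derivative_zet_341:
  assumes "Re s > 1"
  shows "(zet_341 t has_field_derivative (- mangoldt_341 t s * zet_341 t s)) (at s)"
proof -
  have d: "((\<lambda>s. zet (s + \<i> * of_real c)) has_field_derivative
     (- mangoldt_series (s + \<i> * of_real c) * zet (s + \<i> * of_real c))) (at s)" for c
  proof -
    have "((\<lambda>s. zet (s + \<i> * of_real c)) has_field_derivative
       (- mangoldt_series (s + \<i> * of_real c) * zet (s + \<i> * of_real c)) * 1) (at s)"
    proof (rule DERIV_chain2[where f = zet])
      show "(zet has_field_derivative - mangoldt_series (s + \<i> * of_real c) * zet (s + \<i> * of_real c)) (at (s + \<i> * of_real c))"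
        by (rule has_field_derivative_zet') (use assms in simp)
      show "((\<lambda>s. s + \<i> * of_real c) has_field_derivative 1) (at s)"
        by (rule DERIV_cong[OF DERIV_add[OF DERIV_ident DERIV_const]]) simp
    qed
    then show ?thesis by simp
  qed
  show ?thesis
    unfolding zet_341_def
    by (rule DERIV_cong[OF DERIV_mult[OF DERIV_mult[OF DERIV_power[OF has_field_derivative_zet'[OF assms]] DERIV_power[OF d[of t]]] d[of "2 * t"]]])
       (simp add: mangoldt_341_def eval_nat_numeral algebra_simps)
qed

lemma Re_nat_powr:
  "Re (of_nat n powr (-(of_real \<sigma> + \<i> * of_real t))) = real n powr (-\<sigma>) * cos (t * ln (real n))"
proof (cases "n = 0")
  case False
  then show ?thesis by (simp add: powr_def Re_exp Ln_of_nat algebra_simps)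
qed simp

text \<open>\<open>3 + 4 cos x + cos 2x = 2 (1 + cos x)\<^sup>2\<close>.\<close>

lemma Re_mangoldt_341_nonneg:
  assumes "\<sigma> > 1"
  shows "Re (mangoldt_341 t (of_real \<sigma>)) \<ge> 0"
proof -
  have s: "(\<lambda>n. mangoldt n * (real n powr (-\<sigma>) * cos (c * ln (real n)))) sums Re (mangoldt_series (of_real \<sigma> + \<i> * of_real c))" for c
    using sums_Re[OF sums_mangoldt_series[of "of_real \<sigma> + \<i> * of_real c"]] assms Re_nat_powr[of _ \<sigma> c]
    by simp
  let ?c = "\<lambda>n. cos (t * ln (real n))" and ?m = "\<lambda>n. mangoldt n * real n powr (-\<sigma>)"
  have S: "(\<lambda>n. 3 * (mangoldt n * (real n powr (-\<sigma>) * cos (0 * ln (real n)))) + 4 * (mangoldt n * (real n powr (-\<sigma>) * cos (t * ln (real n)))) +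
     mangoldt n * (real n powr (-\<sigma>) * cos (2 * t * ln (real n)))) sums
     (3 * Re (mangoldt_series (of_real \<sigma> + \<i> * of_real 0)) + 4 * Re (mangoldt_series (of_real \<sigma> + \<i> * of_real t)) + Re (mangoldt_series (of_real \<sigma> + \<i> * of_real (2 * t))))"
    by (intro sums_add sums_mult s)
  have E: "3 * (mangoldt n * (real n powr (-\<sigma>) * cos (0 * ln (real n)))) + 4 * (mangoldt n * (real n powr (-\<sigma>) * cos (t * ln (real n)))) +
     mangoldt n * (real n powr (-\<sigma>) * cos (2 * t * ln (real n))) = 2 * ?m n * (1 + ?c n)\<^sup>2" for n
  proof -
    have "cos (2 * t * ln (real n)) = 2 * (cos (t * ln (real n)))\<^sup>2 - 1"
      using cos_double_cos[of "t * ln (real n)"] by (simp add: mult_ac)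
    moreover have "3 * (m * (r * 1)) + 4 * (m * (r * c)) + m * (r * (2 * c\<^sup>2 - 1)) = 2 * (m * r) * (1 + c)\<^sup>2" for m r c :: real
      by (simp add: algebra_simps power2_eq_square)
    ultimately show ?thesis by simp
  qed
  have "0 \<le> 3 * Re (mangoldt_series (of_real \<sigma> + \<i> * of_real 0)) + 4 * Re (mangoldt_series (of_real \<sigma> + \<i> * of_real t)) + Re (mangoldt_series (of_real \<sigma> + \<i> * of_real (2 * t)))"
    by (rule sums_le[OF _ sums_zero S[unfolded E]]) (simp add: mangoldt_nonneg)
  also have "\<dots> = Re (mangoldt_341 t (of_real \<sigma>))"
    by (simp add: mangoldt_341_def)
  finally show ?thesis .
qed

text \<open>The logarithmic derivative of the modulus along the real axis is
  \<open>- Re (mangoldt_341 t x)\<close>, which is not positive. Differentiating the squared modulus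
  avoids logarithms of zeta.\<close>

lemma norm_zet_341_antimono:
  assumes "1 < a" "a \<le> b"
  shows "norm (zet_341 t (of_real b)) \<le> norm (zet_341 t (of_real a))"
proof -
  let ?h = "\<lambda>x. zet_341 t (of_real x)"
  have "(\<lambda>x. (Re (?h x))\<^sup>2 + (Im (?h x))\<^sup>2) b \<le> (\<lambda>x. (Re (?h x))\<^sup>2 + (Im (?h x))\<^sup>2) a"
  proof (rule DERIV_nonpos_imp_nonincreasing[OF assms(2)])
    fix x assume "a \<le> x" "x \<le> b"
    then have x: "x > 1" using assms by simp
    let ?D = "- mangoldt_341 t (of_real x) * ?h x"
    have v: "(?h has_vector_derivative ?D) (at x)"
      using has_vector_derivative_real_field[OF has_field_derivative_zet_341] x by simp
    have sq: "((\<lambda>x. (u x)\<^sup>2 + (v x)\<^sup>2) has_real_derivative (2 * u x * u' + 2 * v x * v')) (at x)"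
      if "(u has_real_derivative u') (at x)" "(v has_real_derivative v') (at x)" for u v u' v'
      by (rule derivative_eq_intros that refl)+ simp
    have "((\<lambda>x. (Re (?h x))\<^sup>2 + (Im (?h x))\<^sup>2) has_real_derivative
       (2 * Re (?h x) * Re ?D + 2 * Im (?h x) * Im ?D)) (at x)"
      by (rule sq; unfold has_real_derivative_iff_has_vector_derivative)
         (rule bounded_linear.has_vector_derivative[OF bounded_linear_Re v] bounded_linear.has_vector_derivative[OF bounded_linear_Im v])+
    moreover have "2 * Re (?h x) * Re ?D + 2 * Im (?h x) * Im ?D = - 2 * Re (mangoldt_341 t (of_real x)) * ((Re (?h x))\<^sup>2 + (Im (?h x))\<^sup>2)"
      by (simp add: algebra_simps power2_eq_square)
    moreover have "- 2 * Re (mangoldt_341 t (of_real x)) * ((Re (?h x))\<^sup>2 + (Im (?h x))\<^sup>2) \<le> 0"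
      using Re_mangoldt_341_nonneg[OF x, of t] by (intro mult_nonpos_nonneg) auto
    ultimately show "\<exists>y. ((\<lambda>x. (Re (?h x))\<^sup>2 + (Im (?h x))\<^sup>2) has_real_derivative y) (at x) \<and> y \<le> 0"
      by (intro exI[of _ "2 * Re (?h x) * Re ?D + 2 * Im (?h x) * Im ?D"]) simp
  qed
  then show ?thesis by (simp add: cmod_def)
qed

text \<open>The term of index 1 outweighs the rest: of the four powers in \<open>n powr (-4)\<close>
  two are bounded by 1/4 and two are summed as inverse squares, giving less than 1.\<close>

lemma zet_nonzero_large:
  assumes "Re s \<ge> 4"
  shows "zet s \<noteq> 0"
proof
  assume z: "zet s = 0"
  let ?p = "\<lambda>n. (of_nat n :: complex) powr (-s)"
  have s0: "?p sums 0" using sums_zet[of s] assms z by simp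
  have "(\<lambda>n. ?p (Suc (Suc n))) sums (0 - (\<Sum>i<Suc (Suc 0). ?p i))"
    using sums_iff_shift'[of ?p 2 0] s0 by (simp add: numeral_2_eq_2)
  then have t: "(\<lambda>n. ?p (Suc (Suc n))) sums (-1)" by simp
  have q: "(\<lambda>n. 1 / (real (Suc (Suc n)))\<^sup>2) sums (pi\<^sup>2 / 6 - 1)"
    using inverse_squares_sums sums_Suc_iff[of "\<lambda>n. 1 / (real (Suc n))\<^sup>2" "pi\<^sup>2 / 6 - 1"] by simp
  have "norm (-1 :: complex) \<le> (pi\<^sup>2 / 6 - 1) / 4"
  proof (rule norm_sums_le[OF t sums_divide[OF q]])
    fix n
    let ?m = "real (Suc (Suc n))"
    have "norm (?p (Suc (Suc n))) = ?m powr (- Re s)" by (simp only: norm_nat_powr) simp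
    also have "\<dots> \<le> ?m powr (- 4)" using assms by (intro powr_mono) auto
    also have "\<dots> = 1 / (?m\<^sup>2 * ?m\<^sup>2)" by (simp add: powr_minus_divide power4_eq_xxxx power2_eq_square mult.assoc)
    also have "\<dots> \<le> 1 / (?m\<^sup>2 * 2\<^sup>2)"
      by (intro divide_left_mono mult_left_mono power_mono) auto
    finally show "norm (?p (Suc (Suc n))) \<le> 1 / ?m\<^sup>2 / 4" by simp
  qed
  moreover have "pi\<^sup>2 < 4\<^sup>2" using pi_less_4 by (intro power_strict_mono) auto
  ultimately show False by simp
qed

text \<open>A zero would make \<open>zet_341\<close> vanish there and, by monotonicity, also further
  to the right, where zeta has no zeros.\<close>

lemma zet_nonzero:
  assumes "Re s > 1"
  shows "zet s \<noteq> 0"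
proof
  assume z: "zet s = 0"
  have "zet_341 (Im s) (of_real (Re s)) = 0"
    using z by (simp add: zet_341_def complex_eq[symmetric])
  then have "zet_341 (Im s) (of_real (max 4 (Re s))) = 0"
    using norm_zet_341_antimono[of "Re s" "max 4 (Re s)" "Im s"] assms by simp
  then show False by (simp add: zet_341_def zet_nonzero_large)
qed

text \<open>A zero at \<open>1 + \<i> t\<close> enters with multiplicity four against the triple
  pole at 1, and the factor at \<open>1 + 2 \<i> t\<close> stays bounded, so \<open>zet_341\<close>
  would tend to 0 at 1 from the right. By monotonicity its modulus stays above its nonzero value at
  4.\<close>

lemma Zet_nonzero:
  assumes "Re s \<ge> 1"
  shows "Zet s \<noteq> 0"
proof (cases "Re s > 1")
  case True
  then show ?thesis using zet_nonzero[OF True] by (auto simp: Zet_eq)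
next
  case False
  define t where "t = Im s"
  have s: "s = 1 + \<i> * t" using False assms by (simp add: t_def complex_eq_iff)
  show ?thesis
  proof (cases "t = 0")
    case True
    then show ?thesis by (simp add: s Zet_1)
  next
    case t: False
    show ?thesis
    proof
      assume Z0: "Zet s = 0"
      have cont: "((\<lambda>x. Zet (of_real x + \<i> * of_real c)) \<longlongrightarrow> Zet (1 + \<i> * of_real c)) (at_right 1)" for c
      proof -
        have "isCont Zet (1 + \<i> * of_real c)"
          using Zet_sums_and_differentiable[of "1 + \<i> * of_real c"] by (intro field_differentiable_imp_continuous_at) simp
        moreover have "((\<lambda>x. of_real x + \<i> * of_real c) \<longlongrightarrow> 1 + \<i> * of_real c) (at_right 1)"
          by (auto intro!: tendsto_eq_intros)
        ultimately show ?thesis by (rule isCont_tendsto_compose)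
      qed
      obtain D where D: "(Zet has_field_derivative D) (at s)"
        using Zet_sums_and_differentiable[of s] s by (auto simp: field_differentiable_def)
      have "((\<lambda>z. (Zet z - Zet s) / (z - s)) \<longlongrightarrow> D) (at s)"
        using D by (simp add: has_field_derivative_iff)
      moreover have "filterlim (\<lambda>x. of_real x + \<i> * of_real t) (at s) (at_right 1)"
        unfolding filterlim_at by (auto simp: s eventually_at_filter intro!: tendsto_eq_intros)
      ultimately have "((\<lambda>x. (Zet (of_real x + \<i> * of_real t) - Zet s) / (of_real x + \<i> * of_real t - s)) \<longlongrightarrow> D) (at_right 1)"
        by (rule filterlim_compose)
      then have L: "((\<lambda>x. Zet (of_real x + \<i> * of_real t) / (of_real x - 1)) \<longlongrightarrow> D) (at_right 1)"
        using Z0 unfolding s by simp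
      have c0: "((\<lambda>x. Zet (of_real x)) \<longlongrightarrow> 1) (at_right 1)" using cont[of 0] by (simp add: Zet_1)
      have "((\<lambda>x. Zet (of_real x) ^ 3 * (of_real x - 1) * (Zet (of_real x + \<i> * of_real t) / (of_real x - 1)) ^ 4
          / (of_real x - 1 + \<i> * of_real t) ^ 4 * (Zet (of_real x + \<i> * of_real (2 * t)) / (of_real x - 1 + \<i> * of_real (2 * t))))
         \<longlongrightarrow> 1 ^ 3 * (of_real 1 - 1) * D ^ 4 / (of_real 1 - 1 + \<i> * of_real t) ^ 4 * (Zet (1 + \<i> * of_real (2 * t)) / (of_real 1 - 1 + \<i> * of_real (2 * t)))) (at_right 1)"
        by (intro tendsto_mult tendsto_divide tendsto_power tendsto_diff tendsto_add tendsto_const c0 L cont tendsto_of_real tendsto_ident_at)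
           (use t in auto)
      moreover have "\<forall>\<^sub>F x in at_right 1. Zet (of_real x) ^ 3 * (of_real x - 1) * (Zet (of_real x + \<i> * of_real t) / (of_real x - 1)) ^ 4
          / (of_real x - 1 + \<i> * of_real t) ^ 4 * (Zet (of_real x + \<i> * of_real (2 * t)) / (of_real x - 1 + \<i> * of_real (2 * t))) = zet_341 t (of_real x)"
        unfolding eventually_at_filter
      proof (intro always_eventually allI impI)
        fix x :: real assume "x \<in> {1<..}"
        then have x: "x > 1" by simp
        have ne: "of_real x - 1 + \<i> * of_real c \<noteq> 0" for c using x by (auto simp: complex_eq_iff)
        have Z: "Zet (of_real x + \<i> * of_real c) = (of_real x - 1 + \<i> * of_real c) * zet (of_real x + \<i> * of_real c)" for c
          using x by (subst Zet_eq) (auto simp: algebra_simps)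
        have gen: "(a * z1) ^ 3 * a * (b * z2 / a) ^ 4 / b ^ 4 * (c * z3 / c) = z1 ^ 3 * z2 ^ 4 * z3"
          if "a \<noteq> 0" "b \<noteq> 0" "c \<noteq> 0" for a b c z1 z2 z3 :: complex
        proof -
          have "(b * z2 / a) ^ 4 / b ^ 4 = z2 ^ 4 / (a ^ 3 * a)"
            using that by (simp add: power_divide power_mult_distrib power3_eq_cube power4_eq_xxxx mult.assoc)
          then have "(a * z1) ^ 3 * a * (b * z2 / a) ^ 4 / b ^ 4 = (a ^ 3 * z1 ^ 3 * a) * (z2 ^ 4 / (a ^ 3 * a))"
            by (simp only: times_divide_eq_right[symmetric] power_mult_distrib)
          then show ?thesis using that by simp
        qed
        show "Zet (of_real x) ^ 3 * (of_real x - 1) * (Zet (of_real x + \<i> * of_real t) / (of_real x - 1)) ^ 4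
          / (of_real x - 1 + \<i> * of_real t) ^ 4 * (Zet (of_real x + \<i> * of_real (2 * t)) / (of_real x - 1 + \<i> * of_real (2 * t))) = zet_341 t (of_real x)"
          using gen[OF ne[of 0] ne[of t] ne[of "2 * t"]] Z[of 0] Z[of t] Z[of "2 * t"] by (simp add: zet_341_def)
      qed
      ultimately have "((\<lambda>x. zet_341 t (of_real x)) \<longlongrightarrow> 0) (at_right 1)"
        by (auto dest: Lim_transform_eventually)
      then have lim: "((\<lambda>x. norm (zet_341 t (of_real x))) \<longlongrightarrow> 0) (at_right 1)"
        by (rule tendsto_norm_zero)
      have "norm (zet_341 t (of_real 4)) \<le> 0"
      proof (rule tendsto_lowerbound[OF lim])
        show "\<forall>\<^sub>F x in at_right 1. norm (zet_341 t (of_real 4)) \<le> norm (zet_341 t (of_real x))"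
          unfolding eventually_at_right_field using norm_zet_341_antimono[where b = 4 and t = t] by (intro exI[of _ 4]) auto
      qed simp
      then show False by (simp add: zet_341_def zet_nonzero_large)
    qed
  qed
qed

text \<open>The continuation of \<open>-\<zeta>'/\<zeta> - \<zeta>\<close> across the line \<open>Re s = 1\<close>.\<close>

definition Wet :: "complex \<Rightarrow> complex" where
  "Wet s = - deriv Zet s / Zet s - (if s = 1 then deriv Zet 1 else (Zet s - Zet 1) / (s - 1))"

lemma Wet_holomorphic: "Wet holomorphic_on {s. Re s > 0 \<and> Zet s \<noteq> 0}" and
  open_Zet_nonzero: "open {s. Re s > 0 \<and> Zet s \<noteq> 0}"
proof -
  let ?R = "{s. Re s > 0}"
  have op: "open ?R" by (rule open_halfspace_Re_gt)
  have hol: "Zet holomorphic_on ?R"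
    using Zet_sums_and_differentiable op by (auto simp: holomorphic_on_open field_differentiable_def)
  have "open (?R \<inter> Zet -` (- {0}))"
    by (rule continuous_open_preimage[OF holomorphic_on_imp_continuous_on[OF hol] op]) auto
  moreover have "?R \<inter> Zet -` (- {0}) = {s. Re s > 0 \<and> Zet s \<noteq> 0}" by auto
  ultimately show op2: "open {s. Re s > 0 \<and> Zet s \<noteq> 0}" by simp
  have "(\<lambda>s. if s = 1 then deriv Zet 1 else (Zet s - Zet 1) / (s - 1)) holomorphic_on ?R"
    by (rule pole_lemma_open[OF hol op])
  then have 1: "(\<lambda>s. if s = 1 then deriv Zet 1 else (Zet s - Zet 1) / (s - 1)) holomorphic_on {s. Re s > 0 \<and> Zet s \<noteq> 0}"
    by (rule holomorphic_on_subset) auto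
  have 2: "deriv Zet holomorphic_on {s. Re s > 0 \<and> Zet s \<noteq> 0}" "Zet holomorphic_on {s. Re s > 0 \<and> Zet s \<noteq> 0}"
    using holomorphic_deriv[OF hol op] hol by (auto intro: holomorphic_on_subset)
  show "Wet holomorphic_on {s. Re s > 0 \<and> Zet s \<noteq> 0}"
    unfolding Wet_def by (intro holomorphic_on_diff holomorphic_on_divide holomorphic_on_minus 1 2) auto
qed

lemma Wet_eq:
  assumes "Re s > 1"
  shows "Wet s = mangoldt_series s - zet s"
proof -
  have "((\<lambda>s. (s - 1) * zet s) has_field_derivative ((s - 1) * (- mangoldt_series s * zet s) + 1 * zet s)) (at s)"
    using has_field_derivative_zet'[OF assms] by (auto intro!: derivative_eq_intros)
  then have "(Zet has_field_derivative ((s - 1) * (- mangoldt_series s * zet s) + 1 * zet s)) (at s)"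
    by (rule has_field_derivative_transform_within_open[OF _ open_halfspace_Re_gt[of 1]])
       (use assms in \<open>auto simp: Zet_eq\<close>)
  then have d: "deriv Zet s = zet s - (s - 1) * (mangoldt_series s * zet s)"
    by (auto dest: DERIV_imp_deriv)
  have "s \<noteq> 1" "zet s \<noteq> 0" using assms zet_nonzero by auto
  moreover have "- (z - w * (F * z)) / (w * z) - (w * z - 1) / w = F - z" if "w \<noteq> 0" "z \<noteq> 0" for w z F :: complex
    using that by (simp add: field_simps)
  ultimately show ?thesis
    using assms by (simp add: Wet_def d Zet_eq Zet_1)
qed

text \<open>The compact rectangle includes its edge on \<open>Re s = 1\<close>, by non-vanishing
  there; so the bound is uniform as \<epsilon> tends to 0.\<close>

lemma Wet_bounded:
  fixes l :: real
  shows "\<exists>M\<ge>0. \<forall>\<epsilon> t. 0 \<le> \<epsilon> \<longrightarrow> \<epsilon> \<le> 1 \<longrightarrow> 0 \<le> t \<longrightarrow> t \<le> l \<longrightarrow>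
    norm (Wet (Complex (1 + \<epsilon>) t)) \<le> M \<and> norm (deriv Wet (Complex (1 + \<epsilon>) t)) \<le> M"
proof -
  let ?U = "{s. Re s > 0 \<and> Zet s \<noteq> 0}" and ?K = "cbox (Complex 1 0) (Complex 2 l)"
  have K: "?K \<subseteq> ?U" using Zet_nonzero by (auto simp: in_cbox_complex_iff)
  have "deriv Wet holomorphic_on ?U" by (rule holomorphic_deriv[OF Wet_holomorphic open_Zet_nonzero])
  then have "continuous_on ?K Wet" "continuous_on ?K (deriv Wet)"
    using Wet_holomorphic K holomorphic_on_imp_continuous_on continuous_on_subset by blast+
  then have "compact (Wet ` ?K)" "compact (deriv Wet ` ?K)"
    by (auto intro: compact_continuous_image compact_cbox)
  from this[THEN compact_imp_bounded]
  obtain A B where "\<forall>x\<in>Wet ` ?K. norm x \<le> A" "\<forall>x\<in>deriv Wet ` ?K. norm x \<le> B"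
    unfolding bounded_iff by blast
  then have "\<forall>z\<in>?K. norm (Wet z) \<le> max 0 (max A B) \<and> norm (deriv Wet z) \<le> max 0 (max A B)"
    by (fastforce simp: le_max_iff_disj)
  moreover have "Complex (1 + \<epsilon>) t \<in> ?K" if "0 \<le> \<epsilon>" "\<epsilon> \<le> 1" "0 \<le> t" "t \<le> l" for \<epsilon> t
    using that by (simp add: in_cbox_complex_iff)
  ultimately show ?thesis by (intro exI[of _ "max 0 (max A B)"]) simp
qed

text \<open>One integration by parts; this is the Riemann-Lebesgue lemma with the explicit rate
  1/y.\<close>

lemma norm_oscillating_integral_le:
  fixes \<phi> :: "real \<Rightarrow> complex"
  assumes d: "\<And>t. t \<in> {0..l} \<Longrightarrow> (\<phi> has_vector_derivative \<phi>' t) (at t within {0..l})"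
    and c: "continuous_on {0..l} \<phi>'" and A: "\<And>t. t \<in> {0..l} \<Longrightarrow> norm (\<phi> t) \<le> A"
    and B: "\<And>t. t \<in> {0..l} \<Longrightarrow> norm (\<phi>' t) \<le> B" and y: "y > 0" and l: "l \<ge> 0"
  shows "norm (integral {0..l} (\<lambda>t. \<phi> t * exp (\<i> * of_real (t * y)))) \<le> (2 * A + l * B) / y"
proof -
  let ?e = "\<lambda>t. exp (\<i> * of_real (t * y))"
  let ?P = "\<lambda>t. \<phi> t * ?e t / (\<i> * y)"
  have e: "(?e has_vector_derivative (\<i> * y * ?e t)) (at t within {0..l})" for t
  proof -
    have "((\<lambda>z. exp (\<i> * (z * of_real y))) has_field_derivative (\<i> * of_real y * exp (\<i> * (of_real t * of_real y)))) (at (of_real t))"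
      by (rule derivative_eq_intros refl)+ (simp add: mult_ac)
    from has_vector_derivative_real_field[OF this] show ?thesis by simp
  qed
  have ce: "continuous_on {0..l} ?e" by (intro continuous_intros)
  have c\<phi>: "continuous_on {0..l} \<phi>"
    unfolding continuous_on_eq_continuous_within by (blast intro: has_vector_derivative_continuous[OF d])
  have P: "(?P has_vector_derivative (\<phi> t * ?e t + \<phi>' t * ?e t / (\<i> * y))) (at t within {0..l})" if "t \<in> {0..l}" for t
  proof -
    have "((\<lambda>t. \<phi> t * ?e t) has_vector_derivative (\<phi> t * (\<i> * y * ?e t) + \<phi>' t * ?e t)) (at t within {0..l})"
      by (rule has_vector_derivative_mult[OF d[OF that] e])
    then have "((\<lambda>t. \<phi> t * ?e t * (1 / (\<i> * y))) has_vector_derivative ((\<phi> t * (\<i> * y * ?e t) + \<phi>' t * ?e t) * (1 / (\<i> * y)))) (at t within {0..l})"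
      by (rule has_vector_derivative_mult_left)
    moreover have "(\<phi> t * (\<i> * y * ?e t) + \<phi>' t * ?e t) * (1 / (\<i> * y)) = \<phi> t * ?e t + \<phi>' t * ?e t / (\<i> * y)"
      using y by (simp add: field_simps)
    ultimately show ?thesis by simp
  qed
  have E: "((\<lambda>t. \<phi> t * ?e t + \<phi>' t * ?e t / (\<i> * y)) has_integral (?P l - ?P 0)) {0..l}"
    by (rule fundamental_theorem_of_calculus[OF l P])
  have i1: "(\<lambda>t. \<phi> t * ?e t) integrable_on {0..l}"
    by (intro integrable_continuous_real continuous_on_mult c\<phi> ce)
  have i2: "(\<lambda>t. \<phi>' t * ?e t / (\<i> * y)) integrable_on {0..l}"
    by (intro integrable_continuous_real continuous_on_divide continuous_on_mult c ce continuous_on_const) (use y in auto)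
  have eq: "integral {0..l} (\<lambda>t. \<phi> t * ?e t) = ?P l - ?P 0 - integral {0..l} (\<lambda>t. \<phi>' t * ?e t / (\<i> * y))"
    using integral_add[OF i1 i2] integral_unique[OF E] by (simp only: eq_diff_eq)
  have ne: "norm (?e t) = 1" for t by (simp add: norm_exp_eq_Re)
  have nP: "norm (?P t) \<le> A / y" if "t \<in> {0..l}" for t
    using A[OF that] ne[of t] y by (simp add: norm_mult norm_divide divide_right_mono)
  have PP: "norm (?P l) \<le> A / y" "norm (?P 0) \<le> A / y" by (rule nP, simp add: l)+
  have "norm (integral {0..l} (\<lambda>t. \<phi>' t * ?e t / (\<i> * y))) \<le> integral {0..l} (\<lambda>t. B / y)"
  proof (rule integral_norm_bound_integral[OF i2])
    fix t assume "t \<in> {0..l}"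
    then show "norm (\<phi>' t * ?e t / (\<i> * y)) \<le> B / y"
      using B[of t] ne[of t] y by (simp add: norm_mult norm_divide divide_right_mono)
  qed auto
  also have "\<dots> = l * B / y" using l by simp
  finally have I: "norm (integral {0..l} (\<lambda>t. \<phi>' t * ?e t / (\<i> * y))) \<le> l * B / y" .
  have "norm (integral {0..l} (\<lambda>t. \<phi> t * ?e t)) \<le> A / y + A / y + l * B / y"
    unfolding eq by (intro order_trans[OF norm_triangle_ineq4] add_mono PP I)
  then show ?thesis by (simp add: add_divide_distrib)
qed

text \<open>The Fourier transform of the tent \<open>1 - |t| / l\<close> on \<open>[-l, l]\<close>:
  a nonnegative kernel of height l and width about 1/l.\<close>

definition fejer :: "real \<Rightarrow> real \<Rightarrow> real" where
  "fejer l u = (if u = 0 then l else 2 * (1 - cos (l * u)) / (l * u\<^sup>2))"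

lemma has_integral_fejer:
  assumes l: "l > 0"
  shows "((\<lambda>t. 2 * (1 - t / l) * cos (t * u)) has_integral fejer l u) {0..l}"
proof (cases "u = 0")
  case True
  have "((\<lambda>t. 2 * (1 - t / l)) has_integral ((\<lambda>t. 2 * t - t\<^sup>2 * (1 / l)) l - (\<lambda>t. 2 * t - t\<^sup>2 * (1 / l)) 0)) {0..l}"
  proof (rule fundamental_theorem_of_calculus)
    fix t assume "t \<in> {0..l}"
    have "((\<lambda>t. 2 * t - t\<^sup>2 * (1 / l)) has_real_derivative 2 * (1 - t / l)) (at t within {0..l})"
      by (rule derivative_eq_intros refl)+ (use l in \<open>auto simp: field_simps\<close>)
    then show "((\<lambda>t. 2 * t - t\<^sup>2 * (1 / l)) has_vector_derivative 2 * (1 - t / l)) (at t within {0..l})"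
      by (simp add: has_real_derivative_iff_has_vector_derivative)
  qed (use l in auto)
  then show ?thesis using True l by (simp add: fejer_def power2_eq_square)
next
  case False
  define a b where "a = 1 / l" and "b = 1 / u"
  have ub: "u * b = 1" using False by (simp add: b_def)
  let ?F = "\<lambda>t. 2 * (1 - t * a) * sin (t * u) * b - 2 * a * cos (t * u) * (b * b)"
  have "((\<lambda>t. 2 * (1 - t * a) * cos (t * u)) has_integral (?F l - ?F 0)) {0..l}"
  proof (rule fundamental_theorem_of_calculus)
    fix t assume "t \<in> {0..l}"
    have "(?F has_real_derivative (- 2 * a * sin (t * u) * b + 2 * (1 - t * a) * cos (t * u) * (u * b) + 2 * a * sin (t * u) * b * (u * b))) (at t within {0..l})"
      by (rule derivative_eq_intros refl)+ (simp add: algebra_simps)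
    then show "(?F has_vector_derivative 2 * (1 - t * a) * cos (t * u)) (at t within {0..l})"
      by (simp add: has_real_derivative_iff_has_vector_derivative ub)
  qed (use l in auto)
  moreover have "?F l - ?F 0 = fejer l u" using l False by (simp add: fejer_def a_def b_def field_simps power2_eq_square)
  ultimately show ?thesis by (simp add: a_def)
qed

text \<open>The kernel is written as an integral over frequencies t and the sum is moved inside,
  which the M-test allows for \<epsilon> > 0. The inner sum is \<open>mangoldt_series - zet\<close>,
  that is \<open>Wet\<close>, on the line \<open>Re s = 1 + \<epsilon>\<close>.\<close>

lemma fejer_series:
  assumes l: "l > 0" and e: "\<epsilon> > 0"
  shows "(\<lambda>n. (mangoldt n - 1) * real n powr (-(1 + \<epsilon>)) * fejer l (y - ln (real n))) sums
    Re (integral {0..l} (\<lambda>t. of_real (2 * (1 - t / l)) * Wet (Complex (1 + \<epsilon>) t) * exp (\<i> * of_real (t * y))))"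
proof -
  let ?a = "\<lambda>n. (mangoldt n - 1) * real n powr (-(1 + \<epsilon>))"
  let ?f = "\<lambda>n t. ?a n * (2 * (1 - t / l) * cos (t * (y - ln (real n))))"
  let ?M = "\<lambda>n. 2 * (mangoldt n * real n powr (-(1 + \<epsilon>)) + real n powr (-(1 + \<epsilon>)))"
  let ?g = "\<lambda>t. of_real (2 * (1 - t / l)) * Wet (Complex (1 + \<epsilon>) t) * exp (\<i> * of_real (t * y))"
  have "norm (?f n t) \<le> ?M n" if t: "t \<in> {0..l}" for n t
  proof -
    have "norm (?f n t) = \<bar>?a n\<bar> * (2 * \<bar>1 - t / l\<bar> * \<bar>cos (t * (y - ln (real n)))\<bar>)"
      by (simp only: abs_mult real_norm_def abs_numeral)
    also have "\<dots> \<le> (mangoldt n * real n powr (-(1 + \<epsilon>)) + real n powr (-(1 + \<epsilon>))) * (2 * 1 * 1)"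
    proof (intro mult_mono)
      have "\<bar>?a n\<bar> = \<bar>mangoldt n - 1\<bar> * real n powr (-(1 + \<epsilon>))" by (simp add: abs_mult)
      also have "\<dots> \<le> (mangoldt n + 1) * real n powr (-(1 + \<epsilon>))"
        using mangoldt_nonneg[of n] by (intro mult_right_mono) (auto simp: abs_if)
      finally show "\<bar>?a n\<bar> \<le> mangoldt n * real n powr (-(1 + \<epsilon>)) + real n powr (-(1 + \<epsilon>))"
        by (simp add: algebra_simps)
      show "\<bar>1 - t / l\<bar> \<le> 1" using t l by (auto simp: abs_if)
    qed (auto simp: mangoldt_nonneg)
    finally show ?thesis by simp
  qed
  moreover have "summable ?M"
    using e by (intro summable_mult summable_add summable_mangoldt_powr) (auto simp: summable_real_powr_iff)
  ultimately have u: "uniform_limit {0..l} (\<lambda>N t. \<Sum>n<N. ?f n t) (\<lambda>t. \<Sum>n. ?f n t) sequentially"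
    by (intro Weierstrass_m_test) auto
  have g: "(\<Sum>n. ?f n t) = Re (?g t)" for t
  proof -
    let ?s = "of_real (1 + \<epsilon>) + \<i> * of_real t"
    have s: "Complex (1 + \<epsilon>) t = ?s" by (simp add: complex_eq_iff)
    have term_eq: "Re (of_real (2 * (1 - t / l)) * exp (\<i> * of_real (t * y)) * (mangoldt n * of_nat n powr (-?s) - of_nat n powr (-?s))) = ?f n t" for n
    proof (cases "n = 0")
      case False
      then have "(of_nat n :: complex) powr (-?s) = of_real (real n powr (-(1 + \<epsilon>))) * exp (\<i> * of_real (- t * ln (real n)))"
        by (simp add: powr_def Ln_of_nat exp_of_real[symmetric] exp_add[symmetric] algebra_simps)
      moreover have "exp (\<i> * of_real (t * y)) * exp (\<i> * of_real (- t * ln (real n))) = exp (\<i> * of_real (t * (y - ln (real n))))"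
        by (simp add: exp_add[symmetric] algebra_simps)
      ultimately have "of_real (2 * (1 - t / l)) * exp (\<i> * of_real (t * y)) * (mangoldt n * of_nat n powr (-?s) - of_nat n powr (-?s))
         = of_real (?a n * (2 * (1 - t / l))) * exp (\<i> * of_real (t * (y - ln (real n))))"
        by (simp add: algebra_simps)
      moreover have "Re (of_real r * exp (\<i> * of_real x)) = r * cos x" for r x
        by (simp add: Re_exp)
      ultimately show ?thesis by (simp only: mult.assoc)
    qed simp
    have "(\<lambda>n. of_real (2 * (1 - t / l)) * exp (\<i> * of_real (t * y)) * (mangoldt n * of_nat n powr (-?s) - of_nat n powr (-?s)))
      sums (of_real (2 * (1 - t / l)) * exp (\<i> * of_real (t * y)) * (mangoldt_series ?s - zet ?s))"
      using e by (intro sums_mult sums_diff sums_mangoldt_series sums_zet) auto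
    from sums_Re[OF this] have "(\<lambda>n. ?f n t) sums Re (of_real (2 * (1 - t / l)) * exp (\<i> * of_real (t * y)) * (mangoldt_series ?s - zet ?s))"
      unfolding term_eq .
    moreover have "of_real (2 * (1 - t / l)) * exp (\<i> * of_real (t * y)) * (mangoldt_series ?s - zet ?s) = ?g t"
      unfolding s using e by (subst Wet_eq) (simp_all add: mult_ac)
    ultimately show ?thesis by (simp only: sums_iff)
  qed
  obtain I J where IJ: "\<And>N. ((\<lambda>t. \<Sum>n<N. ?f n t) has_integral I N) {0..l}"
    "((\<lambda>t. \<Sum>n. ?f n t) has_integral J) {0..l}" "I \<longlonglongrightarrow> J"
    by (rule uniform_limit_integral[OF u]) (use l in \<open>auto intro!: continuous_intros\<close>)
  have eqI: "I N = (\<Sum>n<N. ?a n * fejer l (y - ln (real n)))" for N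
    by (rule has_integral_unique[OF IJ(1)], rule has_integral_sum, simp,
        rule has_integral_mult_right, rule has_integral_fejer[OF l])
  have "(\<lambda>n. ?a n * fejer l (y - ln (real n))) sums J"
    using IJ(3) unfolding sums_def eqI[abs_def] .
  moreover have "J = Re (integral {0..l} ?g)"
  proof -
    have "continuous_on {0..l} (\<lambda>t. Wet (Complex (1 + \<epsilon>) t))"
    proof (rule continuous_on_compose2[OF holomorphic_on_imp_continuous_on[OF Wet_holomorphic]])
      show "continuous_on {0..l} (\<lambda>t. Complex (1 + \<epsilon>) t)"
        unfolding Complex_eq by (intro continuous_intros)
      show "(\<lambda>t. Complex (1 + \<epsilon>) t) ` {0..l} \<subseteq> {s. 0 < Re s \<and> Zet s \<noteq> 0}"
        using e Zet_nonzero by auto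
    qed
    then have "?g integrable_on {0..l}"
      using l by (intro integrable_continuous_real continuous_intros) auto
    then have "(?g has_integral integral {0..l} ?g) {0..l}" by (rule integrable_integral)
    then have "((\<lambda>t. Re (?g t)) has_integral Re (integral {0..l} ?g)) {0..l}"
      using has_integral_linear[OF _ bounded_linear_Re] unfolding o_def by blast
    then show ?thesis using IJ(2) unfolding g by (rule has_integral_unique[rotated])
  qed
  ultimately show ?thesis by simp
qed

lemma fejer_nonneg: "l > 0 \<Longrightarrow> 0 \<le> fejer l u"
  by (simp add: fejer_def)

lemma fejer_le: "l > 0 \<Longrightarrow> fejer l u \<le> l"
proof -
  assume l: "l > 0"
  have "1 - cos x \<le> x\<^sup>2 / 2" for x :: real
  proof -
    have "1 - cos x = 2 * (sin (x / 2))\<^sup>2" using cos_double_sin[of "x / 2"] by simp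
    also have "(sin (x / 2))\<^sup>2 \<le> (x / 2)\<^sup>2" using abs_sin_x_le_abs_x[of "x / 2"] by (simp only: abs_le_square_iff)
    finally show ?thesis by (simp add: power_divide)
  qed
  from this[of "l * u"] have "2 * (1 - cos (l * u)) \<le> l * (l * u\<^sup>2)"
    by (simp add: power2_eq_square algebra_simps)
  then show ?thesis using l by (simp add: fejer_def pos_divide_le_eq)
qed

lemma fejer_le_inverse_square: "l > 0 \<Longrightarrow> u \<noteq> 0 \<Longrightarrow> fejer l u \<le> 4 / (l * u\<^sup>2)"
proof -
  assume "l > 0" "u \<noteq> 0"
  moreover have "2 * (1 - cos (l * u)) \<le> 2 * 2"
    using cos_ge_minus_one[of "l * u"] by (intro mult_left_mono) linarith+
  ultimately show ?thesis by (simp add: fejer_def divide_right_mono)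
qed

lemma fejer_ge:
  assumes l: "l > 0" and u: "\<bar>l * u\<bar> \<le> 1"
  shows "l / 2 \<le> fejer l u"
proof -
  have "x\<^sup>2 / 4 \<le> 1 - cos x" if "\<bar>x\<bar> \<le> 1" for x :: real
  proof -
    obtain t where "cos x = (\<Sum>m<4. cos_coeff m * x ^ m) + (cos (t + 1 / 2 * real 4 * pi) / fact 4) * x ^ 4"
      using Maclaurin_cos_expansion[of x 4] by auto
    moreover have "(\<Sum>m<4. cos_coeff m * x ^ m) = 1 - x\<^sup>2 / 2"
    proof -
      have "{..<4} = {0, 1, 2, 3 :: nat}" by auto
      moreover have "cos_coeff 0 = 1" "cos_coeff 1 = 0" "cos_coeff 2 = - 1 / 2" "cos_coeff 3 = 0"
        by (simp_all add: cos_coeff_def)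
      ultimately show ?thesis by simp
    qed
    moreover have "cos (t + 1 / 2 * real 4 * pi) / fact 4 * x ^ 4 \<le> 1 / fact 4 * x ^ 4"
      by (intro mult_right_mono divide_right_mono) auto
    moreover have "fact 4 = (24 :: real)" by (simp add: fact_numeral)
    ultimately have "cos x \<le> 1 - x\<^sup>2 / 2 + x ^ 4 / 24" by simp
    moreover have "x ^ 4 \<le> x\<^sup>2"
      using power_decreasing[of 2 4 "\<bar>x\<bar>"] that by simp
    moreover have "0 \<le> x\<^sup>2" by simp
    ultimately show ?thesis by linarith
  qed
  from this[OF u] have "l / 2 * (l * u\<^sup>2) \<le> 2 * (1 - cos (l * u))"
    by (simp add: power2_eq_square algebra_simps)
  then show ?thesis using l by (simp add: fejer_def pos_le_divide_eq)
qed

lemma fejer_one_le: "fejer 1 u \<le> 8 / (1 + u\<^sup>2)"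
proof (cases "u\<^sup>2 \<le> 1")
  case True
  have "fejer 1 u \<le> 1" using fejer_le[of 1 u] by simp
  also have "1 \<le> 8 / (1 + u\<^sup>2)" using True by (simp add: field_simps add_pos_nonneg)
  finally show ?thesis .
next
  case False
  then have "u \<noteq> 0" "u\<^sup>2 > 0" by auto
  then have "fejer 1 u \<le> 4 / u\<^sup>2" using fejer_le_inverse_square[of 1 u] by simp
  also have "\<dots> \<le> 8 / (1 + u\<^sup>2)"
  proof -
    have "4 / w \<le> 8 / (1 + w)" if "w > 1" for w :: real
      using that by (simp add: field_simps)
    then show ?thesis using False by simp
  qed
  finally show ?thesis .
qed

text \<open>The zeros of the two shifted kernels are disjoint.\<close>

lemma inverse_square_le_fejer:
  assumes d: "d > 0" "d \<le> \<bar>u\<bar>"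
  shows "4 / u\<^sup>2 \<le> (1 + pi / d)\<^sup>2 * (fejer 1 u + fejer 1 (u + pi))"
proof -
  define A where "A = (1 + pi / d)\<^sup>2"
  have u0: "u \<noteq> 0" using d by auto
  have A1: "A \<ge> 1" unfolding A_def using d pi_gt_zero by (intro one_le_power) simp
  have f1: "fejer 1 u = 2 * (1 - cos u) / u\<^sup>2" using u0 by (simp add: fejer_def)
  have sq: "(u + pi)\<^sup>2 \<le> A * u\<^sup>2"
  proof -
    have "\<bar>u + pi\<bar> \<le> \<bar>u\<bar> + pi / d * d" using d abs_triangle_ineq[of u pi] by simp
    also have "\<dots> \<le> \<bar>u\<bar> + pi / d * \<bar>u\<bar>" using d pi_gt_zero by (intro add_left_mono mult_left_mono) auto
    also have "\<dots> = \<bar>1 + pi / d\<bar> * \<bar>u\<bar>" using d pi_gt_zero by (simp add: algebra_simps)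
    also have "\<dots> = \<bar>(1 + pi / d) * u\<bar>" by (simp only: abs_mult)
    finally show ?thesis unfolding A_def power_mult_distrib[symmetric] abs_le_square_iff .
  qed
  have f2: "2 * (1 + cos u) / u\<^sup>2 \<le> A * fejer 1 (u + pi)"
  proof (cases "u + pi = 0")
    case True
    then have "u = - pi" by simp
    then show ?thesis using A1 by (simp add: fejer_def)
  next
    case False
    have "2 * (1 + cos u) / u\<^sup>2 = A * (2 * (1 + cos u) / (A * u\<^sup>2))" using A1 by simp
    also have "\<dots> \<le> A * (2 * (1 + cos u) / (u + pi)\<^sup>2)"
    proof (intro mult_left_mono divide_left_mono)
      have "0 \<le> 1 + cos u" using cos_ge_minus_one[of u] by linarith
      then show "0 \<le> 2 * (1 + cos u)" by (rule mult_nonneg_nonneg[rotated]) simp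
    qed (use sq A1 u0 False in auto)
    also have "2 * (1 + cos u) / (u + pi)\<^sup>2 = fejer 1 (u + pi)" using False by (simp add: fejer_def)
    finally show ?thesis .
  qed
  \<comment> \<open>The shift by \<pi> changes the sign of the cosine, so the numerators
    \<open>2 (1 - cos u)\<close> and \<open>2 (1 + cos u)\<close> add up to 4.\<close>
  have "4 / u\<^sup>2 = fejer 1 u + 2 * (1 + cos u) / u\<^sup>2" unfolding f1 by (simp add: add_divide_distrib[symmetric] algebra_simps)
  also have "\<dots> \<le> A * fejer 1 u + A * fejer 1 (u + pi)"
    using f2 A1 fejer_nonneg[of 1 u] mult_right_mono[of 1 A "fejer 1 u"] by simp
  finally show ?thesis by (simp add: A_def algebra_simps)
qed

text \<open>The tent times \<open>Wet\<close> and its derivative in t are bounded uniformly in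
  \<epsilon>, so the oscillating integral is at most \<open>C / y\<close> with C independent of
  \<epsilon>. This is what later permits \<epsilon> = 1/y.\<close>

lemma fejer_error:
  fixes l :: real
  assumes l: "l > 0"
  shows "\<exists>C\<ge>0. \<forall>\<epsilon> y. 0 < \<epsilon> \<longrightarrow> \<epsilon> \<le> 1 \<longrightarrow> y > 0 \<longrightarrow>
    (\<exists>J. (\<lambda>n. (mangoldt n - 1) * real n powr (-(1 + \<epsilon>)) * fejer l (y - ln (real n))) sums J \<and> \<bar>J\<bar> \<le> C / y)"
proof -
  obtain M where M: "M \<ge> 0" "\<And>\<epsilon> t. 0 \<le> \<epsilon> \<Longrightarrow> \<epsilon> \<le> 1 \<Longrightarrow> 0 \<le> t \<Longrightarrow> t \<le> l \<Longrightarrow>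
    norm (Wet (Complex (1 + \<epsilon>) t)) \<le> M \<and> norm (deriv Wet (Complex (1 + \<epsilon>) t)) \<le> M"
    using Wet_bounded[of l] by blast
  define C where "C = 2 * (2 * M) + l * (2 / l * M + 2 * M)"
  have "\<exists>J. (\<lambda>n. (mangoldt n - 1) * real n powr (-(1 + \<epsilon>)) * fejer l (y - ln (real n))) sums J \<and> \<bar>J\<bar> \<le> C / y"
    if e: "0 < \<epsilon>" "\<epsilon> \<le> 1" and y: "y > 0" for \<epsilon> y
  proof (intro exI conjI)
    let ?w = "\<lambda>t. Wet (Complex (1 + \<epsilon>) t)" and ?w' = "\<lambda>t. \<i> * deriv Wet (Complex (1 + \<epsilon>) t)"
    let ?\<phi> = "\<lambda>t. of_real (2 * (1 - t / l)) * ?w t"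
    let ?\<phi>' = "\<lambda>t. of_real (2 * (1 - t / l)) * ?w' t + of_real (- 2 / l) * ?w t"
    show "(\<lambda>n. (mangoldt n - 1) * real n powr (-(1 + \<epsilon>)) * fejer l (y - ln (real n))) sums
      Re (integral {0..l} (\<lambda>t. ?\<phi> t * exp (\<i> * of_real (t * y))))"
      by (rule fejer_series[OF l e(1)])
    have cx: "Complex (1 + \<epsilon>) t = of_real (1 + \<epsilon>) + \<i> * of_real t" for t by (simp add: complex_eq_iff)
    let ?U = "{s. Re s > 0 \<and> Zet s \<noteq> 0}"
    have inU: "Complex (1 + \<epsilon>) t \<in> ?U" for t using e Zet_nonzero by auto
    have dw: "(?w has_vector_derivative ?w' t) (at t within {0..l})" for t
    proof -
      have "(Wet has_field_derivative deriv Wet (Complex (1 + \<epsilon>) t)) (at (Complex (1 + \<epsilon>) t))"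
        by (rule holomorphic_derivI[OF Wet_holomorphic open_Zet_nonzero inU])
      then have "((\<lambda>z. Wet (of_real (1 + \<epsilon>) + \<i> * z)) has_field_derivative deriv Wet (Complex (1 + \<epsilon>) t) * \<i>) (at (of_real t))"
        unfolding cx
      proof (rule DERIV_chain2)
        show "((\<lambda>z. of_real (1 + \<epsilon>) + \<i> * z) has_field_derivative \<i>) (at (of_real t))"
          by (rule DERIV_cong[OF DERIV_add[OF DERIV_const DERIV_cmult[OF DERIV_ident]]]) simp
      qed
      from has_vector_derivative_real_field[OF this] show ?thesis unfolding cx by (simp add: mult.commute)
    qed
    have "norm (integral {0..l} (\<lambda>t. ?\<phi> t * exp (\<i> * of_real (t * y)))) \<le> (2 * (2 * M) + l * (2 / l * M + 2 * M)) / y"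
    proof (rule norm_oscillating_integral_le)
      have c1: "continuous_on {0..l} (\<lambda>t. Complex (1 + \<epsilon>) t)" unfolding cx by (intro continuous_intros)
      have c2: "continuous_on {0..l} ?w"
        by (rule continuous_on_compose2[OF holomorphic_on_imp_continuous_on[OF Wet_holomorphic] c1]) (use inU in auto)
      have c3: "continuous_on {0..l} (\<lambda>t. deriv Wet (Complex (1 + \<epsilon>) t))"
        by (rule continuous_on_compose2[OF holomorphic_on_imp_continuous_on[OF holomorphic_deriv[OF Wet_holomorphic open_Zet_nonzero]] c1])
           (use inU in auto)
      show "continuous_on {0..l} ?\<phi>'" by (intro continuous_intros c2 c3) (use l in auto)
      fix t assume t: "t \<in> {0..l}"
      have d1: "((\<lambda>t. complex_of_real (2 * (1 - t / l))) has_vector_derivative of_real (- 2 / l)) (at t within {0..l})"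
      proof -
        have "((\<lambda>z. 2 * (1 - z / complex_of_real l)) has_field_derivative of_real (- 2 / l)) (at (of_real t))"
          by (rule DERIV_cong[OF DERIV_cmult[OF DERIV_diff[OF DERIV_const DERIV_cdivide[OF DERIV_ident]]]]) simp
        from has_vector_derivative_real_field[OF this] show ?thesis by simp
      qed
      show "(?\<phi> has_vector_derivative ?\<phi>' t) (at t within {0..l})"
        by (rule has_vector_derivative_mult[OF d1 dw])
      have r: "\<bar>1 - t / l\<bar> \<le> 1" using t l by (auto simp: abs_if)
      have n: "norm (complex_of_real (2 * (1 - t / l))) \<le> 2"
        using r by (simp only: norm_of_real abs_mult abs_numeral) simp
      have Mt: "norm (?w t) \<le> M" "norm (?w' t) \<le> M" using M(2)[of \<epsilon> t] t e by (auto simp: norm_mult)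
      show "norm (?\<phi> t) \<le> 2 * M"
        unfolding norm_mult using n Mt by (intro mult_mono) auto
      have "norm (of_real (2 * (1 - t / l)) * ?w' t) \<le> 2 * M"
        unfolding norm_mult[of "of_real (2 * (1 - t / l))"] using n Mt by (intro mult_mono) auto
      moreover have "norm (of_real (- 2 / l) * ?w t) \<le> 2 / l * M"
        unfolding norm_mult norm_of_real using l Mt by (intro mult_mono) auto
      ultimately show "norm (?\<phi>' t) \<le> 2 / l * M + 2 * M"
        by (subst add.commute, intro order_trans[OF norm_triangle_ineq] add_mono)
    qed (use y l in auto)
    then show "\<bar>Re (integral {0..l} (\<lambda>t. ?\<phi> t * exp (\<i> * of_real (t * y))))\<bar> \<le> C / y"
      unfolding C_def by (rule order_trans[OF abs_Re_le_cmod])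
  qed
  moreover have "C \<ge> 0" using M l by (simp add: C_def)
  ultimately show ?thesis by blast
qed

text \<open>The summand is the derivative of \<open>arctan (ln x - y)\<close>, so the sum compares
  with a telescoping one of size at most \<pi>, uniformly in y. The factor 3 pays for moving from an
  intermediate point to the next integer, which raises \<open>ln x\<close> by at most 1.\<close>

lemma sum_inverse_le:
  fixes y :: real
  shows "(\<Sum>n<N. 1 / (real (Suc n) * (1 + (ln (real (Suc n)) - y)\<^sup>2))) \<le> 1 + 3 * pi"
proof (cases N)
  case 0
  then show ?thesis using pi_gt_zero by simp
next
  case (Suc M)
  define f where "f x = 1 / (x * (1 + (ln x - y)\<^sup>2))" for x
  define g where "g n = arctan (ln (real (Suc n)) - y)" for n
  have step: "f (real (Suc (Suc n))) \<le> 3 * (g (Suc n) - g n)" for n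
  proof -
    let ?a = "real (Suc n)" and ?b = "real (Suc (Suc n))"
    have "\<exists>z. z > ?a \<and> z < ?b \<and> arctan (ln ?b - y) - arctan (ln ?a - y) = (?b - ?a) * f z"
    proof (rule MVT2)
      fix x assume "?a \<le> x" "x \<le> ?b"
      then have x: "x > 0" by simp
      show "((\<lambda>x. arctan (ln x - y)) has_real_derivative f x) (at x)"
        using x by (auto intro!: derivative_eq_intros simp: f_def field_simps)
    qed simp
    then obtain z where z: "?a < z" "z < ?b" "g (Suc n) - g n = f z" by (auto simp: g_def)
    have z0: "z > 0" using z by simp
    have "ln z \<le> ln ?b" using z z0 by simp
    moreover have "ln ?b \<le> ln z + 1"
    proof -
      have "ln ?b \<le> ln (2 * z)" using z z0 by (subst ln_le_cancel_iff) auto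
      also have "\<dots> = ln 2 + ln z" using z0 by (simp add: ln_mult)
      finally show ?thesis using ln_2_less_1 by simp
    qed
    moreover have "1 + a\<^sup>2 \<le> 3 * (1 + b\<^sup>2)" if "a \<le> b" "b \<le> a + 1" for a b :: real
    proof -
      have "(b - a)\<^sup>2 \<le> 1" using that power_mono[of "b - a" 1 2] by simp
      moreover have "a\<^sup>2 = 2 * b\<^sup>2 + 2 * (b - a)\<^sup>2 - (2 * b - a)\<^sup>2"
        by (simp add: power2_eq_square algebra_simps)
      moreover have "0 \<le> (2 * b - a)\<^sup>2" "0 \<le> b\<^sup>2" by simp_all
      ultimately show ?thesis by (simp only: distrib_left mult_1_right)
    qed
    ultimately have "1 + (ln z - y)\<^sup>2 \<le> 3 * (1 + (ln ?b - y)\<^sup>2)" by simp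
    then have "z * (1 + (ln z - y)\<^sup>2) \<le> ?b * (3 * (1 + (ln ?b - y)\<^sup>2))"
      using z z0 by (intro mult_mono) auto
    moreover have "0 < z * (1 + (ln z - y)\<^sup>2)" using z0 by (intro mult_pos_pos) (auto simp: add_pos_nonneg)
    ultimately have "1 / (?b * (3 * (1 + (ln ?b - y)\<^sup>2))) \<le> 1 / (z * (1 + (ln z - y)\<^sup>2))"
      by (intro frac_le) auto
    then have "3 * (1 / (?b * (3 * (1 + (ln ?b - y)\<^sup>2)))) \<le> 3 * f z"
      unfolding f_def by (rule mult_left_mono) simp
    moreover have "f ?b = 3 * (1 / (?b * (3 * (1 + (ln ?b - y)\<^sup>2))))"
    proof -
      have "1 / (m * q) = 3 * (1 / (m * (3 * q)))" for m q :: real by simp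
      then show ?thesis unfolding f_def .
    qed
    ultimately show ?thesis unfolding z(3) by (simp only:)
  qed
  have "(\<Sum>n<N. f (real (Suc n))) = f 1 + (\<Sum>n<M. f (real (Suc (Suc n))))"
    unfolding Suc by (subst sum.lessThan_Suc_shift) simp
  also have "\<dots> \<le> f 1 + (\<Sum>n<M. 3 * (g (Suc n) - g n))"
    by (intro add_left_mono sum_mono step)
  also have "(\<Sum>n<M. 3 * (g (Suc n) - g n)) = 3 * (g M - g 0)"
    by (simp only: sum_distrib_left[symmetric] sum_lessThan_telescope)
  also have "f 1 + 3 * (g M - g 0) \<le> 1 + 3 * pi"
  proof (intro add_mono mult_left_mono)
    show "f 1 \<le> 1" by (simp add: f_def divide_le_eq_1 add_pos_nonneg)
    show "g M - g 0 \<le> pi"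
      using arctan_bounded[of "ln (real (Suc M)) - y"] arctan_bounded[of "ln (real (Suc 0)) - y"] by (simp add: g_def)
  qed simp
  finally show ?thesis by (simp add: f_def)
qed

definition nat_sum_fejer :: "real \<Rightarrow> real \<Rightarrow> real \<Rightarrow> real" where
  "nat_sum_fejer \<epsilon> l y = (\<Sum>n. real n powr (-(1 + \<epsilon>)) * fejer l (y - ln (real n)))"

lemma sums_nat_sum_fejer:
  assumes "\<epsilon> > 0" "l > 0"
  shows "(\<lambda>n. real n powr (-(1 + \<epsilon>)) * fejer l (y - ln (real n))) sums nat_sum_fejer \<epsilon> l y"
  unfolding nat_sum_fejer_def
proof (rule summable_sums, rule summable_comparison_test')
  show "summable (\<lambda>n. real n powr (-(1 + \<epsilon>)) * l)"
    using assms by (intro summable_mult2) (simp add: summable_real_powr_iff)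
  fix n :: nat
  show "norm (real n powr - (1 + \<epsilon>) * fejer l (y - ln (real n))) \<le> real n powr - (1 + \<epsilon>) * l"
    using fejer_le[of l "y - ln (real n)"] fejer_nonneg[of l "y - ln (real n)"] assms
    by (simp add: abs_mult mult_left_mono)
qed

lemma powr_le_inverse: "n > 0 \<Longrightarrow> \<epsilon> > 0 \<Longrightarrow> real n powr (-(1 + \<epsilon>)) \<le> 1 / real n"
  using powr_mono[of "-(1 + \<epsilon>)" "-1" "real n"] by (simp add: powr_minus_divide)

lemma nat_sum_fejer_le:
  assumes "\<epsilon> > 0"
  shows "nat_sum_fejer \<epsilon> 1 y \<le> 8 * (1 + 3 * pi)"
proof -
  let ?t = "\<lambda>n. real n powr (-(1 + \<epsilon>)) * fejer 1 (y - ln (real n))"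
  have "(\<Sum>n<N. ?t n) \<le> 8 * (1 + 3 * pi)" for N
  proof -
    have "(\<Sum>n<N. ?t n) \<le> (\<Sum>n<Suc N. ?t n)" using fejer_nonneg[of 1] by simp
    also have "\<dots> = (\<Sum>n<N. ?t (Suc n))" by (subst sum.lessThan_Suc_shift) simp
    also have "\<dots> \<le> (\<Sum>n<N. 8 * (1 / (real (Suc n) * (1 + (ln (real (Suc n)) - y)\<^sup>2))))"
    proof (rule sum_mono)
      fix n
      let ?m = "real (Suc n)"
      have "?t (Suc n) \<le> 1 / ?m * (8 / (1 + (y - ln ?m)\<^sup>2))"
        using assms fejer_nonneg[of 1] by (intro mult_mono powr_le_inverse fejer_one_le) auto
      then show "?t (Suc n) \<le> 8 * (1 / (?m * (1 + (ln ?m - y)\<^sup>2)))"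
        by (simp add: power2_commute[of y])
    qed
    also have "\<dots> \<le> 8 * (1 + 3 * pi)"
      unfolding sum_distrib_left[symmetric] by (intro mult_left_mono sum_inverse_le) simp
    finally show ?thesis .
  qed
  then show ?thesis
    using sums_nat_sum_fejer[OF assms, of 1 y] unfolding sums_def by (intro LIMSEQ_le_const2) auto
qed

text \<open>Only n between \<open>exp (y - 1/l)\<close> and \<open>exp y\<close> are kept. There the
  kernel is at least \<open>l/2\<close> and, since \<open>\<epsilon> * y <= 1\<close>, the weight is
  at least \<open>exp (-y) / 3\<close>. The range contains at least \<open>exp y / (2 l) - 1\<close>
  integers.\<close>

lemma nat_sum_fejer_ge:
  assumes l: "l \<ge> 1" and y: "y > 0" and e: "0 < \<epsilon>" "\<epsilon> * y \<le> 1"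
  shows "1 / 12 - l / 6 / y \<le> nat_sum_fejer \<epsilon> l y"
proof -
  define a b where "a = nat \<lceil>exp (y - 1 / l)\<rceil>" and "b = nat \<lfloor>exp y\<rfloor>"
  let ?t = "\<lambda>n. real n powr (-(1 + \<epsilon>)) * fejer l (y - ln (real n))"
  have a: "exp (y - 1 / l) \<le> real a" "real a < exp (y - 1 / l) + 1"
  proof -
    have "real a = of_int \<lceil>exp (y - 1 / l)\<rceil>"
      unfolding a_def by (rule of_nat_nat) (simp add: zero_le_ceiling less_trans[OF _ exp_gt_zero])
    then show "exp (y - 1 / l) \<le> real a" "real a < exp (y - 1 / l) + 1" by linarith+
  qed
  have b: "real b \<le> exp y" "exp y < real b + 1"
  proof -
    have "real b = of_int \<lfloor>exp y\<rfloor>" unfolding b_def by (rule of_nat_nat) simp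
    then show "real b \<le> exp y" "exp y < real b + 1" by linarith+
  qed
  have term_ge: "l / 6 * exp (- y) \<le> ?t n" if n: "n \<in> {a..b}" for n
  proof -
    have n0: "real n > 0" using n a exp_gt_zero[of "y - 1 / l"] by (simp del: exp_gt_zero)
    have "exp (y - 1 / l) \<le> real n" using n a by (simp add: order_trans)
    then have l1: "y - 1 / l \<le> ln (real n)" using n0 by (simp add: ln_ge_iff)
    have "real n \<le> exp y" using n b by (simp add: order_trans)
    then have l2: "ln (real n) \<le> y" using n0 by (metis exp_gt_zero ln_exp ln_le_cancel_iff)
    have u: "\<bar>l * (y - ln (real n))\<bar> \<le> 1"
    proof -
      have "l * (y - ln (real n)) \<le> l * (1 / l)" using l1 l by (intro mult_left_mono) auto
      then show ?thesis using l2 l by simp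
    qed
    have "exp (- y) * (1 / 3) \<le> exp (- y) * exp (- 1)"
    proof (rule mult_left_mono)
      show "1 / 3 \<le> exp (- 1 :: real)" using exp_le by (simp add: exp_minus field_simps)
    qed simp
    also have "\<dots> \<le> exp (- ((1 + \<epsilon>) * y))" using e by (simp add: exp_add[symmetric] algebra_simps)
    also have "\<dots> \<le> exp (- ((1 + \<epsilon>) * ln (real n)))" using l2 e by simp
    also have "\<dots> = real n powr (-(1 + \<epsilon>))" using n0 by (simp add: powr_def algebra_simps)
    finally have "exp (- y) * (1 / 3) * (l / 2) \<le> ?t n"
      using l fejer_ge[OF _ u] by (intro mult_mono) auto
    then show ?thesis by (simp add: mult_ac)
  qed
  have "1 / 12 - l / 6 / y \<le> (exp y - exp (y - 1 / l) - 1) * (l / 6 * exp (- y))"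
  proof -
    have "1 - exp (- (1 / l)) \<ge> 1 / l / 2"
    proof -
      have "exp (- (1 / l)) = 1 / exp (1 / l)" by (simp add: exp_minus field_simps)
      also have "\<dots> \<le> 1 / (1 + 1 / l)" using l exp_ge_add_one_self[of "1 / l"] by (intro divide_left_mono mult_pos_pos) (auto simp: add_pos_nonneg)
      also have "\<dots> = 1 - 1 / l / (1 + 1 / l)" using l by (simp add: field_simps)
      finally have "exp (- (1 / l)) \<le> 1 - 1 / l / (1 + 1 / l)" .
      moreover have "1 / l / 2 \<le> 1 / l / (1 + 1 / l)" using l by (intro frac_le) (auto simp: add_pos_nonneg)
      ultimately show ?thesis by linarith
    qed
    then have "l / 6 * (1 / l / 2) \<le> l / 6 * (1 - exp (- (1 / l)))" using l by (intro mult_left_mono) auto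
    then have 1: "1 / 12 \<le> l / 6 * (1 - exp (- (1 / l)))" using l by simp
    have "y \<le> exp y" using exp_ge_add_one_self[of y] by linarith
    then have "exp (- y) \<le> 1 / y" using y by (simp add: exp_minus field_simps)
    then have 2: "l / 6 * exp (- y) \<le> l / 6 * (1 / y)" using l by (intro mult_left_mono) auto
    have "(exp y - exp (y - 1 / l) - 1) * (l / 6 * exp (- y)) = l / 6 * (1 - exp (- (1 / l))) - l / 6 * exp (- y)"
      by (simp add: exp_diff exp_minus field_simps)
    then show ?thesis using 1 2 by simp
  qed
  also have "\<dots> \<le> real (card {a..b}) * (l / 6 * exp (- y))"
    using a b l by (intro mult_right_mono) auto
  also have "\<dots> = (\<Sum>n\<in>{a..b}. l / 6 * exp (- y))" by simp
  also have "\<dots> \<le> (\<Sum>n\<in>{a..b}. ?t n)" by (rule sum_mono[OF term_ge])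
  also have "\<dots> \<le> nat_sum_fejer \<epsilon> l y"
    unfolding nat_sum_fejer_def
    using sums_nat_sum_fejer[OF e(1), of l y] l fejer_nonneg[of l]
    by (intro sum_le_suminf) (auto simp: sums_iff)
  finally show ?thesis .
qed

section \<open>Primes in windows of fixed width on the logarithmic scale\<close>

definition log_window :: "real \<Rightarrow> real \<Rightarrow> nat set" where
  "log_window y d = {n. n > 0 \<and> \<bar>ln (real n) - y\<bar> \<le> d}"

lemma log_window_bounds:
  assumes "n \<in> log_window y d"
  shows "exp (y - d) \<le> real n" "real n \<le> exp (y + d)"
proof -
  have n: "n > 0" "y - d \<le> ln (real n)" "ln (real n) \<le> y + d"
    using assms by (auto simp: log_window_def abs_le_iff)
  then show "exp (y - d) \<le> real n" by (simp add: ln_ge_iff)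
  from n have "exp (ln (real n)) \<le> exp (y + d)" by (simp only: exp_le_cancel_iff)
  then show "real n \<le> exp (y + d)" using n by simp
qed

lemma finite_log_window: "finite (log_window y d)"
proof (rule finite_subset)
  show "log_window y d \<subseteq> {..nat \<lfloor>exp (y + d)\<rfloor>}"
    using log_window_bounds(2) by (auto simp: le_nat_floor)
qed simp

text \<open>Some positive lower bound suffices, so l stays fixed. The kernel of parameter l has
  \<Lambda>-mass at least 1/12 up to errors of order 1/y. Outside the window it is at most
  \<open>A / l\<close> times the sum of two kernels of parameter 1, whose \<Lambda>-masses are at
  most \<open>B / 2\<close>, uniformly in y.\<close>

lemma sum_mangoldt_log_window_ge:
  assumes d: "d > 0"
  shows "\<exists>\<eta>>0. \<exists>Y. \<forall>y\<ge>Y. \<eta> \<le> (\<Sum>n\<in>log_window y d. mangoldt n / real n)"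
proof -
  define A where "A = (1 + pi / d)\<^sup>2"
  have A: "A \<ge> 0" by (simp add: A_def)
  obtain C1 where C1: "C1 \<ge> 0" "\<And>\<epsilon> y. 0 < \<epsilon> \<Longrightarrow> \<epsilon> \<le> 1 \<Longrightarrow> y > 0 \<Longrightarrow>
    \<exists>J. (\<lambda>n. (mangoldt n - 1) * real n powr (-(1 + \<epsilon>)) * fejer 1 (y - ln (real n))) sums J \<and> \<bar>J\<bar> \<le> C1 / y"
    using fejer_error[of 1] by auto
  define B where "B = 2 * (8 * (1 + 3 * pi) + C1)"
  have B: "B \<ge> 0" using C1 pi_gt_zero by (simp add: B_def)
  \<comment> \<open>This makes the mass outside the window, at most \<open>A * B / l\<close>,
    smaller than 1/48. The errors of order 1/y get another 1/48 through \<open>Y\<close>, and 1/24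
    remains of 1/12.\<close>
  define l where "l = 1 + 48 * (A * B)"
  have l: "l \<ge> 1" using A B by (simp add: l_def)
  obtain C where C: "C \<ge> 0" "\<And>\<epsilon> y. 0 < \<epsilon> \<Longrightarrow> \<epsilon> \<le> 1 \<Longrightarrow> y > 0 \<Longrightarrow>
    \<exists>J. (\<lambda>n. (mangoldt n - 1) * real n powr (-(1 + \<epsilon>)) * fejer l (y - ln (real n))) sums J \<and> \<bar>J\<bar> \<le> C / y"
    using fejer_error[of l] l by auto
  define Y where "Y = 1 + 48 * (l / 6 + C)"
  have "1 / 24 / l \<le> (\<Sum>n\<in>log_window y d. mangoldt n / real n)" if y: "y \<ge> Y" for y
  proof -
    have y1: "y \<ge> 1" using y C l by (simp add: Y_def)
    define \<epsilon> where "\<epsilon> = 1 / y"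
    have e: "0 < \<epsilon>" "\<epsilon> \<le> 1" "\<epsilon> * y \<le> 1" using y1 by (auto simp: \<epsilon>_def)
    let ?w = "\<lambda>n. mangoldt n * real n powr (-(1 + \<epsilon>))"
    have mangoldt_sums: "\<exists>S. (\<lambda>n. ?w n * fejer L (z - ln (real n))) sums S \<and> \<bar>S - nat_sum_fejer \<epsilon> L z\<bar> \<le> D / z"
      if L: "L > 0" and z: "z > 0" and ex: "\<exists>J. (\<lambda>n. (mangoldt n - 1) * real n powr (-(1 + \<epsilon>)) * fejer L (z - ln (real n))) sums J \<and> \<bar>J\<bar> \<le> D / z"
      for L z D
    proof -
      from ex obtain J where J: "(\<lambda>n. (mangoldt n - 1) * real n powr (-(1 + \<epsilon>)) * fejer L (z - ln (real n))) sums J" "\<bar>J\<bar> \<le> D / z"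
        by blast
      from sums_add[OF J(1) sums_nat_sum_fejer[OF e(1) L, of z]]
      have "(\<lambda>n. ?w n * fejer L (z - ln (real n))) sums (J + nat_sum_fejer \<epsilon> L z)"
        by (rule sums_cong[THEN iffD1, rotated]) (simp add: algebra_simps)
      then show ?thesis using J(2) by (intro exI[of _ "J + nat_sum_fejer \<epsilon> L z"]) simp
    qed
    obtain S where S: "(\<lambda>n. ?w n * fejer l (y - ln (real n))) sums S" "\<bar>S - nat_sum_fejer \<epsilon> l y\<bar> \<le> C / y"
      using mangoldt_sums[OF _ _ C(2)[OF e(1,2)], of y] l y1 by (meson less_le_trans zero_less_one)
    have small: "\<exists>S'. (\<lambda>n. ?w n * fejer 1 (z - ln (real n))) sums S' \<and> S' \<le> B / 2" if z: "z \<ge> 1" for z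
    proof -
      obtain S' where S': "(\<lambda>n. ?w n * fejer 1 (z - ln (real n))) sums S'" "\<bar>S' - nat_sum_fejer \<epsilon> 1 z\<bar> \<le> C1 / z"
        using mangoldt_sums[OF _ _ C1(2)[OF e(1,2)], of z] z by (meson less_le_trans zero_less_one)
      have "C1 / z \<le> C1" using C1 z by (simp add: divide_le_eq mult_left_mono[of 1 z C1, simplified])
      then have "S' \<le> B / 2" using S'(2) nat_sum_fejer_le[OF e(1), of z] by (simp add: B_def)
      then show ?thesis using S'(1) by blast
    qed
    obtain S1 where S1: "(\<lambda>n. ?w n * fejer 1 (y - ln (real n))) sums S1" "S1 \<le> B / 2"
      using small[OF y1] by blast
    obtain S2 where S2: "(\<lambda>n. ?w n * fejer 1 (y + pi - ln (real n))) sums S2" "S2 \<le> B / 2"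
      using small[of "y + pi"] y1 pi_gt_zero by auto
    let ?N = "log_window y d"
    have near: "(\<lambda>n. if n \<in> ?N then l * (mangoldt n / real n) else 0) sums (\<Sum>n\<in>?N. l * (mangoldt n / real n))"
      by (rule sums_If_finite_set[OF finite_log_window])
    have far: "(\<lambda>n. A / l * (?w n * fejer 1 (y - ln (real n)) + ?w n * fejer 1 (y + pi - ln (real n)))) sums (A / l * (S1 + S2))"
      by (intro sums_mult sums_add S1 S2)
    have "S \<le> (\<Sum>n\<in>?N. l * (mangoldt n / real n)) + A / l * (S1 + S2)"
    proof (rule sums_le[OF _ S(1) sums_add[OF near far]])
      fix n
      let ?u = "y - ln (real n)"
      have w0: "?w n \<ge> 0" by (simp add: mangoldt_nonneg)
      have u': "y + pi - ln (real n) = ?u + pi" by simp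
      have far0: "0 \<le> A / l * (?w n * fejer 1 ?u + ?w n * fejer 1 (y + pi - ln (real n)))"
        using A l w0 fejer_nonneg[of 1] by (intro mult_nonneg_nonneg add_nonneg_nonneg) (auto simp: mangoldt_nonneg)
      show "?w n * fejer l ?u \<le> (if n \<in> ?N then l * (mangoldt n / real n) else 0) +
         A / l * (?w n * fejer 1 ?u + ?w n * fejer 1 (y + pi - ln (real n)))"
      proof (cases "n \<in> ?N")
        case True
        then have n: "n > 0" by (simp add: log_window_def)
        have "?w n * fejer l ?u \<le> (mangoldt n * (1 / real n)) * l"
          using l fejer_nonneg[of l] by (intro mult_mono mult_left_mono powr_le_inverse[OF n e(1)] fejer_le) (auto simp: mangoldt_nonneg)
        then show ?thesis using True far0 by (simp add: mult_ac)
      next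
        case False
        show ?thesis
        proof (cases "n = 0")
          case True
          then show ?thesis by simp
        next
          case n: False
          then have u: "d \<le> \<bar>?u\<bar>" using False by (auto simp: log_window_def abs_minus_commute)
          then have u0: "?u \<noteq> 0" using d by auto
          have "fejer l ?u \<le> 4 / (l * ?u\<^sup>2)" using l u0 by (intro fejer_le_inverse_square) auto
          also have "\<dots> = 1 / l * (4 / ?u\<^sup>2)" by simp
          also have "\<dots> \<le> 1 / l * (A * (fejer 1 ?u + fejer 1 (?u + pi)))"
            unfolding A_def using l by (intro mult_left_mono inverse_square_le_fejer[OF d u]) auto
          finally have "?w n * fejer l ?u \<le> ?w n * (1 / l * (A * (fejer 1 ?u + fejer 1 (?u + pi))))"
            using w0 by (intro mult_left_mono) auto
          also have "\<dots> = A / l * (?w n * fejer 1 ?u + ?w n * fejer 1 (y + pi - ln (real n)))"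
            unfolding u' by (simp add: algebra_simps)
          finally show ?thesis using False by simp
        qed
      qed
    qed
    moreover have "A / l * (S1 + S2) \<le> 1 / 48"
    proof -
      have "A / l * (S1 + S2) \<le> A / l * B" using S1 S2 A l by (intro mult_left_mono) auto
      also have "\<dots> \<le> 1 / 48" using l by (simp add: divide_le_eq l_def)
      finally show ?thesis .
    qed
    moreover have "1 / 12 - l / 6 / y - C / y \<le> S"
      using nat_sum_fejer_ge[OF l _ e(1,3)] S(2) y1 by (simp add: abs_le_iff)
    moreover have "l / 6 / y + C / y \<le> 1 / 48"
      using y y1 by (simp add: add_divide_distrib[symmetric] divide_le_eq Y_def)
    ultimately have "1 / 24 \<le> (\<Sum>n\<in>?N. l * (mangoldt n / real n))" by linarith
    then have "1 / 24 \<le> l * (\<Sum>n\<in>?N. mangoldt n / real n)" by (simp only: sum_distrib_left)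
    then show ?thesis using l by (simp add: divide_le_eq mult.commute)
  qed
  then show ?thesis using l by (intro exI[of _ "1 / 24 / l"] exI[of _ Y] conjI) auto
qed

lemma card_proper_prime_powers_le:
  assumes X: "X \<ge> 1"
  shows "real (card {n. primepow n \<and> \<not> prime n \<and> real n \<le> X}) \<le> (sqrt X + 1) * (2 * ln X + 1)"
proof -
  let ?S = "{n::nat. primepow n \<and> \<not> prime n \<and> real n \<le> X}"
  let ?P = "{..nat \<lfloor>sqrt X\<rfloor>} \<times> {..nat \<lfloor>2 * ln X\<rfloor>}"
  have "?S \<subseteq> (\<lambda>(p, k). p ^ k) ` ?P"
  proof
    fix n assume n: "n \<in> ?S"
    then obtain p k where pk: "prime p" "k > 0" "n = p ^ k" by (auto simp: primepow_def)
    have "k \<noteq> 1" using n pk by auto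
    then have k: "k \<ge> 2" using pk by simp
    have p2: "p \<ge> 2" using pk by (simp add: prime_ge_2_nat)
    have "real p ^ 2 \<le> real p ^ k" using k p2 by (intro power_increasing) auto
    also have "\<dots> \<le> X" using n pk by simp
    finally have "real p \<le> sqrt X" by (rule real_le_rsqrt)
    moreover have "real k \<le> 2 * ln X"
    proof -
      have "(2::real) ^ k \<le> real p ^ k" using p2 by (intro power_mono) auto
      also have "\<dots> \<le> X" using n pk by simp
      finally have "ln ((2::real) ^ k) \<le> ln X" by (rule ln_mono) simp
      then have "real k * ln 2 \<le> ln X" by (simp add: ln_realpow)
      moreover have "real k * (1 / 2) \<le> real k * ln 2" using ln2_ge_two_thirds by (intro mult_left_mono) auto
      ultimately show ?thesis by simp
    qed
    ultimately show "n \<in> (\<lambda>(p, k). p ^ k) ` ?P" using pk by (intro image_eqI[of _ _ "(p, k)"]) (auto intro: le_nat_floor)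
  qed
  then have "card ?S \<le> card ?P" by (intro surj_card_le) auto
  also have "\<dots> = (nat \<lfloor>sqrt X\<rfloor> + 1) * (nat \<lfloor>2 * ln X\<rfloor> + 1)" by (simp add: card_cartesian_product)
  finally have "real (card ?S) \<le> real ((nat \<lfloor>sqrt X\<rfloor> + 1) * (nat \<lfloor>2 * ln X\<rfloor> + 1))"
    by (simp only: of_nat_le_iff)
  also have "\<dots> = (real (nat \<lfloor>sqrt X\<rfloor>) + 1) * (real (nat \<lfloor>2 * ln X\<rfloor>) + 1)"
    by (simp only: of_nat_mult of_nat_add of_nat_1)
  also have "\<dots> \<le> (sqrt X + 1) * (2 * ln X + 1)"
    using X by (intro mult_mono add_mono) auto
  finally show ?thesis .
qed

text \<open>In a window without primes all \<Lambda>-mass would come from proper prime powers. These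
  number at most about \<open>y * exp (y/2)\<close> and weigh about \<open>y / exp y\<close> each,
  which falls below any fixed \<eta>.\<close>

lemma prime_in_log_window:
  assumes d: "d > 0"
  shows "\<forall>\<^sub>F y in at_top. \<exists>p. prime p \<and> p \<in> log_window y d"
proof -
  obtain \<eta> Y where eta: "\<eta> > 0" "\<And>y. y \<ge> Y \<Longrightarrow> \<eta> \<le> (\<Sum>n\<in>log_window y d. mangoldt n / real n)"
    using sum_mangoldt_log_window_ge[OF d] by blast
  have "((\<lambda>y. (sqrt (exp (y + d)) + 1) * (2 * (y + d) + 1) * ((y + d) / exp (y - d))) \<longlongrightarrow> 0) at_top"
    by real_asymp
  then have "\<forall>\<^sub>F y in at_top. (sqrt (exp (y + d)) + 1) * (2 * (y + d) + 1) * ((y + d) / exp (y - d)) < \<eta>"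
    using eta(1) by (rule order_tendstoD)
  moreover have "\<forall>\<^sub>F y in at_top. y \<ge> max Y 0" by (rule eventually_ge_at_top)
  ultimately show ?thesis
  proof eventually_elim
    case (elim y)
    show ?case
    proof (rule ccontr)
      assume no: "\<not> ?case"
      let ?S = "{n. primepow n \<and> \<not> prime n \<and> real n \<le> exp (y + d)}"
      have finS: "finite ?S"
        by (rule finite_subset[of _ "{..nat \<lfloor>exp (y + d)\<rfloor>}"]) (auto simp: le_nat_floor)
      have "\<eta> \<le> (\<Sum>n\<in>log_window y d. mangoldt n / real n)" using eta(2) elim by simp
      also have "\<dots> = (\<Sum>n\<in>log_window y d \<inter> ?S. mangoldt n / real n)"
        using no log_window_bounds(2) finite_log_window
        by (intro sum.mono_neutral_right) (auto simp: mangoldt_def)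
      also have "\<dots> \<le> (\<Sum>n\<in>log_window y d \<inter> ?S. (y + d) / exp (y - d))"
      proof (rule sum_mono)
        fix n assume n: "n \<in> log_window y d \<inter> ?S"
        then have n0: "n > 0" and "ln (real n) \<le> y + d" by (auto simp: log_window_def)
        then have "mangoldt n \<le> y + d" using mangoldt_le_ln[OF n0] by simp
        then show "mangoldt n / real n \<le> (y + d) / exp (y - d)"
          using log_window_bounds(1)[of n y d] n elim d by (intro frac_le) (auto simp: mangoldt_nonneg)
      qed
      also have "\<dots> = real (card (log_window y d \<inter> ?S)) * ((y + d) / exp (y - d))" by simp
      also have "\<dots> \<le> ((sqrt (exp (y + d)) + 1) * (2 * (y + d) + 1)) * ((y + d) / exp (y - d))"
      proof (rule mult_right_mono)
        have "card (log_window y d \<inter> ?S) \<le> card ?S" using finS by (intro card_mono) auto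
        then have "real (card (log_window y d \<inter> ?S)) \<le> real (card ?S)" by simp
        also have "\<dots> \<le> (sqrt (exp (y + d)) + 1) * (2 * ln (exp (y + d)) + 1)"
          using elim d by (intro card_proper_prime_powers_le) simp
        finally show "real (card (log_window y d \<inter> ?S)) \<le> (sqrt (exp (y + d)) + 1) * (2 * (y + d) + 1)" by simp
      qed (use elim d in simp)
      finally show False using elim by simp
    qed
  qed
qed

section \<open>Schur triples modulo a prime\<close>

definition pm_cong :: "nat \<Rightarrow> int \<Rightarrow> int \<Rightarrow> bool" where
  "pm_cong q x y \<longleftrightarrow> int q dvd x - y \<or> int q dvd x + y"

lemma pm_cong_sym: "pm_cong q x y \<Longrightarrow> pm_cong q y x"
  by (auto simp: pm_cong_def add.commute dvd_diff_commute)

lemma pm_cong_trans: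
  assumes "pm_cong q x y" "pm_cong q y z" shows "pm_cong q x z"
proof -
  have "int q dvd x - z" if "int q dvd x - y" "int q dvd y - z" using dvd_add[OF that] by simp
  moreover have "int q dvd x + z" if "int q dvd x - y" "int q dvd y + z" using dvd_add[OF that] by simp
  moreover have "int q dvd x + z" if "int q dvd x + y" "int q dvd y - z" using dvd_diff[OF that] by simp
  moreover have "int q dvd x - z" if "int q dvd x + y" "int q dvd y + z" using dvd_diff[OF that] by simp
  ultimately show ?thesis using assms unfolding pm_cong_def by blast
qed

lemma pm_cong_signs:
  assumes "a \<in> {1, -1}" "b \<in> {1, -1}" "int q dvd a * x + b * y"
  shows "pm_cong q x y"
proof -
  have "int q dvd a * (a * x + b * y)" using assms(3) by simp
  also have "a * (a * x + b * y) = (a * a) * x + (a * b) * y" by (simp add: algebra_simps)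
  finally have "int q dvd (a * a) * x + (a * b) * y" .
  moreover have "(a * a) * x + (a * b) * y = x + y \<or> (a * a) * x + (a * b) * y = x - y" using assms(1,2) by auto
  ultimately show ?thesis by (auto simp: pm_cong_def)
qed

definition schur :: "nat \<Rightarrow> int \<Rightarrow> int \<Rightarrow> int \<Rightarrow> bool" where
  "schur q x y z \<longleftrightarrow> (\<exists>a\<in>{1, -1}. \<exists>b\<in>{1, -1}. \<exists>c\<in>{1, -1}. int q dvd a * x + b * y + c * z)"

lemma schurI: "a \<in> {1, -1} \<Longrightarrow> b \<in> {1, -1} \<Longrightarrow> c \<in> {1, -1} \<Longrightarrow> int q dvd a * x + b * y + c * z \<Longrightarrow> schur q x y z"
  unfolding schur_def by blast

lemma schur_commute:
  assumes "schur q x y z"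
  shows "schur q y x z" "schur q x z y"
proof -
  from assms obtain a b c where "a \<in> {1, -1}" "b \<in> {1, -1}" "c \<in> {1, -1}" "int q dvd a * x + b * y + c * z"
    unfolding schur_def by blast
  then show "schur q y x z" "schur q x z y"
    using schurI[of b a c q y x z] schurI[of a c b q x z y] by (simp_all only: add_ac)
qed

text \<open>Up to an overall sign z is the sum or the difference of x and y. This gives the two
  choices required by a triangle system.\<close>

lemma schur_pm_cong:
  assumes "schur q x y z"
  shows "pm_cong q z (x + y) \<or> pm_cong q z (x - y)"
proof -
  from assms obtain a b c where abc: "a \<in> {1, -1}" "b \<in> {1, -1}" "c \<in> {1, -1}" "int q dvd a * x + b * y + c * z"
    unfolding schur_def by blast
  show ?thesis
  proof (cases "a = b")
    case True
    then have "int q dvd a * (x + y) + c * z" using abc(4) by (simp add: distrib_left)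
    from pm_cong_sym[OF pm_cong_signs[OF abc(1,3) this]] show ?thesis ..
  next
    case False
    then have "b = - a" using abc(1,2) by auto
    then have "int q dvd a * (x - y) + c * z" using abc(4) by (simp add: algebra_simps)
    from pm_cong_sym[OF pm_cong_signs[OF abc(1,3) this]] show ?thesis ..
  qed
qed

lemma schur_cong:
  assumes "schur q x y z" "pm_cong q x x'" "pm_cong q y y'" "pm_cong q z z'"
  shows "schur q x' y' z'"
proof -
  have one: "\<exists>a'\<in>{1, -1}. int q dvd a' * x' + r" if "pm_cong q x x'" "a \<in> {1, -1}" "int q dvd a * x + r" for a x x' r
  proof -
    from that(1) show ?thesis unfolding pm_cong_def
    proof
      assume *: "int q dvd x - x'"
      then have "int q dvd (a * x + r) - a * (x - x')" by (rule dvd_diff[OF that(3) dvd_mult])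
      then have "int q dvd a * x' + r" by (simp add: algebra_simps)
      then show ?thesis using that(2) by blast
    next
      assume "int q dvd x + x'"
      then have "int q dvd (a * x + r) - a * (x + x')" by (rule dvd_diff[OF that(3) dvd_mult])
      then have "int q dvd (- a) * x' + r" by (simp add: algebra_simps)
      moreover have "- a \<in> {1, -1}" using that(2) by auto
      ultimately show ?thesis by blast
    qed
  qed
  from assms(1) obtain a b c where abc: "a \<in> {1, -1}" "b \<in> {1, -1}" "c \<in> {1, -1}" "int q dvd a * x + b * y + c * z"
    unfolding schur_def by blast
  obtain a' where a': "a' \<in> {1, -1}" "int q dvd a' * x' + (b * y + c * z)"
    using one[OF assms(2) abc(1) abc(4)[unfolded add.assoc]] by blast
  have "int q dvd b * y + (c * z + a' * x')" using a'(2) by (simp only: add_ac)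
  then obtain b' where b': "b' \<in> {1, -1}" "int q dvd b' * y' + (c * z + a' * x')"
    using one[OF assms(3) abc(2)] by blast
  have "int q dvd c * z + (a' * x' + b' * y')" using b'(2) by (simp only: add_ac)
  then obtain c' where c': "c' \<in> {1, -1}" "int q dvd c' * z' + (a' * x' + b' * y')"
    using one[OF assms(4) abc(3)] by blast
  show ?thesis using a'(1) b'(1) c' by (intro schurI[of a' b' c']) (simp_all only: add_ac)
qed

lemma abs_signs:
  fixes a b d k l :: int
  assumes "\<bar>a\<bar> = 1" "\<bar>b\<bar> = 1" "\<bar>d\<bar> = 1" "0 \<le> k" "0 \<le> l"
  shows "\<bar>a + b * k + d * l\<bar> \<le> 1 + k + l"
proof -
  have "\<bar>a + b * k + d * l\<bar> \<le> \<bar>a\<bar> + \<bar>b * k\<bar> + \<bar>d * l\<bar>" by (intro order_trans[OF abs_triangle_ineq] add_mono abs_triangle_ineq order_refl)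
  then show ?thesis using assms by (simp add: abs_mult)
qed
lemma signs_zero:
  fixes a b d k l :: int
  assumes "a \<in> {1, -1}" "b \<in> {1, -1}" "d \<in> {1, -1}" "1 \<le> k" "1 \<le> l" "a + b * k + d * l = 0"
  shows "l = k + 1 \<or> k = l + 1"
proof -
  consider "b = 1" "d = 1" | "b = 1" "d = -1" | "b = -1" "d = 1" | "b = -1" "d = -1" using assms by blast
  then show ?thesis
  proof cases
    case 1
    then show ?thesis using assms(1,4-6) by auto
  next
    case 2
    then have "l = k + a" using assms(6) by simp
    then show ?thesis using assms(1) by auto
  next
    case 3
    then have "k = l + a" using assms(6) by simp
    then show ?thesis using assms(1) by auto
  next
    case 4
    then show ?thesis using assms(1,4-6) by auto
  qed
qed

locale odd_prime =
  fixes q h :: nat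
  assumes prime_q: "prime q" and q_eq: "q = 2 * h + 1"
begin

definition half :: "nat set" where "half = {1..h}"

lemma finite_half [simp]: "finite half" and card_half [simp]: "card half = h"
  by (simp_all add: half_def)

lemma h_pos: "h > 0"
  using prime_q q_eq by (cases h) auto

lemma halfD: "x \<in> half \<Longrightarrow> 0 < int x" "x \<in> half \<Longrightarrow> 2 * int x < int q"
  by (auto simp: half_def q_eq)

lemma pm_cong_half_eq:
  assumes "x \<in> half" "y \<in> half" "pm_cong q (int x) (int y)"
  shows "x = y"
proof -
  have "\<not> int q dvd int x + int y"
    using halfD[OF assms(1)] halfD[OF assms(2)] by (intro zdvd_not_zless) auto
  then have "int q dvd int x - int y" using assms(3) by (simp add: pm_cong_def)
  moreover have "\<not> \<bar>int q\<bar> \<le> \<bar>int x - int y\<bar>"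
    using halfD[OF assms(1)] halfD[OF assms(2)] by (simp add: abs_less_iff not_le)
  ultimately have "int x - int y = 0" by (metis dvd_imp_le_int)
  then show ?thesis by simp
qed

lemma half_not_dvd: "x \<in> half \<Longrightarrow> \<not> int q dvd int x"
  using halfD[of x] by (intro zdvd_not_zless) auto

lemma exists_pm_multiple:
  assumes "u \<in> half" "v \<in> half"
  shows "\<exists>k\<in>half. pm_cong q (int k * int u) (int v)"
proof -
  have "coprime (int u) (int q)"
    using half_not_dvd[OF assms(1)] prime_q by (metis coprime_commute prime_imp_coprime prime_nat_int_transfer)
  then obtain i where i: "[int u * i = 1] (mod int q)" using cong_solve_coprime_int by blast
  define m where "m = (i * int v) mod int q"
  have qpos: "int q > 0" using q_eq by simp
  have m: "0 \<le> m" "m < int q" using qpos by (auto simp: m_def)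
  have "[m * int u = (i * int v) * int u] (mod int q)" unfolding m_def by (intro cong_mult) auto
  also have "(i * int v) * int u = int u * i * int v" by simp
  also have "[int u * i * int v = 1 * int v] (mod int q)" using i by (intro cong_mult) auto
  finally have c: "int q dvd m * int u - int v" by (simp add: cong_iff_dvd_diff)
  have m0: "m \<noteq> 0" using c half_not_dvd[OF assms(2)] by auto
  show ?thesis
  proof (cases "m \<le> int h")
    case True
    have "int (nat m) = m" using m by simp
    then show ?thesis using c m0 m True by (intro bexI[of _ "nat m"]) (auto simp: pm_cong_def half_def)
  next
    case False
    have "int (nat (int q - m)) = int q - m" using m by simp
    moreover have "int q dvd (int q - m) * int u + int v"
    proof -
      have "(int q - m) * int u + int v = int q * int u - (m * int u - int v)" by (simp add: algebra_simps)
      then show ?thesis using c by (metis dvd_diff dvd_triv_left)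
    qed
    ultimately show ?thesis using m False q_eq by (intro bexI[of _ "nat (int q - m)"]) (auto simp: pm_cong_def half_def)
  qed
qed

definition schur_triples :: "nat set set" where
  "schur_triples = {t. \<exists>x y z. t = {x, y, z} \<and> x \<in> half \<and> y \<in> half \<and> z \<in> half \<and> x \<noteq> y \<and> y \<noteq> z \<and> x \<noteq> z \<and>
     schur q (int x) (int y) (int z)}"

lemma schur_triplesD:
  assumes "{x, y, z} \<in> schur_triples"
  shows "x \<in> half" "y \<in> half" "z \<in> half" "x \<noteq> y" "y \<noteq> z" "x \<noteq> z" "schur q (int x) (int y) (int z)"
proof -
  from assms obtain a b c where t: "{x, y, z} = {a, b, c}" "a \<in> half" "b \<in> half" "c \<in> half" "a \<noteq> b" "b \<noteq> c" "a \<noteq> c"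
    "schur q (int a) (int b) (int c)" unfolding schur_triples_def by blast
  have "card {x, y, z} = 3" using t by simp
  then show ne: "x \<noteq> y" "y \<noteq> z" "x \<noteq> z" by (auto simp: card_insert_if split: if_splits)
  have "{x, y, z} \<subseteq> half" using t(2-4) unfolding t(1) by simp
  then show "x \<in> half" "y \<in> half" "z \<in> half" by simp_all
  have "(x = a \<and> y = b \<and> z = c) \<or> (x = a \<and> y = c \<and> z = b) \<or> (x = b \<and> y = a \<and> z = c) \<or>
    (x = b \<and> y = c \<and> z = a) \<or> (x = c \<and> y = a \<and> z = b) \<or> (x = c \<and> y = b \<and> z = a)"
  proof -
    have "x \<in> {a, b, c}" "y \<in> {a, b, c}" "z \<in> {a, b, c}" unfolding t(1)[symmetric] by simp_all
    then show ?thesis using ne by auto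
  qed
  moreover note perm = t(8) schur_commute(1)[OF t(8)] schur_commute(2)[OF t(8)]
  moreover note perm' = schur_commute(2)[OF perm(2)] schur_commute(1)[OF perm(3)]
  moreover note schur_commute(1)[OF perm'(1)]
  ultimately show "schur q (int x) (int y) (int z)" by (elim disjE conjE) (simp_all only:)
qed

text \<open>Division by u turns the Schur relation into \<open>a + b * k + d * l\<close> being
  divisible by q, with signs a, b, d. Its absolute value is below q, so it is 0, and k and l differ
  by 1.\<close>

lemma schur_neighbour:
  assumes "{u, v, w} \<in> schur_triples" and k: "k \<in> half" "l \<in> half"
    and c: "pm_cong q (int k * int u) (int v)" "pm_cong q (int l * int u) (int w)"
  shows "l = k + 1 \<or> k = l + 1"
proof -
  note t = schur_triplesD[OF assms(1)]
  have "schur q (int u) (int k * int u) (int l * int u)"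
    by (rule schur_cong[OF t(7) _ pm_cong_sym[OF c(1)] pm_cong_sym[OF c(2)]]) (simp add: pm_cong_def)
  then obtain a b d where s: "a \<in> {1, -1 :: int}" "b \<in> {1, -1 :: int}" "d \<in> {1, -1 :: int}"
    "int q dvd a * int u + b * (int k * int u) + d * (int l * int u)" unfolding schur_def by blast
  have "a * int u + b * (int k * int u) + d * (int l * int u) = (a + b * int k + d * int l) * int u"
    by (simp add: algebra_simps)
  then have dv: "int q dvd a + b * int k + d * int l"
    using s(4) half_not_dvd[OF t(1)] prime_q by (simp add: prime_dvd_mult_iff)
  \<comment> \<open>The case \<open>k = l = h\<close> has \<open>1 + k + l = q\<close> and must be
    excluded before the congruence becomes an equation.\<close>
  have kl: "k \<noteq> l"
  proof
    assume "k = l"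
    then have "pm_cong q (int v) (int w)" using c(2) by (intro pm_cong_trans[OF pm_cong_sym[OF c(1)]]) simp
    then show False using pm_cong_half_eq t by blast
  qed
  have lt: "\<bar>a + b * int k + d * int l\<bar> < int q"
  proof -
    have "int k + int l < 2 * int h" using k kl by (auto simp: half_def)
    moreover have "\<bar>a + b * int k + d * int l\<bar> \<le> 1 + int k + int l" by (rule abs_signs) (use s(1-3) in auto)
    ultimately show ?thesis by (simp add: q_eq)
  qed
  have "a + b * int k + d * int l = 0"
  proof (rule ccontr)
    assume "a + b * int k + d * int l \<noteq> 0"
    from dvd_imp_le_int[OF this dv] show False using lt by simp
  qed
  moreover have "1 \<le> int k" "1 \<le> int l" using k by (auto simp: half_def)
  ultimately have "int l = int k + 1 \<or> int k = int l + 1"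
    by (intro signs_zero[OF s(1-3)])
  then have "int l = int (k + 1) \<or> int k = int (l + 1)" by (simp only: of_nat_add of_nat_1)
  then show ?thesis by (simp only: of_nat_eq_iff)
qed

text \<open>After division by \<open>u\<close> the Schur triples through \<open>u\<close> are the \<open>{1, k, k + 1}\<close>, so they form a path and
  the edge to its first vertex lies in one triple only.\<close>

lemma triangle_system_schur: "triangle_system half schur_triples"
proof (rule triangle_system.intro)
  show "finite half" by simp
  show "t \<subseteq> half \<and> card t = 3" if "t \<in> schur_triples" for t
    using that unfolding schur_triples_def by auto
  show "card {z. {x, y, z} \<in> schur_triples} \<le> 2" for x y
  proof -
    let ?A = "\<lambda>s. {z \<in> half. pm_cong q (int z) s}"
    have c: "card (?A s) \<le> 1" for s
    proof -
      have "z = z'" if "z \<in> ?A s" "z' \<in> ?A s" for z z'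
        using that by (intro pm_cong_half_eq) (auto intro: pm_cong_trans[OF _ pm_cong_sym])
      then show ?thesis by (subst One_nat_def, subst card_le_Suc0_iff_eq) auto
    qed
    have "{z. {x, y, z} \<in> schur_triples} \<subseteq> ?A (int x + int y) \<union> ?A (int x - int y)"
    proof
      fix z assume "z \<in> {z. {x, y, z} \<in> schur_triples}"
      then have "{x, y, z} \<in> schur_triples" by simp
      note d = schur_triplesD[OF this]
      show "z \<in> ?A (int x + int y) \<union> ?A (int x - int y)" using schur_pm_cong[OF d(7)] d(3) by blast
    qed
    then have "card {z. {x, y, z} \<in> schur_triples} \<le> card (?A (int x + int y) \<union> ?A (int x - int y))"
      by (intro card_mono) auto
    also have "\<dots> \<le> 2" using card_Un_le[of "?A (int x + int y)" "?A (int x - int y)"] c[of "int x + int y"] c[of "int x - int y"] by linarith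
    finally show ?thesis .
  qed
  show "u \<in> \<Union>(bd T)" if T: "T \<subseteq> schur_triples" and t: "t \<in> T" "u \<in> t" for T t u
  proof -
    define P where "P k \<longleftrightarrow> k \<in> half \<and> (\<exists>v. v \<noteq> u \<and> pm_cong q (int k * int u) (int v) \<and> (\<exists>t\<in>T. u \<in> t \<and> v \<in> t))" for k
    have shape: "\<exists>v w. t = {u, v, w}" if "t \<in> T" "u \<in> t" for t
      using that T unfolding schur_triples_def by blast
    have ex: "\<exists>k. P k"
    proof -
      obtain v w where vw: "t = {u, v, w}" using shape t by blast
      note d = schur_triplesD[of u v w]
      have "u \<in> half" "v \<in> half" "v \<noteq> u" using d vw t T by auto
      then obtain k where "k \<in> half" "pm_cong q (int k * int u) (int v)" using exists_pm_multiple by blast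
      then show ?thesis using \<open>v \<noteq> u\<close> t vw unfolding P_def by blast
    qed
    \<comment> \<open>Among the vertices sharing a triple of T with u, v has the least multiplier k.
      In a triple of T through u and v the third multiplier is \<open>k - 1\<close> or
      \<open>k + 1\<close>; minimality leaves \<open>k + 1\<close>, so only one such triple exists
      and the pair lies on the boundary.\<close>
    define k where "k = (LEAST k. P k)"
    have Pk: "P k" unfolding k_def using ex by (rule LeastI_ex)
    then obtain v t0 where v: "v \<noteq> u" "k \<in> half" "pm_cong q (int k * int u) (int v)" "t0 \<in> T" "u \<in> t0" "v \<in> t0"
      unfolding P_def by blast
    have key: "\<exists>w. t' = {u, v, w} \<and> w \<in> half \<and> pm_cong q (int (k + 1) * int u) (int w)" if t': "t' \<in> T" "u \<in> t'" "v \<in> t'" for t'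
    proof -
      obtain v' w' where "t' = {u, v', w'}" using shape t' by blast
      then obtain w where w: "t' = {u, v, w}" using t' v(1) by blast
      have tt: "{u, v, w} \<in> schur_triples" using w t' T by blast
      note d = schur_triplesD[OF tt]
      obtain l where l: "l \<in> half" "pm_cong q (int l * int u) (int w)" using exists_pm_multiple d by blast
      have "P l" unfolding P_def using l d t' by (intro conjI exI[of _ w] bexI[of _ t']) (auto simp: w)
      then have "k \<le> l" unfolding k_def by (rule Least_le)
      moreover have "l = k + 1 \<or> k = l + 1" by (rule schur_neighbour[OF tt v(2) l(1) v(3) l(2)])
      ultimately have "l = k + 1" by (elim disjE) simp_all
      then show ?thesis using w d l by blast
    qed
    have "{t \<in> T. {u, v} \<subseteq> t} = {t0}"
    proof -
      have "t' = t0" if a: "t' \<in> T" "u \<in> t'" "v \<in> t'" for t'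
      proof -
        obtain w where w: "t' = {u, v, w}" "w \<in> half" "pm_cong q (int (k + 1) * int u) (int w)" using key[OF a] by blast
        obtain w0 where w0: "t0 = {u, v, w0}" "w0 \<in> half" "pm_cong q (int (k + 1) * int u) (int w0)" using key[OF v(4-6)] by blast
        have "w = w0" by (rule pm_cong_half_eq[OF w(2) w0(2) pm_cong_trans[OF pm_cong_sym[OF w(3)] w0(3)]])
        then show ?thesis using w w0 by simp
      qed
      then show ?thesis using v by blast
    qed
    then have "{u, v} \<in> bd T" using v(1) by (simp add: bd_def)
    then show ?thesis by blast
  qed
qed

sublocale schur_system: triangle_system half schur_triples
  by (rule triangle_system_schur)

lemma schur_sgn_of:
  assumes S: "S \<in> schur_system.valid" and "{x, y, z} \<in> schur_triples"
  shows "sgn_of S {x, y} * sgn_of S {y, z} * sgn_of S {x, z} = -1"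
proof -
  note d = schur_triplesD[OF assms(2)]
  have "edges_on {x, y, z} = {{x, y}, {y, z}, {x, z}}"
    using d unfolding edges_on_def by (auto simp: card_2_iff)
  moreover have "{x, y} \<noteq> {y, z}" "{x, y} \<noteq> {x, z}" "{y, z} \<noteq> {x, z}" using d by (auto simp: doubleton_eq_iff)
  ultimately have "(\<Prod>e\<in>edges_on {x, y, z}. sgn_of S e) = sgn_of S {x, y} * sgn_of S {y, z} * sgn_of S {x, z}"
    by (simp add: mult.assoc)
  then show ?thesis using S assms(2) by (simp add: schur_system.valid_def)
qed

end

section \<open>Trigonometric sums and jumbledness\<close>

definition cosq :: "nat \<Rightarrow> int \<Rightarrow> real" where
  "cosq q x = cos (2 * pi * of_int x / real q)"

definition sinq :: "nat \<Rightarrow> int \<Rightarrow> real" where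
  "sinq q x = sin (2 * pi * of_int x / real q)"

lemma cosq_0 [simp]: "cosq q 0 = 1" and sinq_0 [simp]: "sinq q 0 = 0"
  by (simp_all add: cosq_def sinq_def)

lemma abs_cosq_le_1: "\<bar>cosq q x\<bar> \<le> 1"
  by (simp add: cosq_def)

lemma cosq_minus [simp]: "cosq q (- x) = cosq q x"
  by (simp add: cosq_def)

lemma cosq_diff: "cosq q (x - y) = cosq q x * cosq q y + sinq q x * sinq q y"
  by (simp add: cosq_def sinq_def cos_diff[symmetric] diff_divide_distrib right_diff_distrib)

lemma cosq_add: "cosq q (x + y) = cosq q x * cosq q y - sinq q x * sinq q y"
  by (simp add: cosq_def sinq_def cos_add[symmetric] add_divide_distrib distrib_left)

lemma cosq_mult_cosq: "cosq q x * cosq q y = (cosq q (x - y) + cosq q (x + y)) / 2"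
  by (simp add: cosq_diff cosq_add)

lemma cosq_dvd:
  assumes "q > 0" "int q dvd x"
  shows "cosq q x = 1"
proof -
  obtain k where "x = int q * k" using assms by blast
  then have "2 * pi * of_int x / real q = of_int k * 2 * pi" using assms by simp
  then show ?thesis unfolding cosq_def cos_one_2pi_int by blast
qed

lemma cosq_cong_dvd:
  assumes "q > 0" "int q dvd x - y"
  shows "cosq q x = cosq q y"
proof -
  obtain k where k: "x - y = int q * k" using assms by blast
  have "2 * pi * of_int x / real q = 2 * pi * of_int y / real q + (2 * pi) * of_int k"
  proof -
    have "x = y + int q * k" using k by simp
    then show ?thesis using assms by (simp add: field_simps)
  qed
  then show ?thesis unfolding cosq_def by (simp only: cos_add cos_int_2pin sin_int_2pin mult_1_right mult_zero_right diff_zero)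
qed

lemma cosq_pm_cong:
  assumes "q > 0" "pm_cong q x y"
  shows "cosq q x = cosq q y"
  using assms cosq_cong_dvd[of q x y] cosq_cong_dvd[of q x "- y"] by (auto simp: pm_cong_def)

lemma sum_cosq:
  assumes q: "q > 0"
  shows "(\<Sum>b<q. cosq q (int b * x)) = (if int q dvd x then real q else 0)"
proof (cases "int q dvd x")
  case True
  then have "cosq q (int b * x) = 1" for b using q by (intro cosq_dvd) auto
  then show ?thesis using True by simp
next
  case False
  let ?\<theta> = "2 * pi * of_int x / real q"
  have ne: "cis ?\<theta> \<noteq> 1"
  proof
    assume "cis ?\<theta> = 1"
    then have "cos ?\<theta> = 1" by (metis cis.simps(1) one_complex.simps(1))
    then obtain n :: int where "?\<theta> = of_int n * 2 * pi" unfolding cos_one_2pi_int by blast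
    then have "of_int x = real q * of_int n" using q by (simp add: field_simps)
    then have "x = int q * n" by (metis of_int_eq_iff of_int_mult of_int_of_nat_eq)
    then show False using False by simp
  qed
  have "cis ?\<theta> ^ q = 1"
  proof -
    have "real q * ?\<theta> = 2 * pi * of_int x" using q by simp
    then have "cis ?\<theta> ^ q = cis (2 * pi * of_int x)" unfolding Complex.DeMoivre by (rule arg_cong)
    then show ?thesis by (simp add: cis_multiple_2pi)
  qed
  then have z: "(\<Sum>b<q. cis ?\<theta> ^ b) = 0" using ne by (simp add: sum_gp_strict)
  have "Re (cis ?\<theta> ^ b) = cosq q (int b * x)" for b
    by (simp add: Complex.DeMoivre cosq_def mult_ac)
  then have "(\<Sum>b<q. cosq q (int b * x)) = Re (\<Sum>b<q. cis ?\<theta> ^ b)" by simp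
  then show ?thesis using z False by simp
qed

lemma parseval_cosq:
  fixes \<phi> :: "nat \<Rightarrow> real"
  assumes q: "q > 0"
  shows "(\<Sum>b<q. (\<Sum>t<q. \<phi> t * cosq q (int b * int t))\<^sup>2 + (\<Sum>t<q. \<phi> t * sinq q (int b * int t))\<^sup>2) = real q * (\<Sum>t<q. (\<phi> t)\<^sup>2)"
proof -
  have "(\<Sum>t<q. \<phi> t * cosq q (int b * int t))\<^sup>2 + (\<Sum>t<q. \<phi> t * sinq q (int b * int t))\<^sup>2
    = (\<Sum>t<q. \<Sum>u<q. \<phi> t * \<phi> u * cosq q (int b * (int t - int u)))" for b
    by (simp add: power2_eq_square sum_product sum.distrib[symmetric] right_diff_distrib cosq_diff algebra_simps)
  then have "(\<Sum>b<q. (\<Sum>t<q. \<phi> t * cosq q (int b * int t))\<^sup>2 + (\<Sum>t<q. \<phi> t * sinq q (int b * int t))\<^sup>2)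
    = (\<Sum>b<q. \<Sum>t<q. \<Sum>u<q. \<phi> t * \<phi> u * cosq q (int b * (int t - int u)))" by simp
  also have "\<dots> = (\<Sum>t<q. \<Sum>u<q. \<Sum>b<q. \<phi> t * \<phi> u * cosq q (int b * (int t - int u)))"
    by (rule trans[OF sum.swap sum.cong[OF refl sum.swap]])
  also have "\<dots> = (\<Sum>t<q. \<Sum>u<q. if u = t then real q * (\<phi> t)\<^sup>2 else 0)"
  proof (intro sum.cong refl)
    fix t u assume "t \<in> {..<q}" "u \<in> {..<q}"
    then have "\<bar>int t - int u\<bar> < int q" by auto
    then have "int q dvd int t - int u \<longleftrightarrow> u = t"
      using zdvd_not_zless[of "int t - int u" "int q"] zdvd_not_zless[of "int u - int t" "int q"] dvd_diff_commute[of "int q" "int t" "int u"]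
      by (cases "int t - int u" "0 :: int" rule: linorder_cases) auto
    then show "(\<Sum>b<q. \<phi> t * \<phi> u * cosq q (int b * (int t - int u))) = (if u = t then real q * (\<phi> t)\<^sup>2 else 0)"
      by (simp add: sum_distrib_left[symmetric] sum_cosq[OF q] power2_eq_square)
  qed
  also have "\<dots> = real q * (\<Sum>t<q. (\<phi> t)\<^sup>2)" by (simp add: sum_distrib_left)
  finally show ?thesis .
qed

section \<open>Inverses in the half system and the cosine matrices\<close>

context odd_prime
begin

lemma q_pos: "q > 0"
  by (simp add: q_eq)

lemma dvd_mult_iff: "int q dvd x * y \<longleftrightarrow> int q dvd x \<or> int q dvd y"
  using prime_q by (simp add: prime_dvd_mult_iff)

text \<open>The frequencies k and q - k give the same cosine, so this is half of the complete sum
  without k = 0.\<close>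

lemma sum_half_cosq: "(\<Sum>k\<in>half. cosq q (int k * x)) = ((if int q dvd x then real q else 0) - 1) / 2"
proof -
  have img: "{h + 1..<q} = (\<lambda>k. q - k) ` half"
  proof (intro equalityI subsetI)
    fix k assume "k \<in> {h + 1..<q}"
    then show "k \<in> (\<lambda>k. q - k) ` half" by (intro image_eqI[of _ _ "q - k"]) (auto simp: half_def q_eq)
  qed (auto simp: half_def q_eq)
  have inj: "inj_on (\<lambda>k. q - k) half" by (auto simp: inj_on_def half_def q_eq)
  have "(\<Sum>k\<in>{h + 1..<q}. cosq q (int k * x)) = (\<Sum>k\<in>half. cosq q (int (q - k) * x))"
    unfolding img by (subst sum.reindex[OF inj]) simp
  also have "\<dots> = (\<Sum>k\<in>half. cosq q (int k * x))"
  proof (rule sum.cong[OF refl])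
    fix k assume "k \<in> half"
    then have "int (q - k) = int q - int k" by (auto simp: half_def q_eq)
    then have "pm_cong q (int (q - k) * x) (int k * x)" by (simp add: pm_cong_def algebra_simps)
    then show "cosq q (int (q - k) * x) = cosq q (int k * x)" using q_pos by (rule cosq_pm_cong[rotated])
  qed
  finally have e: "(\<Sum>k\<in>{h + 1..<q}. cosq q (int k * x)) = (\<Sum>k\<in>half. cosq q (int k * x))" .
  have "{..<q} = insert 0 (half \<union> {h + 1..<q})" by (auto simp: half_def q_eq)
  then have "(\<Sum>k<q. cosq q (int k * x)) = (\<Sum>k\<in>insert 0 (half \<union> {h + 1..<q}). cosq q (int k * x))" by simp
  also have "\<dots> = 1 + (\<Sum>k\<in>half \<union> {h + 1..<q}. cosq q (int k * x))"
    by (subst sum.insert) (auto simp: half_def)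
  also have "(\<Sum>k\<in>half \<union> {h + 1..<q}. cosq q (int k * x)) = 2 * (\<Sum>k\<in>half. cosq q (int k * x))"
  proof -
    have "half \<inter> {h + 1..<q} = {}" by (auto simp: half_def)
    then show ?thesis by (simp only: sum.union_disjoint finite_half finite_atLeastLessThan e mult_2)
  qed
  finally show ?thesis by (simp add: sum_cosq[OF q_pos])
qed

definition rep :: "int \<Rightarrow> nat" where
  "rep x = (THE k. k \<in> half \<and> pm_cong q x (int k))"

lemma rep:
  assumes "\<not> int q dvd x"
  shows "rep x \<in> half" "pm_cong q x (int (rep x))"
proof -
  define m where "m = x mod int q"
  have "m \<noteq> 0" using assms by (simp add: m_def dvd_eq_mod_eq_0)
  moreover have "0 \<le> m" "m < int q" using q_pos by (simp_all add: m_def)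
  ultimately have m: "0 < m" "m < int q" by simp_all
  have c: "int q dvd x - m" by (simp add: m_def)
  have half: "k \<in> half" if "1 \<le> int k" "int k \<le> int h" for k
    using that by (simp add: half_def)
  have "\<exists>k. k \<in> half \<and> pm_cong q x (int k)"
  proof (cases "m \<le> int h")
    case True
    have k: "int (nat m) = m" using m by simp
    have "nat m \<in> half" by (rule half, unfold k) (use m True in simp_all)
    moreover have "pm_cong q x (int (nat m))" unfolding k pm_cong_def using c by simp
    ultimately show ?thesis by blast
  next
    case False
    have d: "int q dvd x + (int q - m)" using dvd_add[OF c dvd_refl[of "int q"]] by (simp add: algebra_simps)
    have k: "int (nat (int q - m)) = int q - m" using m by simp
    have "nat (int q - m) \<in> half" by (rule half, unfold k) (use m False in \<open>simp_all add: q_eq\<close>)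
    moreover have "pm_cong q x (int (nat (int q - m)))" unfolding k pm_cong_def using d by simp
    ultimately show ?thesis by blast
  qed
  then obtain k where k: "k \<in> half" "pm_cong q x (int k)" by blast
  have "rep x = k" unfolding rep_def
  proof (rule the_equality)
    show "k \<in> half \<and> pm_cong q x (int k)" using k by simp
    show "k' = k" if "k' \<in> half \<and> pm_cong q x (int k')" for k'
      using that k pm_cong_half_eq[OF _ _ pm_cong_trans[OF pm_cong_sym]] by blast
  qed
  then show "rep x \<in> half" "pm_cong q x (int (rep x))" using k by simp_all
qed

lemma exists_inv: "\<exists>k. m \<in> half \<longrightarrow> k \<in> half \<and> pm_cong q (int m * int k) 1"
proof (cases "m \<in> half")
  case True
  have "1 \<in> half" using h_pos by (simp add: half_def)
  from exists_pm_multiple[OF True this] show ?thesis by (auto simp: mult.commute)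
qed simp

definition inv_half :: "nat \<Rightarrow> nat" where
  "inv_half m = (SOME k. m \<in> half \<longrightarrow> k \<in> half \<and> pm_cong q (int m * int k) 1)"

lemma inv_half: "m \<in> half \<Longrightarrow> inv_half m \<in> half" "m \<in> half \<Longrightarrow> pm_cong q (int m * int (inv_half m)) 1"
  using someI_ex[OF exists_inv[of m]] unfolding inv_half_def by simp_all

lemma pm_cong_mult: "pm_cong q x y \<Longrightarrow> pm_cong q (z * x) (z * y)"
  by (auto simp: pm_cong_def right_diff_distrib[symmetric] distrib_left[symmetric])

lemma pm_cong_cancel:
  assumes "\<not> int q dvd z" "pm_cong q (z * x) (z * y)"
  shows "pm_cong q x y"
  using assms unfolding pm_cong_def right_diff_distrib[symmetric] distrib_left[symmetric] dvd_mult_iff by blast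

lemma inv_half_inj:
  assumes "m \<in> half" "n \<in> half" "inv_half m = inv_half n"
  shows "m = n"
proof (rule pm_cong_half_eq[OF assms(1,2)])
  have "pm_cong q (int (inv_half m) * int m) (int (inv_half m) * int n)"
    using pm_cong_trans[OF inv_half(2)[OF assms(1)] pm_cong_sym[OF inv_half(2)[OF assms(2)]]] assms(3)
    by (simp add: mult.commute)
  then show "pm_cong q (int m) (int n)"
    using half_not_dvd[OF inv_half(1)[OF assms(1)]] by (rule pm_cong_cancel[rotated])
qed

text \<open>The Fourier coefficient at frequency b of the relation
  \<open>t' - t = \<plusminus> 1 / (m m')\<close>.\<close>

definition cos_matrix :: "nat \<Rightarrow> nat \<Rightarrow> nat \<Rightarrow> real" where
  "cos_matrix b m n = cosq q (int b * (int (inv_half m) * int (inv_half n)))"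

lemma cos_matrix_0 [simp]: "cos_matrix 0 m n = 1"
  by (simp add: cos_matrix_def)

lemma cos_matrix_sym: "cos_matrix b m n = cos_matrix b n m"
  by (simp add: cos_matrix_def mult.commute mult.left_commute)

lemma abs_cos_matrix_le_1: "\<bar>cos_matrix b m n\<bar> \<le> 1"
  by (simp add: cos_matrix_def abs_cosq_le_1)

text \<open>Multiplication by b and inversion permute the half system up to sign, so only the order
  of the rows depends on b. By orthogonality the Gram matrix of the columns is \<open>q/4\<close>
  times the identity minus half the all-ones matrix, and the subtracted form is nonnegative.\<close>

lemma norm_cos_matrix:
  assumes b: "0 < b" "b < q"
  shows "L2_set (mapply half (cos_matrix b) u) half \<le> sqrt (real q) / 2 * L2_set u half"
proof -
  have nb: "\<not> int q dvd int b" using b by (intro zdvd_not_zless) auto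
  let ?A = "\<lambda>y. \<Sum>n\<in>half. cosq q (y * int (inv_half n)) * u n"
  let ?r = "\<lambda>m. rep (int b * int (inv_half m))"
  have nd: "\<not> int q dvd int b * int (inv_half m)" if "m \<in> half" for m
    using nb half_not_dvd[OF inv_half(1)[OF that]] by (simp add: dvd_mult_iff)
  have inj: "inj_on ?r half"
  proof (rule inj_onI)
    fix m n assume m: "m \<in> half" and n: "n \<in> half" and "?r m = ?r n"
    then have "pm_cong q (int b * int (inv_half m)) (int (?r n))" using rep(2)[OF nd[OF m]] by simp
    then have "pm_cong q (int b * int (inv_half m)) (int b * int (inv_half n))"
      by (rule pm_cong_trans[OF _ pm_cong_sym[OF rep(2)[OF nd[OF n]]]])
    then have "pm_cong q (int (inv_half m)) (int (inv_half n))" by (rule pm_cong_cancel[OF nb])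
    then have "inv_half m = inv_half n" by (intro pm_cong_half_eq inv_half m n)
    then show "m = n" using m n inv_half_inj by blast
  qed
  have bij: "?r ` half = half"
    by (rule card_subset_eq[OF finite_half]) (use rep(1)[OF nd] card_image[OF inj] in auto)
  have "(L2_set (mapply half (cos_matrix b) u) half)\<^sup>2 = (\<Sum>m\<in>half. (?A (int b * int (inv_half m)))\<^sup>2)"
    by (simp add: L2_set_def sum_nonneg mapply_def cos_matrix_def mult.assoc)
  also have "\<dots> = (\<Sum>m\<in>half. (?A (int (?r m)))\<^sup>2)"
  proof (intro sum.cong refl arg_cong[where f = "\<lambda>x. x\<^sup>2"])
    fix m n assume "m \<in> half"
    have "pm_cong q (int (inv_half n) * (int b * int (inv_half m))) (int (inv_half n) * int (?r m))"
      by (rule pm_cong_mult[OF rep(2)[OF nd[OF \<open>m \<in> half\<close>]]])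
    then show "cosq q (int b * int (inv_half m) * int (inv_half n)) * u n = cosq q (int (?r m) * int (inv_half n)) * u n"
      using cosq_pm_cong[OF q_pos] by (simp add: mult.commute)
  qed
  also have "\<dots> = (\<Sum>k\<in>half. (?A (int k))\<^sup>2)"
    using sum.reindex[OF inj, of "\<lambda>k. (?A (int k))\<^sup>2"] bij by simp
  also have "\<dots> = (\<Sum>k\<in>half. \<Sum>n\<in>half. \<Sum>n'\<in>half. u n * u n' * (cosq q (int k * int (inv_half n)) * cosq q (int k * int (inv_half n'))))"
    by (simp add: power2_eq_square sum_product mult_ac)
  also have "\<dots> = (\<Sum>n\<in>half. \<Sum>n'\<in>half. \<Sum>k\<in>half. u n * u n' * (cosq q (int k * int (inv_half n)) * cosq q (int k * int (inv_half n'))))"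
    by (rule trans[OF sum.swap sum.cong[OF refl sum.swap]])
  also have "\<dots> = (\<Sum>n\<in>half. \<Sum>n'\<in>half. (if n' = n then real q / 4 * (u n)\<^sup>2 else 0) - u n * u n' / 2)"
  proof (intro sum.cong refl)
    fix n n' assume n: "n \<in> half" "n' \<in> half"
    let ?i = "int (inv_half n)" and ?j = "int (inv_half n')"
    have h: "inv_half n \<in> half" "inv_half n' \<in> half" using n inv_half by auto
    have "\<not> int q dvd ?i + ?j" using halfD[OF h(1)] halfD[OF h(2)] by (intro zdvd_not_zless) auto
    then have B: "(\<Sum>k\<in>half. cosq q (int k * (?i + ?j))) = - 1 / 2" by (simp add: sum_half_cosq)
    have "int q dvd ?i - ?j \<longleftrightarrow> n' = n"
      using pm_cong_half_eq[OF h] inv_half_inj[OF n] by (auto simp: pm_cong_def)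
    then have A: "(\<Sum>k\<in>half. cosq q (int k * (?i - ?j))) = ((if n' = n then real q else 0) - 1) / 2"
      by (simp only: sum_half_cosq)
    have "(\<Sum>k\<in>half. cosq q (int k * ?i) * cosq q (int k * ?j)) =
       ((\<Sum>k\<in>half. cosq q (int k * (?i - ?j))) + (\<Sum>k\<in>half. cosq q (int k * (?i + ?j)))) / 2"
      by (simp add: cosq_mult_cosq sum.distrib[symmetric] sum_divide_distrib distrib_left right_diff_distrib)
    then have S: "(\<Sum>k\<in>half. cosq q (int k * ?i) * cosq q (int k * ?j)) = (if n' = n then real q / 4 else 0) - 1 / 2"
      unfolding A B by (auto simp: field_simps)
    show "(\<Sum>k\<in>half. u n * u n' * (cosq q (int k * ?i) * cosq q (int k * ?j))) = (if n' = n then real q / 4 * (u n)\<^sup>2 else 0) - u n * u n' / 2"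
      unfolding sum_distrib_left[symmetric] S by (simp add: algebra_simps power2_eq_square)
  qed
  also have "\<dots> = real q / 4 * (\<Sum>n\<in>half. (u n)\<^sup>2) - (\<Sum>n\<in>half. u n)\<^sup>2 / 2"
  proof -
    have "(\<Sum>n\<in>half. \<Sum>n'\<in>half. u n * u n' / 2) = (\<Sum>n\<in>half. u n)\<^sup>2 / 2"
      by (simp only: power2_eq_square sum_product sum_divide_distrib)
    then show ?thesis by (simp add: sum_subtractf sum_distrib_left)
  qed
  also have "\<dots> \<le> real q / 4 * (\<Sum>n\<in>half. (u n)\<^sup>2)" by simp
  also have "\<dots> = (sqrt (real q) / 2 * L2_set u half)\<^sup>2"
    by (simp add: L2_set_def sum_nonneg power_mult_distrib power_divide)
  finally show ?thesis by (rule power2_le_imp_le) (simp add: L2_set_nonneg)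
qed

end

definition bilin :: "'a set \<Rightarrow> ('a \<Rightarrow> 'a \<Rightarrow> real) \<Rightarrow> ('a \<Rightarrow> real) \<Rightarrow> ('a \<Rightarrow> real) \<Rightarrow> real" where
  "bilin X M u v = (\<Sum>x\<in>X. u x * mapply X M v x)"

lemma abs_sum_mult_le: "\<bar>\<Sum>x\<in>X. u x * v x\<bar> \<le> L2_set u X * L2_set v X"
proof -
  have "\<bar>\<Sum>x\<in>X. u x * v x\<bar> \<le> (\<Sum>x\<in>X. \<bar>u x\<bar> * \<bar>v x\<bar>)" by (metis (no_types, lifting) abs_mult sum.cong sum_abs)
  also have "\<dots> \<le> L2_set u X * L2_set v X" by (rule L2_set_mult_ineq)
  finally show ?thesis .
qed

lemma abs_bilin_le:
  assumes "L2_set (mapply X M v) X \<le> d * L2_set v X"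
  shows "\<bar>bilin X M u v\<bar> \<le> d * (L2_set u X * L2_set v X)"
proof -
  have "\<bar>bilin X M u v\<bar> \<le> L2_set u X * L2_set (mapply X M v) X"
    unfolding bilin_def by (rule abs_sum_mult_le)
  also have "\<dots> \<le> L2_set u X * (d * L2_set v X)" by (intro mult_left_mono assms L2_set_nonneg)
  finally show ?thesis by (simp add: mult_ac)
qed

definition off_diag :: "('a \<Rightarrow> 'a \<Rightarrow> real) \<Rightarrow> 'a \<Rightarrow> 'a \<Rightarrow> real" where
  "off_diag M x y = (if x = y then 0 else M x y)"

text \<open>The removed diagonal has norm at most 1. It is the origin of the \<open>+ 1\<close> in
  \<open>sqrt q / 2 + 1\<close>.\<close>

lemma bilin_off_diag:
  assumes X: "finite X" and M: "\<And>x. \<bar>M x x\<bar> \<le> 1"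
  shows "\<bar>bilin X (off_diag M) u v - bilin X M u v\<bar> \<le> L2_set u X * L2_set v X"
proof -
  have "mapply X (off_diag M) v x = mapply X M v x - M x x * v x" if x: "x \<in> X" for x
  proof -
    have "(\<Sum>y\<in>X - {x}. off_diag M x y * v y) = (\<Sum>y\<in>X - {x}. M x y * v y)"
      by (rule sum.cong) (auto simp: off_diag_def)
    then show ?thesis unfolding mapply_def using X x by (simp add: sum.remove[of X x] off_diag_def)
  qed
  then have "bilin X (off_diag M) u v = (\<Sum>x\<in>X. u x * (mapply X M v x - M x x * v x))"
    unfolding bilin_def by (intro sum.cong refl) simp
  also have "\<dots> = bilin X M u v - (\<Sum>x\<in>X. u x * (M x x * v x))"
    by (simp add: bilin_def right_diff_distrib sum_subtractf)
  finally have "\<bar>bilin X (off_diag M) u v - bilin X M u v\<bar> = \<bar>\<Sum>x\<in>X. u x * (M x x * v x)\<bar>" by simp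
  also have "\<dots> \<le> L2_set u X * L2_set (\<lambda>x. M x x * v x) X" by (rule abs_sum_mult_le)
  also have "\<dots> \<le> L2_set u X * L2_set v X"
  proof (intro mult_left_mono L2_set_nonneg)
    have "(M x x * v x)\<^sup>2 \<le> (v x)\<^sup>2" for x
    proof -
      have "\<bar>M x x * v x\<bar> \<le> 1 * \<bar>v x\<bar>" unfolding abs_mult by (rule mult_right_mono[OF M]) simp
      then show ?thesis by (simp add: abs_le_square_iff[symmetric])
    qed
    then show "L2_set (\<lambda>x. M x x * v x) X \<le> L2_set v X"
      unfolding L2_set_def by (intro real_sqrt_le_mono sum_mono)
  qed
  finally show ?thesis .
qed

text \<open>The even parts carry the small norm \<open>a\<close> and, of total mass \<open>2p\<close>, at least half.\<close>

lemma weighted_sqrt_le: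
  fixes a d p r P P' Q Q' :: real
  assumes "0 \<le> a" "a \<le> d" "0 \<le> P" "0 \<le> P'" "0 \<le> Q" "0 \<le> Q'"
    "P + P' = 2 * p" "Q + Q' = 2 * r" "P' \<le> p" "Q' \<le> r"
  shows "a * (sqrt P * sqrt Q) + d * (sqrt P' * sqrt Q') \<le> (a + d) * sqrt (p * r)"
proof -
  have "(sqrt P * sqrt Q + sqrt P' * sqrt Q')\<^sup>2 \<le> (P + P') * (Q + Q')"
  proof -
    have "0 \<le> (sqrt P * sqrt Q' - sqrt P' * sqrt Q)\<^sup>2" by simp
    also have "\<dots> = P * Q' + P' * Q - 2 * (sqrt P * sqrt Q' * (sqrt P' * sqrt Q))"
      using assms by (simp add: power2_diff power_mult_distrib)
    finally have "2 * (sqrt P * sqrt Q * (sqrt P' * sqrt Q')) \<le> P * Q' + P' * Q" by (simp add: mult_ac)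
    moreover have "(sqrt P * sqrt Q + sqrt P' * sqrt Q')\<^sup>2 = P * Q + P' * Q' + 2 * (sqrt P * sqrt Q * (sqrt P' * sqrt Q'))"
      using assms by (simp add: power2_sum power_mult_distrib)
    ultimately show ?thesis by (simp add: algebra_simps)
  qed
  also have "\<dots> = 4 * (p * r)" using assms by simp
  finally have "sqrt P * sqrt Q + sqrt P' * sqrt Q' \<le> sqrt (4 * (p * r))" by (rule real_le_rsqrt)
  then have 1: "sqrt P * sqrt Q + sqrt P' * sqrt Q' \<le> 2 * sqrt (p * r)" by (simp add: real_sqrt_mult)
  have 2: "sqrt P' * sqrt Q' \<le> sqrt (p * r)"
    unfolding real_sqrt_mult using assms by (intro mult_mono real_sqrt_le_mono) auto
  \<comment> \<open>The weight a is applied to the whole Cauchy-Schwarz sum, at most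
    \<open>2 * sqrt (p r)\<close>; only the excess \<open>d - a\<close> meets the odd part, which is
    at most \<open>sqrt (p r)\<close>.\<close>
  have "a * (sqrt P * sqrt Q) + d * (sqrt P' * sqrt Q') = a * (sqrt P * sqrt Q + sqrt P' * sqrt Q') + (d - a) * (sqrt P' * sqrt Q')"
    by (simp add: algebra_simps)
  also have "\<dots> \<le> a * (2 * sqrt (p * r)) + (d - a) * sqrt (p * r)"
    using 1 2 assms by (intro add_mono mult_left_mono) auto
  finally show ?thesis by (simp add: algebra_simps)
qed

section \<open>The graph and its decomposition into waves\<close>

context odd_prime
begin

definition verts :: "(real \<times> nat \<times> nat) set" where
  "verts = {1, -1} \<times> half \<times> {..<q}"

fun adj :: "nat set set \<Rightarrow> real \<times> nat \<times> nat \<Rightarrow> real \<times> nat \<times> nat \<Rightarrow> bool" where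
  "adj S (s, m, t) (s', m', t') \<longleftrightarrow> m \<noteq> m' \<and> s * s' = sgn_of S {m, m'} \<and>
     pm_cong q (int t' - int t) (int (inv_half m) * int (inv_half m'))"

lemma finite_verts [simp]: "finite verts"
  by (simp add: verts_def)

lemma card_verts: "card verts = q * (q - 1)"
proof -
  have "card verts = 2 * (h * q)" by (simp add: verts_def card_cartesian_product)
  moreover have "q - 1 = 2 * h" by (simp add: q_eq)
  ultimately show ?thesis by (simp only: mult_ac)
qed

lemma sum_verts: "(\<Sum>x\<in>verts. \<phi> x) = (\<Sum>m\<in>half. \<Sum>t<q. \<phi> (1, m, t) + \<phi> (-1, m, t))" for \<phi> :: "_ \<Rightarrow> real"
proof -
  have "(\<Sum>x\<in>verts. \<phi> x) = (\<Sum>s\<in>{1, -1}. \<Sum>m\<in>half. \<Sum>t<q. \<phi> (s, m, t))"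
    unfolding verts_def by (simp only: sum.cartesian_product split_def prod.collapse)
  then show ?thesis by (simp add: sum.distrib)
qed

text \<open>Cosines and sines at all q frequencies are redundant, since b and q - b agree up to
  sign, but they still satisfy Parseval's identity with the factor q.\<close>

definition wave :: "nat \<times> bool \<Rightarrow> nat \<Rightarrow> real" where
  "wave i t = (if snd i then cosq q (int (fst i) * int t) else sinq q (int (fst i) * int t))"

abbreviation waves :: "(nat \<times> bool) set" where
  "waves \<equiv> {..<q} \<times> UNIV"

lemma sum_waves: "(\<Sum>i\<in>waves. \<phi> i) = (\<Sum>b<q. \<phi> (b, True) + \<phi> (b, False))" for \<phi> :: "_ \<Rightarrow> real"
proof -
  have "(\<Sum>i\<in>waves. \<phi> i) = (\<Sum>b<q. \<Sum>\<sigma>\<in>UNIV. \<phi> (b, \<sigma>))"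
    by (simp only: sum.cartesian_product split_def prod.collapse)
  then show ?thesis by (simp add: UNIV_bool add.commute)
qed

text \<open>Product-to-sum and orthogonality detect the two congruences \<open>d = c\<close> and
  \<open>d = -c\<close>; since q is odd and does not divide c, at most one of them holds.\<close>

lemma sum_pm_cong_cosq:
  assumes "\<not> int q dvd c"
  shows "(\<Sum>b<q. cosq q (int b * d) * cosq q (int b * c)) = (if pm_cong q d c then real q / 2 else 0)"
proof -
  have "\<not> (int q dvd d - c \<and> int q dvd d + c)"
  proof
    assume "int q dvd d - c \<and> int q dvd d + c"
    then have "int q dvd (d + c) - (d - c)" using dvd_diff[of "int q" "d + c" "d - c"] by blast
    then have "int q dvd 2 * c" by simp
    moreover have "\<not> int q dvd 2" using prime_q q_eq h_pos by (intro zdvd_not_zless) auto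
    ultimately show False using assms dvd_mult_iff by blast
  qed
  moreover have "(\<Sum>b<q. cosq q (int b * d) * cosq q (int b * c)) =
    ((\<Sum>b<q. cosq q (int b * (d - c))) + (\<Sum>b<q. cosq q (int b * (d + c)))) / 2"
    by (simp add: cosq_mult_cosq sum.distrib[symmetric] sum_divide_distrib distrib_left right_diff_distrib)
  ultimately show ?thesis by (auto simp: sum_cosq[OF q_pos] pm_cong_def)
qed

text \<open>Adjacency is \<open>(1 + s s' e) / 2\<close> times the indicator of the congruence. The
  latter is a sum of cosines in \<open>t' - t\<close>, which the addition formula splits into
  products of waves.\<close>

lemma adj_eq_sum_waves:
  assumes "(s, m, t) \<in> verts" "(s', m', t') \<in> verts"
  shows "(if adj S (s, m, t) (s', m', t') then 1 else 0) =
    (\<Sum>i\<in>waves. wave i t * wave i t' * (off_diag (cos_matrix (fst i)) m m' + s * s' * signed S (cos_matrix (fst i)) m m')) / real q"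
proof (cases "m = m'")
  case True
  then show ?thesis by (simp add: off_diag_def signed_def)
next
  case False
  let ?c = "int (inv_half m) * int (inv_half m')"
  have mm: "m \<in> half" "m' \<in> half" using assms by (auto simp: verts_def)
  have nc: "\<not> int q dvd ?c" using mm[THEN inv_half(1)] half_not_dvd by (simp add: dvd_mult_iff)
  have ss: "s * s' \<in> {1, -1}" using assms by (auto simp: verts_def)
  have e: "sgn_of S {m, m'} \<in> {1, -1}" by (simp add: sgn_of_def)
  have "(\<Sum>i\<in>waves. wave i t * wave i t' * (off_diag (cos_matrix (fst i)) m m' + s * s' * signed S (cos_matrix (fst i)) m m'))
    = (\<Sum>b<q. cosq q (int b * (int t' - int t)) * cosq q (int b * ?c) * (1 + s * s' * sgn_of S {m, m'}))"
    unfolding sum_waves using False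
    by (intro sum.cong refl) (simp add: wave_def off_diag_def signed_def cos_matrix_def cosq_diff right_diff_distrib algebra_simps)
  also have "\<dots> = (if pm_cong q (int t' - int t) ?c then real q / 2 else 0) * (1 + s * s' * sgn_of S {m, m'})"
    unfolding sum_distrib_right[symmetric] sum_pm_cong_cosq[OF nc] ..
  finally show ?thesis using False ss e q_pos by auto
qed

definition transf :: "(nat \<Rightarrow> real) \<Rightarrow> (nat \<Rightarrow> nat \<Rightarrow> real) \<Rightarrow> nat \<Rightarrow> real" where
  "transf w f m = (\<Sum>t<q. w t * f m t)"

definition even_part :: "(real \<times> nat \<times> nat \<Rightarrow> real) \<Rightarrow> nat \<Rightarrow> nat \<Rightarrow> real" where
  "even_part f m t = f (1, m, t) + f (-1, m, t)"

definition odd_part :: "(real \<times> nat \<times> nat \<Rightarrow> real) \<Rightarrow> nat \<Rightarrow> nat \<Rightarrow> real" where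
  "odd_part f m t = f (1, m, t) - f (-1, m, t)"

text \<open>A term independent of the signs sees only sums over s, and a term with the factor
  \<open>s s'\<close> only differences; this separates A from B.\<close>

lemma sum_verts_bilin:
  "(\<Sum>x\<in>verts. \<Sum>y\<in>verts. f x * g y * (w (snd (snd x)) * w (snd (snd y)) *
      (A (fst (snd x)) (fst (snd y)) + fst x * fst y * B (fst (snd x)) (fst (snd y))))) =
   bilin half A (transf w (even_part f)) (transf w (even_part g)) + bilin half B (transf w (odd_part f)) (transf w (odd_part g))"
proof -
  have bil: "bilin half M (transf w F) (transf w G) = (\<Sum>m\<in>half. \<Sum>t<q. \<Sum>m'\<in>half. \<Sum>t'<q. M m m' * (w t * F m t) * (w t' * G m' t'))" for M F G
  proof -
    have "transf w F m * mapply half M (transf w G) m = (\<Sum>t<q. \<Sum>m'\<in>half. \<Sum>t'<q. M m m' * (w t * F m t) * (w t' * G m' t'))" for m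
      unfolding transf_def mapply_def
      by (simp only: sum_product, intro sum.cong refl) (simp only: sum_distrib_left mult_ac)
    then show ?thesis by (simp only: bilin_def)
  qed
  show ?thesis
    unfolding bil sum.distrib[symmetric]
    unfolding sum_verts by (intro sum.cong refl, simp add: sum.distrib[symmetric], intro sum.cong refl)
      (simp add: even_part_def odd_part_def algebra_simps)
qed

lemma sum_transf_squares:
  "(\<Sum>i\<in>waves. \<Sum>m\<in>half. (transf (wave i) f m)\<^sup>2) = real q * (\<Sum>m\<in>half. \<Sum>t<q. (f m t)\<^sup>2)"
proof -
  have "(\<Sum>i\<in>waves. \<Sum>m\<in>half. (transf (wave i) f m)\<^sup>2) = (\<Sum>m\<in>half. \<Sum>i\<in>waves. (transf (wave i) f m)\<^sup>2)"
    by (rule sum.swap)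
  also have "\<dots> = (\<Sum>m\<in>half. real q * (\<Sum>t<q. (f m t)\<^sup>2))"
    unfolding sum_waves by (intro sum.cong refl) (simp add: transf_def wave_def parseval_cosq[OF q_pos, symmetric] mult.commute)
  finally show ?thesis by (simp only: sum_distrib_left)
qed

lemma sum_norm_transf_le:
  "(\<Sum>i\<in>waves. L2_set (transf (wave i) f) half * L2_set (transf (wave i) g) half) \<le>
    real q * (sqrt (\<Sum>m\<in>half. \<Sum>t<q. (f m t)\<^sup>2) * sqrt (\<Sum>m\<in>half. \<Sum>t<q. (g m t)\<^sup>2))"
proof -
  have n: "L2_set (\<lambda>i. L2_set (transf (wave i) F) half) waves = sqrt (real q) * sqrt (\<Sum>m\<in>half. \<Sum>t<q. (F m t)\<^sup>2)" for F
    unfolding real_sqrt_mult[symmetric] sum_transf_squares[symmetric] L2_set_def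
    by (intro arg_cong[where f = sqrt] sum.cong refl) (simp add: sum_nonneg)
  have "(\<Sum>i\<in>waves. L2_set (transf (wave i) f) half * L2_set (transf (wave i) g) half)
     \<le> \<bar>\<Sum>i\<in>waves. L2_set (transf (wave i) f) half * L2_set (transf (wave i) g) half\<bar>" by (rule abs_ge_self)
  also have "\<dots> \<le> L2_set (\<lambda>i. L2_set (transf (wave i) f) half) waves * L2_set (\<lambda>i. L2_set (transf (wave i) g) half) waves"
    by (rule abs_sum_mult_le)
  also have "\<dots> = (sqrt (real q) * sqrt (real q)) * (sqrt (\<Sum>m\<in>half. \<Sum>t<q. (f m t)\<^sup>2) * sqrt (\<Sum>m\<in>half. \<Sum>t<q. (g m t)\<^sup>2))"
    unfolding n by (simp only: mult_ac)
  finally show ?thesis by simp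
qed

text \<open>For each wave the even part has norm at most \<open>sqrt q / 2 + 1\<close>, apart from
  the main term, and the odd part at most d. Parseval sums over the waves, and
  \<open>weighted_sqrt_le\<close> combines the even and odd masses.\<close>

lemma adj_count:
  assumes d: "\<And>b u. b < q \<Longrightarrow> L2_set (mapply half (signed S (cos_matrix b)) u) half \<le> d * L2_set u half"
    and ad: "sqrt (real q) / 2 + 1 \<le> d"
    and P: "P \<subseteq> verts" and Q: "Q \<subseteq> verts"
  shows "\<bar>real (card {(x, y). x \<in> P \<and> y \<in> Q \<and> adj S x y}) - real (card P) * real (card Q) / real q\<bar>
    \<le> (sqrt (real q) / 2 + 1 + d) * sqrt (real (card P) * real (card Q))"
proof -
  define f where "f = (\<lambda>x. if x \<in> P then 1 else 0 :: real)"
  define g where "g = (\<lambda>x. if x \<in> Q then 1 else 0 :: real)"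
  let ?a = "sqrt (real q) / 2 + 1"
  let ?fe = "even_part f" and ?ge = "even_part g" and ?fo = "odd_part f" and ?go = "odd_part g"
  let ?A = "\<lambda>i. bilin half (off_diag (cos_matrix (fst i))) (transf (wave i) ?fe) (transf (wave i) ?ge)"
  let ?B = "\<lambda>i. bilin half (signed S (cos_matrix (fst i))) (transf (wave i) ?fo) (transf (wave i) ?go)"
  let ?T = "\<lambda>i x y. f x * g y * (wave i (snd (snd x)) * wave i (snd (snd y)) *
      (off_diag (cos_matrix (fst i)) (fst (snd x)) (fst (snd y)) + fst x * fst y * signed S (cos_matrix (fst i)) (fst (snd x)) (fst (snd y))))"
  let ?N = "\<lambda>i u. L2_set (transf (wave i) u) half"
  have cardf: "real (card R) = (\<Sum>x\<in>verts. if x \<in> R then 1 else 0)" if "R \<subseteq> verts" for R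
    using that by (simp add: sum.If_cases Int_absorb1)
  have "real (card {(x, y). x \<in> P \<and> y \<in> Q \<and> adj S x y}) = (\<Sum>x\<in>verts. \<Sum>y\<in>verts. f x * g y * (if adj S x y then 1 else 0))"
  proof -
    have "{(x, y). x \<in> P \<and> y \<in> Q \<and> adj S x y} = (verts \<times> verts) \<inter> {z. fst z \<in> P \<and> snd z \<in> Q \<and> adj S (fst z) (snd z)}"
      using P Q by auto
    then have "real (card {(x, y). x \<in> P \<and> y \<in> Q \<and> adj S x y}) = (\<Sum>z\<in>verts \<times> verts. if fst z \<in> P \<and> snd z \<in> Q \<and> adj S (fst z) (snd z) then 1 else 0)"
      by (simp add: sum.If_cases)
    also have "\<dots> = (\<Sum>x\<in>verts. \<Sum>y\<in>verts. if x \<in> P \<and> y \<in> Q \<and> adj S x y then 1 else 0)"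
      by (simp add: sum.cartesian_product split_def)
    also have "\<dots> = (\<Sum>x\<in>verts. \<Sum>y\<in>verts. f x * g y * (if adj S x y then 1 else 0))"
      by (intro sum.cong refl) (simp add: f_def g_def)
    finally show ?thesis .
  qed
  also have "\<dots> = (\<Sum>x\<in>verts. \<Sum>y\<in>verts. \<Sum>i\<in>waves. ?T i x y) / real q"
    unfolding sum_divide_distrib
  proof (intro sum.cong refl)
    fix x y assume xy: "x \<in> verts" "y \<in> verts"
    show "f x * g y * (if adj S x y then 1 else 0) = (\<Sum>i\<in>waves. ?T i x y / real q)"
      using adj_eq_sum_waves[of "fst x" "fst (snd x)" "snd (snd x)" "fst y" "fst (snd y)" "snd (snd y)" S] xy
      by (simp only: prod.collapse sum_distrib_left sum_divide_distrib times_divide_eq_right)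
  qed
  also have "(\<Sum>x\<in>verts. \<Sum>y\<in>verts. \<Sum>i\<in>waves. ?T i x y) = (\<Sum>i\<in>waves. \<Sum>x\<in>verts. \<Sum>y\<in>verts. ?T i x y)"
    by (rule trans[OF sum.cong[OF refl sum.swap] sum.swap])
  also have "\<dots> = (\<Sum>i\<in>waves. ?A i + ?B i)"
    by (simp only: sum_verts_bilin)
  finally have cnt: "real (card {(x, y). x \<in> P \<and> y \<in> Q \<and> adj S x y}) = (\<Sum>i\<in>waves. ?A i + ?B i) / real q" .
  let ?p = "real (card P)" and ?r = "real (card Q)"
  \<comment> \<open>At frequency 0 the cosine matrix is all ones and not small; the constant wave
    then yields the expected count \<open>|P| |Q| / q\<close>.\<close>
  define main where "main i = (if i = (0, True) then ?p * ?r else 0)" for i :: "nat \<times> bool"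
  have tot: "(\<Sum>m\<in>half. transf (wave (0, True)) (even_part F) m) = (\<Sum>x\<in>verts. F x)" for F
    by (simp add: transf_def wave_def even_part_def sum_verts)
  have A: "\<bar>?A i - main i\<bar> \<le> ?a * (?N i ?fe * ?N i ?ge)" if i: "i \<in> waves" for i
  proof -
    let ?u = "transf (wave i) ?fe" and ?v = "transf (wave i) ?ge"
    have 1: "\<bar>?A i - bilin half (cos_matrix (fst i)) ?u ?v\<bar> \<le> ?N i ?fe * ?N i ?ge"
      by (rule bilin_off_diag[OF finite_half abs_cos_matrix_le_1])
    have "\<bar>bilin half (cos_matrix (fst i)) ?u ?v - main i\<bar> \<le> sqrt (real q) / 2 * (?N i ?fe * ?N i ?ge)"
    proof (cases "fst i = 0")
      case True
      have "bilin half (cos_matrix (fst i)) ?u ?v = (\<Sum>m\<in>half. ?u m) * (\<Sum>m\<in>half. ?v m)"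
        unfolding bilin_def mapply_def by (simp add: True sum_distrib_right)
      moreover have "(\<Sum>m\<in>half. ?u m) * (\<Sum>m\<in>half. ?v m) = main i"
      proof (cases "snd i")
        case True
        then have "i = (0, True)" using \<open>fst i = 0\<close> by (cases i) simp
        then show ?thesis by (simp add: main_def tot f_def g_def cardf[OF P] cardf[OF Q])
      next
        case False
        then have "wave i = (\<lambda>_. 0)" using True by (auto simp: wave_def)
        then show ?thesis using False by (auto simp: main_def transf_def)
      qed
      ultimately show ?thesis by (simp add: L2_set_nonneg)
    next
      case False
      then have "main i = 0" by (auto simp: main_def)
      moreover have "\<bar>bilin half (cos_matrix (fst i)) ?u ?v\<bar> \<le> sqrt (real q) / 2 * (?N i ?fe * ?N i ?ge)"
        by (rule abs_bilin_le, rule norm_cos_matrix) (use False i in auto)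
      ultimately show ?thesis by simp
    qed
    note 2 = this
    have "\<bar>?A i - main i\<bar> \<le> \<bar>bilin half (cos_matrix (fst i)) ?u ?v - main i\<bar> + \<bar>?A i - bilin half (cos_matrix (fst i)) ?u ?v\<bar>"
      using abs_triangle_ineq[of "bilin half (cos_matrix (fst i)) ?u ?v - main i" "?A i - bilin half (cos_matrix (fst i)) ?u ?v"] by simp
    also have "\<dots> \<le> sqrt (real q) / 2 * (?N i ?fe * ?N i ?ge) + 1 * (?N i ?fe * ?N i ?ge)"
      by (intro add_mono 2) (simp only: mult_1_left 1)
    finally show ?thesis by (simp only: distrib_right)
  qed
  have B: "\<bar>?B i\<bar> \<le> d * (?N i ?fo * ?N i ?go)" if i: "i \<in> waves" for i
    by (rule abs_bilin_le, rule d) (use i in auto)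
  have "(\<Sum>i\<in>waves. main i) = ?p * ?r" using q_pos by (simp add: main_def sum.delta')
  then have E: "real (card {(x, y). x \<in> P \<and> y \<in> Q \<and> adj S x y}) - ?p * ?r / real q
    = (\<Sum>i\<in>waves. (?A i - main i) + ?B i) / real q"
    unfolding cnt by (simp add: sum.distrib sum_subtractf diff_divide_distrib add_divide_distrib)
  have "\<bar>(\<Sum>i\<in>waves. (?A i - main i) + ?B i) / real q\<bar> \<le> (\<Sum>i\<in>waves. ?a * (?N i ?fe * ?N i ?ge) + d * (?N i ?fo * ?N i ?go)) / real q"
  proof -
    have "\<bar>\<Sum>i\<in>waves. (?A i - main i) + ?B i\<bar> \<le> (\<Sum>i\<in>waves. \<bar>(?A i - main i) + ?B i\<bar>)" by (rule sum_abs)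
    also have "\<dots> \<le> (\<Sum>i\<in>waves. ?a * (?N i ?fe * ?N i ?ge) + d * (?N i ?fo * ?N i ?go))"
      by (intro sum_mono order_trans[OF abs_triangle_ineq] add_mono A B)
    finally show ?thesis unfolding abs_divide by (simp only: abs_of_nat) (rule divide_right_mono, assumption, simp)
  qed
  also have "\<dots> = (?a * (\<Sum>i\<in>waves. ?N i ?fe * ?N i ?ge) + d * (\<Sum>i\<in>waves. ?N i ?fo * ?N i ?go)) / real q"
    by (simp only: sum.distrib sum_distrib_left)
  also have "\<dots> \<le> (?a * (real q * (sqrt (\<Sum>m\<in>half. \<Sum>t<q. (?fe m t)\<^sup>2) * sqrt (\<Sum>m\<in>half. \<Sum>t<q. (?ge m t)\<^sup>2))) +
      d * (real q * (sqrt (\<Sum>m\<in>half. \<Sum>t<q. (?fo m t)\<^sup>2) * sqrt (\<Sum>m\<in>half. \<Sum>t<q. (?go m t)\<^sup>2)))) / real q"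
  proof -
    have "0 \<le> ?a" by simp
    moreover have "0 \<le> d" using ad \<open>0 \<le> ?a\<close> by linarith
    ultimately show ?thesis
      by (intro divide_right_mono add_mono mult_left_mono sum_norm_transf_le) auto
  qed
  also have "\<dots> = ?a * (sqrt (\<Sum>m\<in>half. \<Sum>t<q. (?fe m t)\<^sup>2) * sqrt (\<Sum>m\<in>half. \<Sum>t<q. (?ge m t)\<^sup>2)) +
      d * (sqrt (\<Sum>m\<in>half. \<Sum>t<q. (?fo m t)\<^sup>2) * sqrt (\<Sum>m\<in>half. \<Sum>t<q. (?go m t)\<^sup>2))"
    using q_pos by (simp add: add_divide_distrib)
  also have "\<dots> \<le> (?a + d) * sqrt (?p * ?r)"
  proof -
    \<comment> \<open>For the two vertices over one \<open>(m, t)\<close>, with indicator values x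
      and y in {0, 1}, \<open>(x + y)^2 + (x - y)^2 = 2 (x + y)\<close> and
      \<open>(x - y)^2 <= x + y\<close>.\<close>
    have sq: "(\<Sum>m\<in>half. \<Sum>t<q. (even_part F m t)\<^sup>2) + (\<Sum>m\<in>half. \<Sum>t<q. (odd_part F m t)\<^sup>2) = 2 * real (card R)"
        "(\<Sum>m\<in>half. \<Sum>t<q. (odd_part F m t)\<^sup>2) \<le> real (card R)"
      if R: "R \<subseteq> verts" and F: "F = (\<lambda>x. if x \<in> R then 1 else 0)" for F R
    proof -
      have c: "real (card R) = (\<Sum>m\<in>half. \<Sum>t<q. F (1, m, t) + F (-1, m, t))"
        unfolding cardf[OF R] F sum_verts ..
      show "(\<Sum>m\<in>half. \<Sum>t<q. (even_part F m t)\<^sup>2) + (\<Sum>m\<in>half. \<Sum>t<q. (odd_part F m t)\<^sup>2) = 2 * real (card R)"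
        unfolding c sum.distrib[symmetric] sum_distrib_left by (intro sum.cong refl) (simp add: even_part_def odd_part_def F)
      show "(\<Sum>m\<in>half. \<Sum>t<q. (odd_part F m t)\<^sup>2) \<le> real (card R)"
        unfolding c by (intro sum_mono) (simp add: odd_part_def F)
    qed
    show ?thesis
      by (rule weighted_sqrt_le[OF _ ad _ _ _ _ sq(1)[OF P f_def] sq(1)[OF Q g_def] sq(2)[OF P f_def] sq(2)[OF Q g_def]])
         (auto intro!: sum_nonneg)
  qed
  finally show ?thesis unfolding E .
qed

end

section \<open>Forbidden subgraphs\<close>

lemma pm_cong_iff_sign: "pm_cong q x c \<longleftrightarrow> (\<exists>d\<in>{1, -1}. int q dvd x - d * c)"
  by (simp add: pm_cong_def)

lemma pm_cong_mult_mono: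
  assumes "pm_cong q x x'" "pm_cong q y y'"
  shows "pm_cong q (x * y) (x' * y')"
proof -
  have m: "pm_cong q (z * a) (z * b)" if "pm_cong q a b" for a b z
    using that by (auto simp: pm_cong_def right_diff_distrib[symmetric] distrib_left[symmetric])
  have "pm_cong q (x * y) (x * y')" by (rule m[OF assms(2)])
  moreover have "pm_cong q (x * y') (x' * y')" using m[OF assms(1), of y'] by (simp only: mult.commute)
  ultimately show ?thesis by (rule pm_cong_trans)
qed

context odd_prime
begin

lemma adj_sym: "adj S x y \<Longrightarrow> adj S y x"
proof (cases x, cases y)
  fix s m t s' m' t' assume "adj S x y" "x = (s, m, t)" "y = (s', m', t')"
  then have a: "m \<noteq> m'" "s * s' = sgn_of S {m, m'}" "pm_cong q (int t' - int t) (int (inv_half m) * int (inv_half m'))" by auto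
  have "pm_cong q (int t - int t') (int (inv_half m') * int (inv_half m))"
    using a(3) unfolding pm_cong_def
  proof
    assume "int q dvd int t' - int t - int (inv_half m) * int (inv_half m')"
    then have "int q dvd - (int t' - int t - int (inv_half m) * int (inv_half m'))" by (simp only: dvd_minus_iff)
    then show "int q dvd int t - int t' - int (inv_half m') * int (inv_half m) \<or> int q dvd int t - int t' + int (inv_half m') * int (inv_half m)"
      by (simp add: algebra_simps)
  next
    assume "int q dvd int t' - int t + int (inv_half m) * int (inv_half m')"
    then have "int q dvd - (int t' - int t + int (inv_half m) * int (inv_half m'))" by (simp only: dvd_minus_iff)
    then show "int q dvd int t - int t' - int (inv_half m') * int (inv_half m) \<or> int q dvd int t - int t' + int (inv_half m') * int (inv_half m)"
      by (simp add: algebra_simps)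
  qed
  then show ?thesis using a \<open>x = _\<close> \<open>y = _\<close> by (simp add: mult.commute insert_commute)
qed

lemma adj_irrefl: "\<not> adj S x x"
  by (cases x) simp

lemma inv_half_cancel:
  assumes "m \<in> half" "n \<in> half" "pm_cong q x (int (inv_half m) * int (inv_half n))"
  shows "pm_cong q (int m * int n * z * x) z"
proof -
  have "pm_cong q (int m * int n * z * x) (int m * int n * z * (int (inv_half m) * int (inv_half n)))"
    by (rule pm_cong_mult[OF assms(3)])
  moreover have "int m * int n * z * (int (inv_half m) * int (inv_half n)) = (int m * int (inv_half m)) * (int n * int (inv_half n)) * z"
    by (simp only: mult_ac)
  moreover have "pm_cong q ((int m * int (inv_half m)) * (int n * int (inv_half n)) * z) (1 * 1 * z)"
    by (intro pm_cong_mult_mono inv_half(2) assms) (simp add: pm_cong_def)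
  ultimately show ?thesis using pm_cong_trans by simp
qed

text \<open>Multiplication by \<open>m1 m2 m3\<close> turns the differences of the t-coordinates
  into m3, m1, m2 up to sign. The differences are linearly dependent, so these form a Schur triple
  with sign product -1, while \<open>(s1 s2) (s2 s3) (s1 s3) = 1\<close>.\<close>

lemma adj_triangle_free:
  assumes S: "S \<in> schur_system.valid" and v: "x \<in> verts" "y \<in> verts" "z \<in> verts"
    and a: "adj S x y" "adj S y z" "adj S x z"
  shows False
proof -
  obtain s1 m1 t1 where x: "x = (s1, m1, t1)" by (cases x)
  obtain s2 m2 t2 where y: "y = (s2, m2, t2)" by (cases y)
  obtain s3 m3 t3 where z: "z = (s3, m3, t3)" by (cases z)
  have m: "m1 \<in> half" "m2 \<in> half" "m3 \<in> half" and ne: "m1 \<noteq> m2" "m2 \<noteq> m3" "m1 \<noteq> m3"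
    using v a by (auto simp: x y z verts_def)
  have s: "s1 \<in> {1, -1}" "s2 \<in> {1, -1}" "s3 \<in> {1, -1}" using v by (auto simp: x y z verts_def)
  let ?M = "int m1 * int m2 * int m3"
  have c12: "pm_cong q (int t2 - int t1) (int (inv_half m1) * int (inv_half m2))"
    and c23: "pm_cong q (int t3 - int t2) (int (inv_half m2) * int (inv_half m3))"
    and c13: "pm_cong q (int t3 - int t1) (int (inv_half m1) * int (inv_half m3))"
    using a by (simp_all add: x y z)
  have 1: "pm_cong q (?M * (int t2 - int t1)) (int m3)" using inv_half_cancel[OF m(1,2) c12, of "int m3"] by (simp only: mult_ac)
  have 2: "pm_cong q (?M * (int t3 - int t2)) (int m1)" using inv_half_cancel[OF m(2,3) c23, of "int m1"] by (simp only: mult_ac)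
  have 3: "pm_cong q (?M * (int t3 - int t1)) (int m2)" using inv_half_cancel[OF m(1,3) c13, of "int m2"] by (simp only: mult_ac)
  have "schur q (?M * (int t2 - int t1)) (?M * (int t3 - int t2)) (?M * (int t3 - int t1))"
    by (rule schurI[of 1 1 "-1"]) (simp_all add: algebra_simps)
  then have "schur q (int m3) (int m1) (int m2)" by (rule schur_cong) (rule 1 2 3)+
  then have sc: "schur q (int m1) (int m2) (int m3)" using schur_commute by blast
  have "{m1, m2, m3} \<in> schur_triples" unfolding schur_triples_def using m ne sc by blast
  then have "sgn_of S {m1, m2} * sgn_of S {m2, m3} * sgn_of S {m1, m3} = -1" by (rule schur_sgn_of[OF S])
  moreover have "sgn_of S {m1, m2} = s1 * s2" "sgn_of S {m2, m3} = s2 * s3" "sgn_of S {m1, m3} = s1 * s3"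
    using a by (simp_all add: x y z)
  ultimately show False using s by auto
qed

lemma nat_eq_if_dvd:
  assumes "t < q" "t' < q" "int q dvd int t - int t'"
  shows "t = t'"
proof (rule ccontr)
  assume "t \<noteq> t'"
  then have "int t - int t' \<noteq> 0" by simp
  from dvd_imp_le_int[OF this assms(3)] show False using assms(1,2) by simp
qed

text \<open>A common neighbour \<open>(r, k, \<tau>)\<close> of \<open>(s, m, t)\<close> and \<open>(s', m', t')\<close> satisfies
  \<open>t' - t \<equiv> k\<inverse> (d m\<inverse> - d' m'\<inverse>)\<close> with signs \<open>d, d'\<close>. As \<open>k\<close> lies in a half system, it is determined
  by \<open>d d'\<close>, so there are at most two common neighbours.\<close>

lemma common_neighbour_unique:
  assumes v: "(s, m, t) \<in> verts" "(s', m', t') \<in> verts" "(s, m, t) \<noteq> (s', m', t')"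
    and w1: "(r1, k1, u1) \<in> verts" "adj S (s, m, t) (r1, k1, u1)" "adj S (s', m', t') (r1, k1, u1)"
    and w2: "(r2, k2, u2) \<in> verts" "adj S (s, m, t) (r2, k2, u2)" "adj S (s', m', t') (r2, k2, u2)"
    and d: "d1 \<in> {1, -1}" "d1' \<in> {1, -1}" "d2 \<in> {1, -1}" "d2' \<in> {1, -1}" "d1 * d1' = d2 * d2'"
    and e1: "int q dvd (int u1 - int t) - d1 * (int (inv_half m) * int (inv_half k1))"
      "int q dvd (int u1 - int t') - d1' * (int (inv_half m') * int (inv_half k1))"
    and e2: "int q dvd (int u2 - int t) - d2 * (int (inv_half m) * int (inv_half k2))"
      "int q dvd (int u2 - int t') - d2' * (int (inv_half m') * int (inv_half k2))"
  shows "(r1, k1, u1) = (r2, k2, u2)"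
proof -
  define \<mu> \<mu>' \<kappa>1 \<kappa>2 where mu: "\<mu> = int (inv_half m)" "\<mu>' = int (inv_half m')" "\<kappa>1 = int (inv_half k1)" "\<kappa>2 = int (inv_half k2)"
  define D where "D = d1 * \<mu> - d1' * \<mu>'"
  define \<epsilon> where "\<epsilon> = d1 * d2"
  have half: "m \<in> half" "m' \<in> half" "k1 \<in> half" "k2 \<in> half" using v w1(1) w2(1) by (auto simp: verts_def)
  have lt: "t < q" "t' < q" "u1 < q" "u2 < q" using v w1(1) w2(1) by (auto simp: verts_def)
  have eps: "\<epsilon> \<in> {1, -1}" "d2 = \<epsilon> * d1" "d2' = \<epsilon> * d1'" using d by (auto simp: \<epsilon>_def)
  have k1: "int q dvd (int t' - int t) - \<kappa>1 * D"
    using dvd_diff[OF e1] by (simp add: D_def mu algebra_simps)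
  have k2: "int q dvd (int t' - int t) - \<epsilon> * \<kappa>2 * D"
    using dvd_diff[OF e2] unfolding eps(2,3) by (simp add: D_def mu algebra_simps)
  have "int q dvd D * (\<kappa>1 - \<epsilon> * \<kappa>2)"
    using dvd_diff[OF k2 k1] by (simp add: algebra_simps)
  \<comment> \<open>If D vanished modulo q, the two vertices would agree in t and m, and then in s
    because they share a neighbour.\<close>
  moreover have nD: "\<not> int q dvd D"
  proof
    assume D: "int q dvd D"
    then have "int q dvd (int t' - int t) - \<kappa>1 * D + \<kappa>1 * D" using k1 by (intro dvd_add dvd_mult)
    then have t: "t = t'" using nat_eq_if_dvd[OF lt(2,1)] by simp
    have "- d1' \<in> {1, -1}" using d(2) by auto
    moreover have "int q dvd d1 * \<mu> + (- d1') * \<mu>'" using D by (simp add: D_def)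
    ultimately have "pm_cong q \<mu> \<mu>'" by (intro pm_cong_signs[OF d(1)])
    then have "inv_half m = inv_half m'" unfolding mu by (intro pm_cong_half_eq inv_half half)
    then have m: "m = m'" by (rule inv_half_inj[OF half(1,2)])
    have "s * r1 = s' * r1" using w1(2,3) m by simp
    moreover have "r1 \<noteq> 0" using w1(1) by (auto simp: verts_def)
    ultimately show False using v(3) t m by simp
  qed
  ultimately have kk: "int q dvd \<kappa>1 - \<epsilon> * \<kappa>2" by (simp add: dvd_mult_iff)
  then have "pm_cong q \<kappa>1 \<kappa>2" unfolding pm_cong_iff_sign using eps(1) by blast
  then have "inv_half k1 = inv_half k2" unfolding mu by (intro pm_cong_half_eq inv_half half)
  then have k: "k1 = k2" by (rule inv_half_inj[OF half(3,4)])
  \<comment> \<open>Otherwise q would divide \<open>2 * \<kappa>1\<close>, with \<kappa>1 in the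
    half system.\<close>
  have "\<epsilon> = 1"
  proof (rule ccontr)
    assume "\<epsilon> \<noteq> 1"
    then have "int q dvd \<kappa>1 + \<kappa>1" using eps(1) kk k by (simp add: mu)
    moreover have "\<not> int q dvd \<kappa>1 + \<kappa>1"
      using halfD[OF inv_half(1)[OF half(3)]] by (intro zdvd_not_zless) (simp_all add: mu)
    ultimately show False by simp
  qed
  then have "d2 = d1" using eps by simp
  then have "int q dvd int u1 - int u2"
    using dvd_diff[OF e1(1) e2(1)] k by simp
  then have u: "u1 = u2" by (rule nat_eq_if_dvd[OF lt(3,4)])
  have "s * r1 = s * r2" using w1(2) w2(2) k by simp
  moreover have "s \<noteq> 0" using v(1) by (auto simp: verts_def)
  ultimately show ?thesis using k u by simp
qed

text \<open>The product of its two signs determines a common neighbour and takes only two values, so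
  of three common neighbours two coincide.\<close>

lemma adj_K23_free:
  assumes v: "x \<in> verts" "y \<in> verts" "x \<noteq> y" and w: "a \<in> verts" "b \<in> verts" "c \<in> verts" "a \<noteq> b" "b \<noteq> c" "a \<noteq> c"
    and ad: "adj S x a" "adj S x b" "adj S x c" "adj S y a" "adj S y b" "adj S y c"
  shows False
proof -
  obtain s m t where x: "x = (s, m, t)" by (cases x)
  obtain s' m' t' where y: "y = (s', m', t')" by (cases y)
  define sig where "sig z d d' \<longleftrightarrow> (\<exists>r k u. z = (r, k, u) \<and> d \<in> {1, -1} \<and> d' \<in> {1, -1} \<and>
      int q dvd (int u - int t) - d * (int (inv_half m) * int (inv_half k)) \<and>
      int q dvd (int u - int t') - d' * (int (inv_half m') * int (inv_half k)))" for z :: "real \<times> nat \<times> nat" and d d' :: int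
  have ex: "\<exists>d d'. sig z d d'" if "adj S x z" "adj S y z" for z
  proof -
    obtain r k u where z: "z = (r, k, u)" by (cases z)
    have "pm_cong q (int u - int t) (int (inv_half m) * int (inv_half k))" "pm_cong q (int u - int t') (int (inv_half m') * int (inv_half k))"
      using that by (simp_all add: x y z)
    then show ?thesis unfolding sig_def z pm_cong_iff_sign by blast
  qed
  have uniq: "z1 = z2" if z1: "z1 \<in> verts" "adj S x z1" "adj S y z1" "sig z1 d1 d1'" and z2: "z2 \<in> verts" "adj S x z2" "adj S y z2" "sig z2 d2 d2'"
      and p: "d1 * d1' = d2 * d2'" for z1 z2 d1 d1' d2 d2'
  proof -
    obtain r1 k1 u1 where 1: "z1 = (r1, k1, u1)" "d1 \<in> {1, -1}" "d1' \<in> {1, -1}"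
      "int q dvd (int u1 - int t) - d1 * (int (inv_half m) * int (inv_half k1))"
      "int q dvd (int u1 - int t') - d1' * (int (inv_half m') * int (inv_half k1))" using z1(4) unfolding sig_def by blast
    obtain r2 k2 u2 where 2: "z2 = (r2, k2, u2)" "d2 \<in> {1, -1}" "d2' \<in> {1, -1}"
      "int q dvd (int u2 - int t) - d2 * (int (inv_half m) * int (inv_half k2))"
      "int q dvd (int u2 - int t') - d2' * (int (inv_half m') * int (inv_half k2))" using z2(4) unfolding sig_def by blast
    show ?thesis unfolding 1(1) 2(1)
      by (rule common_neighbour_unique[OF v[unfolded x y] z1(1-3)[unfolded x y 1(1)] z2(1-3)[unfolded x y 2(1)] 1(2,3) 2(2,3) p 1(4,5) 2(4,5)])
  qed
  have unit: "d * d' \<in> {1, -1}" if "sig z d d'" for z d d' using that by (auto simp: sig_def)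
  obtain d1 e1 where 1: "sig a d1 e1" using ex ad by blast
  obtain d2 e2 where 2: "sig b d2 e2" using ex ad by blast
  obtain d3 e3 where 3: "sig c d3 e3" using ex ad by blast
  have "d1 * e1 = d2 * e2 \<or> d2 * e2 = d3 * e3 \<or> d1 * e1 = d3 * e3"
    using unit[OF 1] unit[OF 2] unit[OF 3] by auto
  then show False
    using uniq[OF w(1) ad(1,4) 1 w(2) ad(2,5) 2] uniq[OF w(2) ad(2,5) 2 w(3) ad(3,6) 3] uniq[OF w(1) ad(1,4) 1 w(3) ad(3,6) 3] w(4-6)
    by blast
qed

end

section \<open>Induced subgraphs on n vertices\<close>

context odd_prime
begin

text \<open>Intended for \<phi> injective into \<open>verts\<close>. Freeness and the jumbledness
  bound both pass to induced subgraphs, so which n vertices are chosen does not matter.\<close>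

definition schur_graph :: "nat set set \<Rightarrow> (nat \<Rightarrow> real \<times> nat \<times> nat) \<Rightarrow> nat \<Rightarrow> nat ugraph" where
  "schur_graph S \<phi> n = \<lparr>vertices = {..<n}, edges = {{i, j} | i j. i < n \<and> j < n \<and> adj S (\<phi> i) (\<phi> j)}\<rparr>"

lemma vertices_schur_graph [simp]: "vertices (schur_graph S \<phi> n) = {..<n}"
  by (simp add: schur_graph_def)

lemma edge_schur_graph_iff:
  "{i, j} \<in> edges (schur_graph S \<phi> n) \<longleftrightarrow> i < n \<and> j < n \<and> adj S (\<phi> i) (\<phi> j)"
proof
  assume "{i, j} \<in> edges (schur_graph S \<phi> n)"
  then obtain k l where kl: "{i, j} = {k, l}" "k < n" "l < n" "adj S (\<phi> k) (\<phi> l)" by (auto simp: schur_graph_def)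
  from kl(1) have "i = k \<and> j = l \<or> i = l \<and> j = k" by (simp only: doubleton_eq_iff)
  then show "i < n \<and> j < n \<and> adj S (\<phi> i) (\<phi> j)" using kl(2-4) adj_sym[OF kl(4)] by (elim disjE conjE) simp_all
qed (auto simp: schur_graph_def)

lemma simple_schur_graph: "simple_graph (schur_graph S \<phi> n)"
proof -
  have "e \<subseteq> {..<n} \<and> card e = 2" if "e \<in> edges (schur_graph S \<phi> n)" for e
  proof -
    from that obtain i j where ij: "e = {i, j}" "i < n" "j < n" "adj S (\<phi> i) (\<phi> j)" by (auto simp: schur_graph_def)
    then have "i \<noteq> j" using adj_irrefl by metis
    then show ?thesis using ij by simp
  qed
  then show ?thesis by (simp add: simple_graph_def)
qed

lemma schur_graph_free:
  assumes S: "S \<in> schur_system.valid" and inj: "inj_on \<phi> {..<n}" and im: "\<phi> ` {..<n} \<subseteq> verts"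
  shows "family_free {K3, K23} (schur_graph S \<phi> n)"
proof -
  have False if "contains_subgraph (schur_graph S \<phi> n) K3"
  proof -
    from that obtain f where f: "inj_on f {0, 1, 2}" "f ` {0, 1, 2} \<subseteq> {..<n}" "\<forall>e\<in>edges K3. f ` e \<in> edges (schur_graph S \<phi> n)"
      by (auto simp: contains_subgraph_def K3_def complete_graph_def)
    have e: "adj S (\<phi> (f i)) (\<phi> (f j))" if "i \<in> {0, 1, 2}" "j \<in> {0, 1, 2}" "i \<noteq> j" for i j
    proof -
      have "{i, j} \<in> edges K3" using that by (auto simp: K3_def complete_graph_def)
      then have "{f i, f j} \<in> edges (schur_graph S \<phi> n)" using f(3) by force
      then show ?thesis by (simp add: edge_schur_graph_iff)
    qed
    have v: "\<phi> (f i) \<in> verts" if "i \<in> {0, 1, 2}" for i using that f(2) im by blast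
    show False
      by (rule adj_triangle_free[OF S, of "\<phi> (f 0)" "\<phi> (f 1)" "\<phi> (f 2)"]) ((rule v e; simp)+)
  qed
  moreover have False if "contains_subgraph (schur_graph S \<phi> n) K23"
  proof -
    have V: "vertices K23 = {0, 1, 2, 3, 4}" by (auto simp: K23_def complete_bipartite_graph_def)
    from that obtain f where f: "inj_on f {0, 1, 2, 3, 4}" "f ` {0, 1, 2, 3, 4} \<subseteq> {..<n}" "\<forall>e\<in>edges K23. f ` e \<in> edges (schur_graph S \<phi> n)"
      unfolding contains_subgraph_def V by auto
    have e: "adj S (\<phi> (f i)) (\<phi> (f j))" if "i \<in> {0, 1}" "j \<in> {2, 3, 4}" for i j
    proof -
      have "{i, j} \<in> edges K23" using that by (auto simp: K23_def complete_bipartite_graph_def)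
      then have "{f i, f j} \<in> edges (schur_graph S \<phi> n)" using f(3) by force
      then show ?thesis by (simp add: edge_schur_graph_iff)
    qed
    have v: "\<phi> (f i) \<in> verts" if "i \<in> {0, 1, 2, 3, 4}" for i using that f(2) im by blast
    have ne: "\<phi> (f i) \<noteq> \<phi> (f j)" if "i \<in> {0, 1, 2, 3, 4}" "j \<in> {0, 1, 2, 3, 4}" "i \<noteq> j" for i j
    proof -
      have "f i \<noteq> f j" using that f(1) by (auto simp: inj_on_def)
      moreover have "f i \<in> {..<n}" "f j \<in> {..<n}" using that f(2) by blast+
      ultimately show ?thesis using inj by (auto simp: inj_on_def)
    qed
    show False
      by (rule adj_K23_free[of "\<phi> (f 0)" "\<phi> (f 1)" "\<phi> (f 2)" "\<phi> (f 3)" "\<phi> (f 4)"]) ((rule v ne e; simp)+)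
  qed
  ultimately show ?thesis by (auto simp: family_free_def)
qed

lemma edge_count_schur_graph:
  assumes inj: "inj_on \<phi> {..<n}" and X: "X \<subseteq> {..<n}" "Y \<subseteq> {..<n}"
  shows "edge_count (schur_graph S \<phi> n) X Y = card {(x, y). x \<in> \<phi> ` X \<and> y \<in> \<phi> ` Y \<and> adj S x y}"
proof -
  have "edge_count (schur_graph S \<phi> n) X Y = card {(x, y). x \<in> X \<and> y \<in> Y \<and> {x, y} \<in> edges (schur_graph S \<phi> n)}"
    by (rule edge_count_eq_card_pairs[OF simple_schur_graph]) (use X in auto)
  also have "{(x, y). x \<in> X \<and> y \<in> Y \<and> {x, y} \<in> edges (schur_graph S \<phi> n)} = {(x, y). x \<in> X \<and> y \<in> Y \<and> adj S (\<phi> x) (\<phi> y)}"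
    using X by (auto simp: edge_schur_graph_iff)
  also have "card \<dots> = card (map_prod \<phi> \<phi> ` {(x, y). x \<in> X \<and> y \<in> Y \<and> adj S (\<phi> x) (\<phi> y)})"
  proof (rule card_image[symmetric], rule inj_on_subset)
    show "inj_on (map_prod \<phi> \<phi>) ({..<n} \<times> {..<n})" by (rule map_prod_inj_on[OF inj inj])
  qed (use X in auto)
  also have "map_prod \<phi> \<phi> ` {(x, y). x \<in> X \<and> y \<in> Y \<and> adj S (\<phi> x) (\<phi> y)} = {(x, y). x \<in> \<phi> ` X \<and> y \<in> \<phi> ` Y \<and> adj S x y}"
  proof (intro equalityI subsetI)
    fix z assume "z \<in> {(x, y). x \<in> \<phi> ` X \<and> y \<in> \<phi> ` Y \<and> adj S x y}"
    then obtain x y where "x \<in> X" "y \<in> Y" "adj S (\<phi> x) (\<phi> y)" "z = (\<phi> x, \<phi> y)" by blast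
    then show "z \<in> map_prod \<phi> \<phi> ` {(x, y). x \<in> X \<and> y \<in> Y \<and> adj S (\<phi> x) (\<phi> y)}"
      by (intro image_eqI[of _ _ "(x, y)"]) simp_all
  next
    fix z assume "z \<in> map_prod \<phi> \<phi> ` {(x, y). x \<in> X \<and> y \<in> Y \<and> adj S (\<phi> x) (\<phi> y)}"
    then obtain p where p: "z = map_prod \<phi> \<phi> p" "p \<in> {(x, y). x \<in> X \<and> y \<in> Y \<and> adj S (\<phi> x) (\<phi> y)}" by (elim imageE)
    then show "z \<in> {(x, y). x \<in> \<phi> ` X \<and> y \<in> \<phi> ` Y \<and> adj S x y}" by (cases p) simp
  qed
  finally show ?thesis .
qed

text \<open>\<open>adj_count\<close> holds for all pairs of vertex subsets and gives jumbledness
  with \<open>p = 1/q\<close>. Applied to all n vertices it also counts the edges, since each of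
  them is counted twice.\<close>

lemma ex_rand_ge:
  assumes S: "S \<in> schur_system.valid"
    and d: "\<And>b u. b < q \<Longrightarrow> L2_set (mapply half (signed S (cos_matrix b)) u) half \<le> d * L2_set u half"
    and ad: "sqrt (real q) / 2 + 1 \<le> d"
    and n: "n \<le> q * (q - 1)" and \<alpha>: "\<alpha> = sqrt (real q) / 2 + 1 + d" "\<alpha> \<le> 2 * sqrt (real n * (1 / real q))"
  shows "real n * real n / real q / 2 - \<alpha> * real n / 2 \<le> real (ex_rand n 2 {K3, K23})"
proof -
  obtain \<psi> where \<psi>: "bij_betw \<psi> {0..<card verts} verts"
    using ex_bij_betw_nat_finite[OF finite_verts] by blast
  have inj: "inj_on \<psi> {..<n}"
    by (rule inj_on_subset[OF bij_betw_imp_inj_on[OF \<psi>]]) (use n in \<open>auto simp: card_verts\<close>)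
  have im: "\<psi> ` {..<n} \<subseteq> verts"
  proof -
    have "\<psi> ` {..<n} \<subseteq> \<psi> ` {0..<card verts}" by (rule image_mono) (use n in \<open>auto simp: card_verts\<close>)
    then show ?thesis unfolding bij_betw_imp_surj_on[OF \<psi>] .
  qed
  let ?G = "schur_graph S \<psi> n"
  have jum: "jumbled (1 / real q) \<alpha> ?G"
    unfolding jumbled_def
  proof (intro allI impI)
    fix X Y assume X: "X \<subseteq> vertices ?G" and Y: "Y \<subseteq> vertices ?G"
    then have XY: "X \<subseteq> {..<n}" "Y \<subseteq> {..<n}" by simp_all
    have c: "card (\<psi> ` X) = card X" "card (\<psi> ` Y) = card Y"
      using inj_on_subset[OF inj XY(1)] inj_on_subset[OF inj XY(2)] by (simp_all add: card_image)
    have "\<bar>real (edge_count ?G X Y) - real (card X) * real (card Y) / real q\<bar> \<le> \<alpha> * sqrt (real (card X) * real (card Y))"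
      unfolding edge_count_schur_graph[OF inj XY] \<alpha>(1) c[symmetric]
      by (rule adj_count[OF d ad]) (use XY im in auto)
    then show "\<bar>real (edge_count ?G X Y) - 1 / real q * real (card X) * real (card Y)\<bar> \<le> \<alpha> * sqrt (real (card X) * real (card Y))"
      by simp
  qed
  have "0 \<le> sqrt (real q) / 2 + 1" by simp
  with ad have "0 \<le> \<alpha>" unfolding \<alpha>(1) by linarith
  moreover have "0 \<le> 1 / real q" "1 / real q \<le> 1" using q_pos by simp_all
  ultimately have "\<exists>p \<alpha>. 0 \<le> p \<and> p \<le> 1 \<and> 0 \<le> \<alpha> \<and> \<alpha> \<le> 2 * sqrt (real n * p) \<and> jumbled p \<alpha> ?G"
    using jum \<alpha>(2) by blast
  then have mem: "?G \<in> ex_rand_graphs n 2 {K3, K23}"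
    using simple_schur_graph schur_graph_free[OF S inj im] unfolding ex_rand_graphs_def by simp
  have "card (edges ?G) \<le> ex_rand n 2 {K3, K23}"
    unfolding ex_rand_def by (rule Max_ge[OF finite_ex_rand_graphs]) (use mem in blast)
  moreover have "edge_count ?G {..<n} {..<n} = 2 * card (edges ?G)"
  proof -
    have e: "\<exists>x\<in>{..<n}. \<exists>y\<in>{..<n}. e = {x, y}" "e \<subseteq> {..<n} \<inter> {..<n}" if "e \<in> edges ?G" for e
      using that by (auto simp: schur_graph_def)
    have "{e \<in> edges ?G. \<exists>x\<in>{..<n}. \<exists>y\<in>{..<n}. e = {x, y}} = edges ?G" "{e \<in> edges ?G. e \<subseteq> {..<n} \<inter> {..<n}} = edges ?G"
      using e by blast+
    then show ?thesis unfolding edge_count_def by simp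
  qed
  moreover have "real n * real n / real q - \<alpha> * real n \<le> real (edge_count ?G {..<n} {..<n})"
  proof -
    have "\<bar>real (edge_count ?G {..<n} {..<n}) - 1 / real q * real (card {..<n}) * real (card {..<n})\<bar> \<le> \<alpha> * sqrt (real (card {..<n}) * real (card {..<n}))"
      by (rule jum[unfolded jumbled_def, rule_format]) simp_all
    then show ?thesis by (simp add: abs_le_iff)
  qed
  ultimately show ?thesis by simp
qed

lemma exists_small_norm:
  assumes j: "157464 * 2 ^ (14 * Suc j) \<le> root 6 (real h)" "4 * real h * real q \<le> (41 / 40) ^ (2 ^ Suc j)"
  shows "\<exists>S\<in>schur_system.valid. \<forall>b<q. \<forall>u. L2_set (mapply half (signed S (cos_matrix b)) u) half
    \<le> 41 / 40 * (2 * sqrt (real h)) * L2_set u half"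
proof -
  have "0 < root 6 (real h)" "root 6 (real h) ^ 6 = real (card half)" using h_pos by simp_all
  moreover have "4 * real (card half) * real (card {..<q}) \<le> (41 / 40) ^ (2 ^ Suc j)" using j(2) by (simp only: card_half card_lessThan)
  ultimately have "\<exists>S\<in>schur_system.valid. \<forall>b\<in>{..<q}. \<forall>u. L2_set (mapply half (signed S (cos_matrix b)) u) half
    \<le> 41 / 40 * (2 * sqrt (real (card half))) * L2_set u half"
    by (intro schur_system.exists_valid_small_norm[OF _ abs_cos_matrix_le_1 cos_matrix_sym _ _ j(1)]) simp_all
  then show ?thesis by (simp only: card_half lessThan_iff Ball_def)
qed

end

section \<open>The extremal bound\<close>

text \<open>The walk length \<open>2^(j + 1)\<close> must reach \<open>L h\<close> for the power of
  41/40, yet its 14th power must stay below \<open>h^(1/6)\<close> up to a constant. A power of 2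
  between \<open>L h\<close> and \<open>2 * (L h + 2)\<close> does both, as \<open>L h\<close> is
  logarithmic.\<close>

lemma eventually_walk_length:
  "\<forall>\<^sub>F h in sequentially. \<exists>j. 157464 * 2 ^ (14 * Suc j) \<le> root 6 (real h) \<and>
     4 * real h * real (2 * h + 1) \<le> (41 / 40) ^ (2 ^ Suc j)"
proof -
  define L where "L h = ln (4 * real h * real (2 * h + 1)) / ln (41 / 40)" for h :: nat
  have "\<forall>\<^sub>F h in sequentially. 157464 * (2 * (L h + 2)) ^ 14 \<le> real h powr (1 / 6)"
    unfolding L_def by real_asymp
  then show ?thesis using eventually_gt_at_top[of 0]
  proof eventually_elim
    case (elim h)
    have pos: "1 \<le> 4 * real h * real (2 * h + 1)"
    proof -
      have "1 * 1 \<le> 4 * real h * real (2 * h + 1)" using elim(2) by (intro mult_mono) auto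
      then show ?thesis by simp
    qed
    have L0: "0 \<le> L h" unfolding L_def using pos by (intro divide_nonneg_pos) auto
    define k where "k = nat \<lceil>L h\<rceil> + 1"
    have "real (nat \<lceil>L h\<rceil>) = of_int \<lceil>L h\<rceil>" using L0 by (intro of_nat_nat) simp
    then have k: "L h \<le> real k" "real k \<le> L h + 2" unfolding k_def of_nat_add of_nat_1 by linarith+
    obtain j where j: "2 ^ j \<le> k" "k < 2 ^ (j + 1)"
      using ex_power_ivl1[of 2 k] by (auto simp: k_def)
    have "real (2 ^ j) \<le> real k" using j(1) by (simp only: of_nat_le_iff)
    then have "(2 :: real) ^ j \<le> L h + 2" using k(2) by (simp only: of_nat_power of_nat_numeral)
    then have "(2 :: real) ^ Suc j \<le> 2 * (L h + 2)" unfolding power_Suc by (rule mult_left_mono) simp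
    then have "((2 :: real) ^ Suc j) ^ 14 \<le> (2 * (L h + 2)) ^ 14" by (intro power_mono) auto
    then have "157464 * 2 ^ (14 * Suc j) \<le> 157464 * (2 * (L h + 2)) ^ 14"
      by (simp only: power_mult[symmetric] mult.commute[of 14])
    also have "\<dots> \<le> real h powr (1 / 6)" by (rule elim(1))
    also have "\<dots> = root 6 (real h)" using elim(2) by (simp add: root_powr_inverse)
    finally have 1: "157464 * 2 ^ (14 * Suc j) \<le> root 6 (real h)" .
    have "real k \<le> real (2 ^ Suc j)" using j(2) by (simp only: of_nat_le_iff Suc_eq_plus1 less_imp_le)
    then have "L h \<le> real (2 ^ Suc j)" using k(1) by simp
    then have "L h * ln (41 / 40) \<le> real (2 ^ Suc j) * ln (41 / 40)" by (intro mult_right_mono) auto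
    then have "exp (ln (4 * real h * real (2 * h + 1))) \<le> exp (real (2 ^ Suc j) * ln (41 / 40))"
      by (simp add: L_def)
    also have "\<dots> = (41 / 40) ^ (2 ^ Suc j)"
    proof -
      have "exp (real N * ln (41 / 40)) = (41 / 40) ^ N" for N by (simp add: exp_of_nat_mult)
      then show ?thesis .
    qed
    finally have "4 * real h * real (2 * h + 1) \<le> (41 / 40) ^ (2 ^ Suc j)" using pos by simp
    then show ?case using 1 by blast
  qed
qed

lemma eventually_ex_rand_ge:
  assumes \<delta>: "\<delta> > 0"
  shows "\<forall>\<^sub>F n in sequentially. (1 / 2 - \<delta>) * real n powr (3 / 2) \<le> real (ex_rand n 2 {K3, K23})"
proof -
  \<comment> \<open>q may exceed \<open>sqrt n\<close> by the factor \<open>exp (3 d)\<close>. With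
    \<open>d <= \<delta>/3\<close> this costs at most a proportion \<delta> of the edges, and
    \<open>d <= 1/200\<close> keeps \<open>2 * (1 - 3 * d)\<close> at least 1.97.\<close>
  define d where "d = min (1 / 200) (\<delta> / 3)"
  have d: "0 < d" "d \<le> 1 / 200" "d \<le> \<delta> / 3" using \<delta> by (auto simp: d_def)
  obtain H where H: "\<And>h. h \<ge> H \<Longrightarrow> \<exists>j. 157464 * 2 ^ (14 * Suc j) \<le> root 6 (real h) \<and>
     4 * real h * real (2 * h + 1) \<le> (41 / 40) ^ (2 ^ Suc j)"
    using eventually_walk_length unfolding eventually_sequentially by blast
  have "\<forall>\<^sub>F y in at_top. \<exists>p. prime p \<and> p \<in> log_window y d" by (rule prime_in_log_window[OF d(1)])
  \<comment> \<open>The centre is shifted by \<open>2 * d\<close>, so the whole window lies above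
    \<open>sqrt n\<close> and \<open>q (q - 1)\<close> can reach n.\<close>
  moreover have "filterlim (\<lambda>n. ln (real n) / 2 + 2 * d) at_top sequentially" by real_asymp
  ultimately have "\<forall>\<^sub>F n in sequentially. \<exists>p. prime p \<and> p \<in> log_window (ln (real n) / 2 + 2 * d) d"
    by (rule eventually_compose_filterlim)
  moreover have "\<forall>\<^sub>F n in sequentially. real n powr (5 / 4) \<le> \<delta> / 2 * real n powr (3 / 2)"
    using \<delta> by real_asymp
  \<comment> \<open>The term with H makes walks of suitable length available, 10000 gives
    \<open>sqrt q >= 100\<close>, and the last term gives
    \<open>q * exp (-2 d) <= q - 1\<close>.\<close>
  moreover have "\<forall>\<^sub>F n in sequentially. 2 * real H + 1 + 10000 + 1 / (1 - exp (- 2 * d)) \<le> sqrt (real n)"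
    by real_asymp
  ultimately show ?thesis using eventually_gt_at_top[of 0]
  proof eventually_elim
    case (elim n)
    define r where "r = sqrt (real n)"
    have n0: "real n > 0" and r0: "r > 0" and rr: "r * r = real n" using elim(4) by (simp_all add: r_def)
    obtain q where q: "prime q" "q \<in> log_window (ln (real n) / 2 + 2 * d) d" using elim(1) by blast
    have er: "exp (ln (real n) / 2) = r"
      using n0 by (simp add: r_def ln_sqrt[symmetric])
    have "exp (ln (real n) / 2 + 2 * d - d) \<le> real q" "real q \<le> exp (ln (real n) / 2 + 2 * d + d)"
      using log_window_bounds[OF q(2)] by blast+
    then have qb: "r * exp d \<le> real q" "real q \<le> r * exp (3 * d)"
      by (simp_all add: exp_add[symmetric] er[symmetric] algebra_simps)
    have e1: "1 \<le> exp d" using d by simp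
    have "r * 1 \<le> r * exp d" by (intro mult_left_mono e1) (use r0 in simp)
    then have rq: "r \<le> real q" using qb(1) by linarith
    have em: "0 < 1 - exp (- 2 * d)" using d by simp
    have big: "2 * real H + 1 \<le> r" "10000 \<le> r" "1 / (1 - exp (- 2 * d)) \<le> r"
    proof -
      have gen: "2 * x + 1 \<le> r \<and> 10000 \<le> r \<and> z \<le> r" if "2 * x + 1 + 10000 + z \<le> r" "0 \<le> x" "0 \<le> z" for x z :: real
        using that by simp
      have "0 \<le> 1 / (1 - exp (- 2 * d))" using em by simp
      from gen[OF elim(3)[folded r_def] of_nat_0_le_iff this]
      show "2 * real H + 1 \<le> r" "10000 \<le> r" "1 / (1 - exp (- 2 * d)) \<le> r" by blast+
    qed
    have "q > 2" using rq big(2) by simp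
    then have "odd q" using q(1) prime_odd_nat by blast
    then obtain h where h: "q = 2 * h + 1" by (elim oddE) simp
    interpret odd_prime q h by unfold_locales (use q h in auto)
    have "H \<le> h"
    proof -
      have "2 * real H + 1 \<le> real q" using big(1) rq by (rule order_trans)
      then show ?thesis unfolding h by simp
    qed
    then obtain j where j: "157464 * 2 ^ (14 * Suc j) \<le> root 6 (real h)" "4 * real h * real q \<le> (41 / 40) ^ (2 ^ Suc j)"
      using H[of h] unfolding h by blast
    define D where "D = 41 / 40 * (2 * sqrt (real h))"
    obtain S where S: "S \<in> schur_system.valid"
      "\<And>b u. b < q \<Longrightarrow> L2_set (mapply half (signed S (cos_matrix b)) u) half \<le> D * L2_set u half"
      using exists_small_norm[OF j] unfolding D_def by blast
    define s where "s = sqrt (real q)"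
    have s: "s * s = real q" "s \<ge> 100"
    proof -
      show "s * s = real q" by (simp add: s_def)
      have "100\<^sup>2 \<le> real q" using big(2) rq by simp
      then show "s \<ge> 100" unfolding s_def by (rule real_le_rsqrt)
    qed
    \<comment> \<open>1.4145 is an upper bound for \<open>sqrt 2\<close>, and
      \<open>1.4145 * 41/40 < 1.45\<close>.\<close>
    have Dle: "D \<le> 29 / 20 * s"
    proof -
      have "(40 * D / 41)\<^sup>2 = 4 * real h" by (simp add: D_def power_mult_distrib)
      also have "\<dots> \<le> 2 * (s * s)" unfolding s(1) by (simp add: h)
      also have "\<dots> \<le> (1.4145 * s)\<^sup>2" by (simp add: power2_eq_square)
      finally have "40 * D / 41 \<le> 1.4145 * s" by (rule power2_le_imp_le) (use s in simp)
      then show ?thesis using s by simp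
    qed
    have Dge: "s / 2 + 1 \<le> D"
    proof -
      have "(s / 2 + 1)\<^sup>2 \<le> (40 * D / 41)\<^sup>2"
      proof -
        have "(40 * D / 41)\<^sup>2 = 4 * real h" by (simp add: D_def power_mult_distrib)
        also have "\<dots> = 2 * (s * s) - 2" unfolding s(1) by (simp add: h)
        finally have 1: "(40 * D / 41)\<^sup>2 = 2 * (s * s) - 2" .
        have "100 * s \<le> s * s" using s(2) by (intro mult_right_mono) auto
        moreover have "(s / 2 + 1)\<^sup>2 = s * s / 4 + s + 1" by (simp add: power2_eq_square field_simps)
        moreover have "w / 4 + s + 1 \<le> 2 * w - 2" if "100 * s \<le> w" for w
          using that s(2) by simp
        ultimately show ?thesis unfolding 1 by (simp only:)
      qed
      then have "s / 2 + 1 \<le> 40 * D / 41" by (rule power2_le_imp_le) (simp add: D_def)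
      also have "\<dots> \<le> D" by (simp add: D_def)
      finally show ?thesis .
    qed
    have nq: "n \<le> q * (q - 1)"
    proof -
      have "1 \<le> real q * (1 - exp (- 2 * d))"
      proof -
        have "1 / (1 - exp (- 2 * d)) \<le> real q" using big(3) rq by (rule order_trans)
        then show ?thesis using em by (simp add: pos_divide_le_eq)
      qed
      then have "real q * exp (- 2 * d) \<le> real q - 1" by (simp add: algebra_simps)
      then have 1: "real q * (real q * exp (- 2 * d)) \<le> real q * (real q - 1)" by (intro mult_left_mono) auto
      have "exp d * exp d * exp (- 2 * d) = 1" by (simp add: exp_add[symmetric])
      moreover have "(r * exp d) * (r * exp d) * exp (- 2 * d) = (r * r) * (exp d * exp d * exp (- 2 * d))"
        by (simp only: mult_ac)
      ultimately have "real n = (r * exp d) * (r * exp d) * exp (- 2 * d)" by (simp only: rr mult_1_right)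
      also have "\<dots> \<le> real q * real q * exp (- 2 * d)"
        using qb(1) r0 by (intro mult_right_mono mult_mono) auto
      also have "\<dots> = real q * (real q * exp (- 2 * d))" by (simp only: mult.assoc)
      also have "\<dots> \<le> real q * (real q - 1)" by (rule 1)
      also have "\<dots> = real (q * (q - 1))" using q_pos by (simp add: of_nat_diff)
      finally show ?thesis by (simp only: of_nat_le_iff)
    qed
    define \<alpha> where "\<alpha> = s / 2 + 1 + D"
    have e3: "exp (3 * d) * (1 - 3 * d) \<le> 1"
    proof -
      have "1 - 3 * d \<le> exp (- (3 * d))" using exp_ge_add_one_self[of "- (3 * d)"] by simp
      then have "exp (3 * d) * (1 - 3 * d) \<le> exp (3 * d) * exp (- (3 * d))" by (intro mult_left_mono) auto
      then show ?thesis by (simp add: exp_minus)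
    qed
    have nr: "real n * (1 / real q) = r * (r / real q)" using rr by simp
    have rqd: "1 - 3 * d \<le> r / real q"
    proof -
      have "real q * (1 - 3 * d) \<le> r * exp (3 * d) * (1 - 3 * d)" using qb(2) d by (intro mult_right_mono) auto
      also have "\<dots> \<le> r * 1" unfolding mult.assoc using e3 r0 by (intro mult_left_mono) auto
      finally show ?thesis using q_pos by (simp add: le_divide_eq mult.commute)
    qed
    have sq1: "s * (1 - 3 * d) \<le> sqrt (real n * (1 / real q))"
    proof (rule real_le_rsqrt)
      have "(s * (1 - 3 * d))\<^sup>2 = real q * ((1 - 3 * d) * (1 - 3 * d))" by (simp add: power2_eq_square s(1)[symmetric] mult_ac)
      also have "\<dots> \<le> real q * (r / real q * (r / real q))"
        using rqd d by (intro mult_left_mono mult_mono) auto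
      also have "\<dots> = real n * (1 / real q)" using q_pos rr by (simp add: field_simps)
      finally show "(s * (1 - 3 * d))\<^sup>2 \<le> real n * (1 / real q)" .
    qed
    have \<alpha>le: "\<alpha> \<le> 2 * sqrt (real n * (1 / real q))"
    proof -
      \<comment> \<open>\<open>1.45 + 0.5 = 1.95\<close>, and the margin up to 1.97 absorbs the
        additive 1 because \<open>s >= 100\<close>.\<close>
      have "\<alpha> \<le> 39 / 20 * s + 1" using Dle by (simp add: \<alpha>_def)
      also have "\<dots> \<le> 2 * (s * (197 / 200))" using s(2) by simp
      also have "\<dots> \<le> 2 * (s * (1 - 3 * d))" using d s(2) by (intro mult_left_mono) auto
      also have "\<dots> \<le> 2 * sqrt (real n * (1 / real q))" using sq1 by simp
      finally show ?thesis .
    qed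
    have main: "real n * real n / real q / 2 - \<alpha> * real n / 2 \<le> real (ex_rand n 2 {K3, K23})"
      by (rule ex_rand_ge[OF S(1) S(2) Dge[unfolded s_def] nq _ \<alpha>le]) (simp_all add: \<alpha>_def s_def)
    have p32: "real n powr (3 / 2) = real n * r"
      using n0 by (simp add: r_def powr_half_sqrt[symmetric] powr_add[symmetric] powr_mult_base)
    have "(1 - \<delta>) * (real n * r) \<le> real n * real n / real q"
    proof -
      have "(1 - \<delta>) * (real n * r) \<le> (1 - 3 * d) * (real n * r)" using d n0 r0 by (intro mult_right_mono) auto
      also have "\<dots> \<le> r / real q * (real n * r)" using rqd n0 r0 by (intro mult_right_mono) auto
      also have "\<dots> = real n * real n / real q" using rr by simp
      finally show ?thesis .
    qed
    note lower = this
    \<comment> \<open>The jumbledness error in the edge count is of order \<open>n^(5/4)\<close>,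
      negligible against \<open>n^(3/2)\<close>.\<close>
    have upper: "\<alpha> * real n / 2 \<le> \<delta> / 2 * (real n * r)"
    proof -
      have "sqrt (real n * (1 / real q)) \<le> sqrt r"
      proof (rule real_sqrt_le_mono)
        have "r * (r / real q) \<le> r * 1" using rq r0 q_pos by (intro mult_left_mono) auto
        then show "real n * (1 / real q) \<le> r" unfolding nr by simp
      qed
      also have "sqrt r = real n powr (1 / 4)" using n0 by (simp add: r_def powr_half_sqrt[symmetric] powr_powr)
      finally have "\<alpha> \<le> 2 * real n powr (1 / 4)" using \<alpha>le by simp
      then have "\<alpha> * real n \<le> 2 * real n powr (1 / 4) * real n" using n0 by (intro mult_right_mono) auto
      also have "\<dots> = 2 * real n powr (5 / 4)" using n0 powr_add[of "real n" "1 / 4" 1] by simp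
      finally show ?thesis using elim(2) by (simp add: p32)
    qed
    have "(1 / 2 - \<delta>) * (real n * r) = (1 - \<delta>) * (real n * r) / 2 - \<delta> / 2 * (real n * r)"
      by (simp add: field_simps)
    also have "\<dots> \<le> real n * real n / real q / 2 - \<alpha> * real n / 2"
      by (intro diff_mono divide_right_mono lower upper) simp
    also note main
    finally show ?case unfolding p32 .
  qed
qed

theorem theorem1p5:
  "\<exists>\<epsilon> :: nat \<Rightarrow> real. \<epsilon> \<in> o(\<lambda>_. 1) \<and>
     (\<forall>n. real (ex_rand n 2 {K3, K23}) \<ge> (1 / 2 - \<epsilon> n) * real n powr (3 / 2))"
proof -
  \<comment> \<open>The actual deficit, cut off at 0, so that the inequality holds for every n and
    not only eventually; at n = 0 the power of n vanishes.\<close>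
  define \<epsilon> where "\<epsilon> n = max 0 (1 / 2 - real (ex_rand n 2 {K3, K23}) / real n powr (3 / 2))" for n
  have "\<epsilon> \<longlonglongrightarrow> 0"
  proof (rule tendstoI)
    fix e :: real assume e: "e > 0"
    then have "e / 2 > 0" by simp
    from eventually_ex_rand_ge[OF this] eventually_gt_at_top[of 0]
    show "\<forall>\<^sub>F n in sequentially. dist (\<epsilon> n) 0 < e"
    proof eventually_elim
      case (elim n)
      then have "1 / 2 - e / 2 \<le> real (ex_rand n 2 {K3, K23}) / real n powr (3 / 2)"
        by (simp add: pos_le_divide_eq)
      moreover have "max 0 (1 / 2 - z) \<le> e / 2" if "1 / 2 - e / 2 \<le> z" for z
        using that e by (simp add: max_def)
      ultimately have "\<epsilon> n \<le> e / 2" unfolding \<epsilon>_def by blast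
      moreover have "0 \<le> \<epsilon> n" by (simp add: \<epsilon>_def)
      ultimately show ?case using e by (simp add: dist_real_def)
    qed
  qed
  then have "\<epsilon> \<in> o(\<lambda>_. 1)" by (intro smalloI_tendsto) simp_all
  moreover have "(1 / 2 - \<epsilon> n) * real n powr (3 / 2) \<le> real (ex_rand n 2 {K3, K23})" for n
  proof (cases "n = 0")
    case False
    have "1 / 2 - \<epsilon> n \<le> real (ex_rand n 2 {K3, K23}) / real n powr (3 / 2)" by (simp add: \<epsilon>_def)
    then show ?thesis using False by (simp add: pos_le_divide_eq)
  qed simp
  ultimately show ?thesis by blast
qed

end
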